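(* Let $n\ge1$, $c\ge0$ with $m:=n-c+1\ge2$, and let $\mathrm{Quad}^c_{\mathbb{A}}(n)$ be the set of connected non-negative unit forms in $n$ variables of corank $c$ and Dynkin type $\mathbb{A}_{n-c}$. The cycle type $\mathrm{ct}:\mathrm{Quad}^c_{\mathbb{A}}(n)\to\mathrm{Part}(m)$ is constant on strong Gram congruence classes and induces a bijection $$\mathrm{Quad}^c_{\mathbb{A}}(n)/\!\approx\;\longrightarrow\;\mathrm{Part}^c_1(m):=\{\pi\vdash m \mid 0\le c-(\ell(\pi)-1)\equiv 0 \bmod 2\},$$ where $\approx$ denotes strong Gram congruence. Moreover, if $\mathrm{ct}(q)=(\pi_1,\dots,\pi_\ell)$ for $q\in\mathrm{Quad}^c_{\mathbb{A}}(n)$, then: (i) $\varphi_q(\lambda)=(\lambda-1)^{c-1}\prod_{t=1}^{\ell}(\lambda^{\pi_t}-1)$; (ii) the Coxeter number of $q$ is $\pi_1$ if $\ell=1$ and $\infty$ otherwise; (iii) the reduced Coxeter number of $q$ is $\mathrm{lcm}(\pi_1,\dots,\pi_\ell)$; (iv) the geometric multiplicity of $1$ as an eigenvalue of $\Phi_q$ equals the corank $c$; (v) the reduced corank of $q$ is $\ell-1$, and the algebraic multiplicity of $1$ as an eigenvalue of $\Phi_q$ is $c+(\ell-1)$.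
   Context: An integral quadratic form $q:\mathbb{Z}^n\to\mathbb{Z}$ is a unit form if $q(\mathbf{e}_i)=1$ for all $i$; non-negative, connected (connected graph of nonzero off-diagonal coefficients) in the usual sense. $G_q$ is the symmetric Gram matrix of $\mathbb{b}_q(x,y)=q(x+y)-q(x)-q(y)$; $\check G_q$ is the upper triangular integer matrix with $q(x)=x^{\mathrm{tr}}\check G_qx$, and $\check{\mathbb{b}}_q(x,y)=x^{\mathrm{tr}}\check G_q y$. Strong Gram congruence: $\check G_{q'}=B^{\mathrm{tr}}\check G_qB$ with $B$ $\mathbb{Z}$-invertible. The radical is $\mathrm{rad}(q)=\ker G_q\subseteq\mathbb{Z}^n$, the corank is its rank. The reduced radical is $\mathrm{rad}_{re}(q)=\{x\in\mathrm{rad}(q)\mid y^{\mathrm{tr}}\check G_qx=0\ \forall y\in\mathrm{rad}(q)\}$ and its rank is the reduced corank. The Coxeter matrix is $\Phi_q=-\check G_q^{\mathrm{tr}}\check G_q^{-1}$, the Coxeter polynomial $\varphi_q$ its characteristic polynomial; the Coxeter number is the least $t>0$ with $\Phi_q^t=\mathrm{Id}$ ($\infty$ if none), and the reduced Coxeter number is the least $t>0$ with $\Phi_q^t-\mathrm{Id}$ nilpotent. Dynkin type: the unique simply-laced Dynkin diagram $\Delta$ such that the form induced by $q$ on $\mathbb{Z}^n/\mathrm{rad}(q)$ is equivalent to $q_\Delta$ ($G_{q_\Delta}=2\mathrm{Id}-\mathrm{Adj}(\Delta)$). A partition $\pi\vdash m$ is a nonincreasing sequence of positive integers summing to $m$;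 $\ell(\pi)$ is its length and $\mathrm{Part}(m)$ the set of partitions of $m$. Cycle type: for a quiver $Q$ with vertices $\{1,\dots,m\}$, arrows $\{1,\dots,n\}$, source/target maps $s,t$, its incidence matrix $I(Q)$ is the $m\times n$ matrix with $i$-th column $\mathbf{e}_{s(i)}-\mathbf{e}_{t(i)}$; $q_Q(x)=\frac12\|I(Q)x\|^2$; $\check G_Q:=\check G_{q_Q}$. Its Coxeter–Laplacian $\Lambda_Q=\mathrm{Id}_m-I(Q)\check G_Q^{-1}I(Q)^{\mathrm{tr}}$ is (a known fact) for connected loop-less $Q$ a permutation matrix $P(\xi)$ ($P(\xi)\mathbf{e}_v=\mathbf{e}_{\xi(v)}$); $\mathrm{ct}(Q)$ is the partition of $m$ given by the orbit sizes of $\xi$. Every $q\in\mathrm{Quad}^c_{\mathbb{A}}(n)$ equals $q_Q$ for some connected loop-less quiver $Q$ with $n$ arrows and $m$ vertices, and $\mathrm{ct}(q):=\mathrm{ct}(Q)$ does not depend on the choice of $Q$. *)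

theory Defs
  imports
    "Jordan_Normal_Form.Jordan_Normal_Form_Uniqueness"
    "Graph_Theory.Digraph_Component"
    "HOL-Algebra.Coset"
    "HOL-Combinatorics.Orbits"
    "HOL-Combinatorics.Permutations"
    "HOL-Computational_Algebra.Fraction_Field"
    "HOL-Computational_Algebra.Polynomial_Factorial"
    "HOL-Library.Extended_Nat"
    "HOL-Library.Multiset"
begin

section \<open>Integral quadratic forms\<close>

text \<open>
  A form \<open>q : \<int>\<^sup>n \<rightarrow> \<int>\<close> is a function on \<open>carrier_vec n\<close>, extensional outside of it so that
  equality of forms is equality in the logic. Coordinates are indexed by \<open>{0..<n}\<close>.
\<close>

definition integral_quadratic_form :: "nat \<Rightarrow> (int vec \<Rightarrow> int) \<Rightarrow> bool" where
  "integral_quadratic_form n q \<longleftrightarrow>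
     q \<in> extensional (carrier_vec n) \<and>
     (\<exists>A \<in> carrier_mat n n. \<forall>x \<in> carrier_vec n. q x = x \<bullet> (A *\<^sub>v x))"

definition unit_form :: "nat \<Rightarrow> (int vec \<Rightarrow> int) \<Rightarrow> bool" where
  "unit_form n q \<longleftrightarrow> integral_quadratic_form n q \<and> (\<forall>i<n. q (unit_vec n i) = 1)"

definition nonneg_form :: "nat \<Rightarrow> (int vec \<Rightarrow> int) \<Rightarrow> bool" where
  "nonneg_form n q \<longleftrightarrow> (\<forall>x \<in> carrier_vec n. 0 \<le> q x)"

definition polar_form :: "(int vec \<Rightarrow> int) \<Rightarrow> int vec \<Rightarrow> int vec \<Rightarrow> int" where
  "polar_form q x y = q (x + y) - q x - q y"

definition gram :: "nat \<Rightarrow> (int vec \<Rightarrow> int) \<Rightarrow> int mat" where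
  "gram n q = mat n n (\<lambda>(i, j). polar_form q (unit_vec n i) (unit_vec n j))"

definition tri_gram :: "nat \<Rightarrow> (int vec \<Rightarrow> int) \<Rightarrow> int mat" where
  "tri_gram n q = (THE A. A \<in> carrier_mat n n \<and> upper_triangular A \<and>
     (\<forall>x \<in> carrier_vec n. q x = x \<bullet> (A *\<^sub>v x)))"

definition connected_form :: "nat \<Rightarrow> (int vec \<Rightarrow> int) \<Rightarrow> bool" where
  "connected_form n q \<longleftrightarrow>
     (\<forall>i<n. \<forall>j<n. (i, j) \<in> {(k, l). k < n \<and> l < n \<and> k \<noteq> l \<and> gram n q $$ (k, l) \<noteq> 0}\<^sup>*)"

definition strong_gram_congruent :: "nat \<Rightarrow> (int vec \<Rightarrow> int) \<Rightarrow> (int vec \<Rightarrow> int) \<Rightarrow> bool" where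
  "strong_gram_congruent n q q' \<longleftrightarrow>
     (\<exists>B \<in> carrier_mat n n. invertible_mat B \<and>
        tri_gram n q' = transpose_mat B * tri_gram n q * B)"

section \<open>Radical and reduced radical\<close>

definition rad :: "nat \<Rightarrow> (int vec \<Rightarrow> int) \<Rightarrow> int vec set" where
  "rad n q = {x \<in> carrier_vec n. gram n q *\<^sub>v x = 0\<^sub>v n}"

definition reduced_rad :: "nat \<Rightarrow> (int vec \<Rightarrow> int) \<Rightarrow> int vec set" where
  "reduced_rad n q = {x \<in> rad n q. \<forall>y \<in> rad n q. y \<bullet> (tri_gram n q *\<^sub>v x) = 0}"

text \<open>The rank of a subgroup of \<open>\<int>\<^sup>n\<close>: the largest number of \<open>\<int>\<close>-independent elements.\<close>

definition int_rank :: "nat \<Rightarrow> int vec set \<Rightarrow> nat" where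
  "int_rank n L = Max {card S | S. finite S \<and> S \<subseteq> L \<and>
     \<not> module.lin_dep class_ring (module_vec TYPE(int) n) S}"

definition corank :: "nat \<Rightarrow> (int vec \<Rightarrow> int) \<Rightarrow> nat" where
  "corank n q = int_rank n (rad n q)"

definition reduced_corank :: "nat \<Rightarrow> (int vec \<Rightarrow> int) \<Rightarrow> nat" where
  "reduced_corank n q = int_rank n (reduced_rad n q)"

section \<open>Dynkin type\<close>

text \<open>
  The form \<open>q\<^sub>\<Delta>\<close> of a simple graph with vertices \<open>{0..<r}\<close> and (symmetric, irreflexive)
  adjacency relation \<open>E\<close>; its symmetric Gram matrix is \<open>2 Id - Adj(\<Delta>)\<close>, so each edge
  contributes the monomial \<open>- x\<^sub>i x\<^sub>j\<close> once.
\<close>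

definition graph_form :: "nat \<Rightarrow> (nat \<Rightarrow> nat \<Rightarrow> bool) \<Rightarrow> int vec \<Rightarrow> int" where
  "graph_form r E = (\<lambda>x \<in> carrier_vec r.
     (\<Sum>i<r. (x $ i)\<^sup>2) - (\<Sum>(i, j) \<in> {(i, j). i < j \<and> j < r \<and> E i j}. x $ i * x $ j))"

definition dynkin_A :: "nat \<Rightarrow> nat \<Rightarrow> bool" where
  "dynkin_A i j \<longleftrightarrow> j = Suc i \<or> i = Suc j"

text \<open>
  An isomorphism of abelian groups \<open>\<int>\<^sup>n / rad(q) \<cong> \<int>\<^sup>r\<close> that carries the induced form
  \<open>x + rad(q) \<mapsto> q(x)\<close> to \<open>q\<^sub>\<Delta>\<close>.
\<close>

definition has_dynkin_type ::
    "nat \<Rightarrow> (int vec \<Rightarrow> int) \<Rightarrow> nat \<Rightarrow> (nat \<Rightarrow> nat \<Rightarrow> bool) \<Rightarrow> bool" where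
  "has_dynkin_type n q r E \<longleftrightarrow>
     (\<exists>h \<in> iso (monoid_vec TYPE(int) n Mod rad n q) (monoid_vec TYPE(int) r).
        \<forall>x \<in> carrier_vec n. graph_form r E (h (rad n q #>\<^bsub>monoid_vec TYPE(int) n\<^esub> x)) = q x)"

definition Quad_A :: "nat \<Rightarrow> nat \<Rightarrow> (int vec \<Rightarrow> int) set" where
  "Quad_A c n = {q. unit_form n q \<and> nonneg_form n q \<and> connected_form n q \<and>
     corank n q = c \<and> has_dynkin_type n q (n - c) dynkin_A}"

definition strong_gram_rel :: "nat \<Rightarrow> nat \<Rightarrow> ((int vec \<Rightarrow> int) \<times> (int vec \<Rightarrow> int)) set" where
  "strong_gram_rel c n =
     {(q, q'). q \<in> Quad_A c n \<and> q' \<in> Quad_A c n \<and> strong_gram_congruent n q q'}"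

section \<open>Coxeter matrix\<close>

definition int_mat_inverse :: "nat \<Rightarrow> int mat \<Rightarrow> int mat" where
  "int_mat_inverse n A = (THE B. B \<in> carrier_mat n n \<and> inverts_mat A B \<and> inverts_mat B A)"

definition coxeter_mat :: "nat \<Rightarrow> (int vec \<Rightarrow> int) \<Rightarrow> int mat" where
  "coxeter_mat n q = - (transpose_mat (tri_gram n q) * int_mat_inverse n (tri_gram n q))"

definition coxeter_poly :: "nat \<Rightarrow> (int vec \<Rightarrow> int) \<Rightarrow> int poly" where
  "coxeter_poly n q = char_poly (coxeter_mat n q)"

text \<open>The infimum over the empty set is \<open>\<infinity>\<close>.\<close>

definition coxeter_number :: "nat \<Rightarrow> (int vec \<Rightarrow> int) \<Rightarrow> enat" where
  "coxeter_number n q = (INF t \<in> {t. 0 < t \<and> coxeter_mat n q ^\<^sub>m t = 1\<^sub>m n}. enat t)"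

definition nilpotent_mat :: "nat \<Rightarrow> int mat \<Rightarrow> bool" where
  "nilpotent_mat n A \<longleftrightarrow> (\<exists>k. A ^\<^sub>m k = 0\<^sub>m n n)"

definition reduced_coxeter_number :: "nat \<Rightarrow> (int vec \<Rightarrow> int) \<Rightarrow> enat" where
  "reduced_coxeter_number n q =
     (INF t \<in> {t. 0 < t \<and> nilpotent_mat n (coxeter_mat n q ^\<^sub>m t - 1\<^sub>m n)}. enat t)"

text \<open>Multiplicities of eigenvalues of an integer matrix, taken over \<open>\<complex>\<close>.\<close>

definition geom_mult :: "int mat \<Rightarrow> complex \<Rightarrow> nat" where
  "geom_mult A ev = kernel_dim (char_matrix (map_mat of_int A) ev)"

definition alg_mult :: "int mat \<Rightarrow> complex \<Rightarrow> nat" where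
  "alg_mult A ev = Polynomial.order ev (char_poly (map_mat of_int A))"

section \<open>Partitions\<close>

definition Part :: "nat \<Rightarrow> nat list set" where
  "Part m = {\<pi>. sorted_wrt (\<ge>) \<pi> \<and> (\<forall>k \<in> set \<pi>. 0 < k) \<and> sum_list \<pi> = m}"

definition Part1 :: "nat \<Rightarrow> nat \<Rightarrow> nat list set" where
  "Part1 c m = {\<pi> \<in> Part m.
     0 \<le> int c - (int (length \<pi>) - 1) \<and> (int c - (int (length \<pi>) - 1)) mod 2 = 0}"

definition orbit_partition :: "nat \<Rightarrow> (nat \<Rightarrow> nat) \<Rightarrow> nat list" where
  "orbit_partition m \<xi> =
     rev (sorted_list_of_multiset (image_mset card (mset_set (orbit \<xi> ` {..<m}))))"

section \<open>Quivers and cycle type\<close>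

definition quiver :: "nat \<Rightarrow> nat \<Rightarrow> (nat, nat) pre_digraph \<Rightarrow> bool" where
  "quiver m n Q \<longleftrightarrow> verts Q = {..<m} \<and> arcs Q = {..<n} \<and> wf_digraph Q"

definition incidence_mat :: "nat \<Rightarrow> nat \<Rightarrow> (nat, nat) pre_digraph \<Rightarrow> int mat" where
  "incidence_mat m n Q =
     mat_of_cols m (map (\<lambda>i. unit_vec m (tail Q i) - unit_vec m (head Q i)) [0..<n])"

text \<open>
  The division by 2 is exact: the entries of \<open>I(Q) x\<close> sum to 0, hence the sum of their squares is even.
\<close>

definition quiver_form :: "nat \<Rightarrow> nat \<Rightarrow> (nat, nat) pre_digraph \<Rightarrow> int vec \<Rightarrow> int" where
  "quiver_form m n Q = (\<lambda>x \<in> carrier_vec n.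
     ((incidence_mat m n Q *\<^sub>v x) \<bullet> (incidence_mat m n Q *\<^sub>v x)) div 2)"

definition coxeter_laplacian :: "nat \<Rightarrow> nat \<Rightarrow> (nat, nat) pre_digraph \<Rightarrow> int mat" where
  "coxeter_laplacian m n Q = 1\<^sub>m m -
     incidence_mat m n Q * int_mat_inverse n (tri_gram n (quiver_form m n Q)) *
       transpose_mat (incidence_mat m n Q)"

definition perm_mat :: "nat \<Rightarrow> (nat \<Rightarrow> nat) \<Rightarrow> int mat" where
  "perm_mat m \<xi> = mat_of_cols m (map (\<lambda>v. unit_vec m (\<xi> v)) [0..<m])"

definition quiver_cycle_type :: "nat \<Rightarrow> nat \<Rightarrow> (nat, nat) pre_digraph \<Rightarrow> nat list" where
  "quiver_cycle_type m n Q = orbit_partition m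
     (THE \<xi>. \<xi> permutes {..<m} \<and> coxeter_laplacian m n Q = perm_mat m \<xi>)"

text \<open>The description determines the value: it does not depend on the choice of \<open>Q\<close>.\<close>

definition cycle_type :: "nat \<Rightarrow> nat \<Rightarrow> (int vec \<Rightarrow> int) \<Rightarrow> nat list" where
  "cycle_type m n q = (THE \<pi>. \<exists>Q. quiver m n Q \<and> loopfree_digraph Q \<and>
     Digraph_Component.connected Q \<and> q = quiver_form m n Q \<and> \<pi> = quiver_cycle_type m n Q)"

end

theory Submission
  imports Defs "Jordan_Normal_Form.Jordan_Normal_Form_Existence"
begin

no_notation m_inv (\<open>(\<open>open_block notation=\<open>prefix inv\<close>\<close>inv\<index> _)\<close> [81] 80)

text \<open>
  A form \<open>q\<close> of Dynkin type A is \<open>x \<mapsto> |I x|\<^sup>2 / 2\<close> for the incidence matrix \<open>I\<close> of a quiver: the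
  columns of \<open>I\<close> are roots of \<open>A\<^bsub>m-1\<^esub>\<close>. With \<open>G\<close> the upper triangular Gram matrix, the
  Coxeter-Laplacian \<open>\<Lambda> = 1 - I G\<^sup>-\<^sup>1 I\<^sup>t\<^sup>r\<close> is a product of transpositions, one for each arrow, and
  \<open>\<Phi> = 1 - I\<^sup>t\<^sup>r I G\<^sup>-\<^sup>1\<close> satisfies \<open>\<Phi> I\<^sup>t\<^sup>r = I\<^sup>t\<^sup>r \<Lambda>\<close>; the spectral assertions follow, the
  characteristic polynomial by Sylvester's determinant identity. As \<open>\<Phi>\<close> is an invariant up to
  conjugation and its characteristic polynomial determines the cycle type, so is the cycle type.

  For completeness of the invariant, relabel the vertices such that both quivers have the same
  \<open>\<Lambda>\<close>. Restricted to the radical, \<open>G\<close> is alternating. Split off hyperbolic planes from both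
  radicals, over the integers, until the remaining part is contained in the image of
  \<open>G\<^sup>-\<^sup>1 I\<^sup>t\<^sup>r\<close>, on which both forms are determined by \<open>\<Lambda>\<close>. A linear map that is compatible
  with these splittings, \<open>I\<close> and \<open>G\<^sup>-\<^sup>1 I\<^sup>t\<^sup>r\<close> respects the Gram matrices up to an alternating error
  of the form \<open>I\<^sup>t\<^sup>r \<epsilon> I\<close>, and this error can be removed. Every admissible partition is attained
  by a path with multiple edges.
\<close>

section \<open>A ring with involution containing all integer matrices\<close>

text \<open>The obstacle is integrality. An alternating form over the integers may have arbitrary
  elementary divisors; on these radicals all nonzero ones are 1. Indeed, if the values of a radical
  vector \<open>k\<close> on the radical are divisible by d, then \<open>G k\<close> agrees modulo d
  with \<open>I^T f\<close> for a function f on the vertices, and f is invariant modulo d. A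
  permutation moves coordinates without changing values, so the residues of f are invariant over the
  integers as well. Their image under \<open>G\<^sup>-\<^sup>1 I\<^sup>t\<^sup>r\<close> lies in the
  radical and is orthogonal to it; after subtracting it, \<open>k\<close> is divisible by d inside
  the radical. The numbers of planes on the two sides are never compared: planes are matched until
  one radical is exhausted, which gives an isometry in one of the two directions, and unimodularity
  makes it invertible. The remaining error is constant on pairs of orbits. Being alternating, it
  vanishes within an orbit, so a linear order of the orbits writes it as \<open>F - F^T\<close> with
  an invariant \<open>F\<close>, and \<open>F\<close> dictates the correction.\<close>

text \<open>
  Matrices of all formats are embedded into a single ring, so that matrix identities can be
  verified by ring normalisation. An element of the ring is a pair of additive endomorphisms
  of \<open>\<nat> \<rightarrow> \<int>\<close>; a matrix is sent to the pair formed by its action and that of its transpose.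
\<close>

definition endo :: "((nat \<Rightarrow> int) \<Rightarrow> nat \<Rightarrow> int) \<Rightarrow> bool" where
  "endo f \<longleftrightarrow> (\<forall>x y. f (\<lambda>i. x i + y i) = (\<lambda>i. f x i + f y i))"

typedef biendo = "{(f, g). endo f \<and> endo g}"
  by (rule exI[of _ "(\<lambda>x. x, \<lambda>x. x)"]) (simp add: endo_def)

setup_lifting type_definition_biendo

instantiation biendo :: ring_1
begin
lift_definition zero_biendo :: biendo is "(\<lambda>x i. 0, \<lambda>x i. 0)" by (simp add: endo_def)
lift_definition one_biendo :: biendo is "(\<lambda>x. x, \<lambda>x. x)" by (simp add: endo_def)
lift_definition plus_biendo :: "biendo \<Rightarrow> biendo \<Rightarrow> biendo"
  is "\<lambda>(f, g) (f', g'). (\<lambda>x i. f x i + f' x i, \<lambda>x i. g x i + g' x i)"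
  by (auto simp: endo_def fun_eq_iff)
lift_definition uminus_biendo :: "biendo \<Rightarrow> biendo"
  is "\<lambda>(f, g). (\<lambda>x i. - f x i, \<lambda>x i. - g x i)"
  by (auto simp: endo_def fun_eq_iff)
lift_definition minus_biendo :: "biendo \<Rightarrow> biendo \<Rightarrow> biendo"
  is "\<lambda>(f, g) (f', g'). (\<lambda>x i. f x i - f' x i, \<lambda>x i. g x i - g' x i)"
  by (auto simp: endo_def fun_eq_iff)
text \<open>The second components compose in the opposite order, so that exchanging the components
  is an anti-automorphism, as transposition is.\<close>

lift_definition times_biendo :: "biendo \<Rightarrow> biendo \<Rightarrow> biendo"
  is "\<lambda>(f, g) (f', g'). (\<lambda>x. f (f' x), \<lambda>x. g' (g x))"
  by (auto simp: endo_def)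
instance
proof
  show "(0::biendo) \<noteq> 1" by transfer (auto simp: fun_eq_iff intro!: exI[of _ "\<lambda>i. 1"])
qed (transfer; auto simp: fun_eq_iff endo_def)+
end

lift_definition swap_biendo :: "biendo \<Rightarrow> biendo" is "\<lambda>(f, g). (g, f)" by auto

locale involutive_ring =
  fixes star :: "'a::ring_1 \<Rightarrow> 'a"
  assumes star_add: "star (x + y) = star x + star y"
    and star_mult: "star (x * y) = star y * star x"
    and star_star: "star (star x) = x"
begin

lemma star_zero: "star 0 = 0"
  using star_add[of 0 0] by simp

lemma star_uminus: "star (- x) = - star x"
  using star_add[of x "- x"] by (simp add: star_zero add_eq_0_iff)

lemma star_diff: "star (x - y) = star x - star y"
  using star_add[of x "- y"] by (simp add: star_uminus)

lemma star_one: "star 1 = 1"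
  by (metis mult.left_neutral mult.right_neutral star_mult star_star)

lemmas star_simps = star_add star_mult star_star star_zero star_uminus star_diff star_one

end

interpretation swap: involutive_ring swap_biendo
  by standard (transfer; auto simp: fun_eq_iff)+

text \<open>Truncation to \<open>dim_row A\<close> outputs and \<open>dim_col A\<close> inputs lets
  all formats act on one space. The price is that \<open>1\<^sub>m n\<close> becomes an idempotent,
  not the 1 of the ring; the element \<open>u\<close> of the locale below stands for it.\<close>

definition mat_act :: "int mat \<Rightarrow> (nat \<Rightarrow> int) \<Rightarrow> nat \<Rightarrow> int" where
  "mat_act A x i = (if i < dim_row A then \<Sum>j<dim_col A. A $$ (i, j) * x j else 0)"

lemma endo_mat_act: "endo (mat_act A)"
  unfolding endo_def mat_act_def
  by (auto simp: fun_eq_iff algebra_simps sum.distrib)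

lemma mat_act_mult:
  assumes "dim_col A = dim_row B"
  shows "mat_act (A * B) x = mat_act A (mat_act B x)"
proof
  fix i
  show "mat_act (A * B) x i = mat_act A (mat_act B x) i"
  proof (cases "i < dim_row A")
    case True
    have "mat_act (A * B) x i = (\<Sum>j<dim_col B. (\<Sum>k<dim_row B. A $$ (i, k) * B $$ (k, j)) * x j)"
      using True assms by (simp add: mat_act_def scalar_prod_def row_def col_def atLeast0LessThan)
    also have "\<dots> = (\<Sum>k<dim_row B. \<Sum>j<dim_col B. A $$ (i, k) * B $$ (k, j) * x j)"
      unfolding sum_distrib_right by (rule sum.swap)
    also have "\<dots> = (\<Sum>k<dim_row B. A $$ (i, k) * (\<Sum>j<dim_col B. B $$ (k, j) * x j))"
      unfolding sum_distrib_left by (simp only: mult.assoc)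
    also have "\<dots> = mat_act A (mat_act B x) i"
      using True assms by (simp add: mat_act_def)
    finally show ?thesis .
  qed (simp add: mat_act_def)
qed

lift_definition ring_emb :: "int mat \<Rightarrow> biendo" is "\<lambda>A. (mat_act A, mat_act (transpose_mat A))"
  by (simp add: endo_mat_act)

lemma ring_emb_mult:
  assumes "dim_col A = dim_row B"
  shows "ring_emb (A * B) = ring_emb A * ring_emb B"
proof -
  have "transpose_mat (A * B) = transpose_mat B * transpose_mat A"
    using assms by (intro transpose_mult) auto
  with assms show ?thesis
    by transfer (simp add: mat_act_mult fun_eq_iff)
qed

lemma ring_emb_add:
  "dim_row A = dim_row B \<Longrightarrow> dim_col A = dim_col B \<Longrightarrow> ring_emb (A + B) = ring_emb A + ring_emb B"
  by transfer (auto simp: mat_act_def fun_eq_iff algebra_simps sum.distrib)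

lemma ring_emb_diff:
  "dim_row A = dim_row B \<Longrightarrow> dim_col A = dim_col B \<Longrightarrow> ring_emb (A - B) = ring_emb A - ring_emb B"
  by transfer (auto simp: mat_act_def fun_eq_iff algebra_simps sum_subtractf)

lemma ring_emb_transpose: "ring_emb (transpose_mat A) = swap_biendo (ring_emb A)"
  by transfer simp

lemma ring_emb_zero: "ring_emb (0\<^sub>m r c) = 0"
  by transfer (auto simp: mat_act_def fun_eq_iff)

text \<open>The embedding does not see zero rows and columns at the end, so the formats are compared
  separately; the entries are recovered by acting on indicator functions.\<close>

lemma ring_emb_inj:
  assumes "ring_emb A = ring_emb B" "dim_row A = dim_row B" "dim_col A = dim_col B"
  shows "A = B"
proof (rule eq_matI)
  fix i j assume ij: "i < dim_row B" "j < dim_col B"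
  have "mat_act A (\<lambda>k. if k = j then 1 else 0) i = mat_act B (\<lambda>k. if k = j then 1 else 0) i"
    using assms(1) by transfer (auto simp: fun_eq_iff)
  then show "A $$ (i, j) = B $$ (i, j)"
    using ij assms by (simp add: mat_act_def if_distrib cong: if_cong)
qed (use assms in auto)

lemmas ring_emb_simps =
  ring_emb_mult ring_emb_add ring_emb_diff ring_emb_transpose ring_emb_zero

section \<open>Ring identities behind the classification\<close>

lemma mult_eq_assoc: "a * b = c \<Longrightarrow> a * (b * x) = c * (x::'a::semigroup_mult)"
  by (simp add: mult.assoc[symmetric])

text \<open>
  Elements \<open>x\<close> with \<open>u x = x = x u\<close> play the role of the \<open>n \<times> n\<close> matrices, \<open>K\<close> is the inverse of
  \<open>G\<close>, and \<open>S\<close> is a section of \<open>I\<close> on the lattice of vectors with coordinate sum 0. The pair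
  \<open>T\<close>, \<open>T'\<close> consists of mutually inverse isometries between nondegenerate sublattices of the
  radicals of both forms, extended by zero to the orthogonal complements.
\<close>

locale gram_pair = involutive_ring star
  for star :: "'a::ring_1 \<Rightarrow> 'a" +
  fixes u I I' G G' K K' S S' T T' :: 'a
  assumes GK: "G * K = u" "K * G = u" "G' * K' = u" "K' * G' = u"
    and unit: "star u = u" "I * u = I" "I' * u = I'" "u * S = S" "u * S' = S'" "u * T = T"
      "u * T' = T'" "T * u = T" "T' * u = T'" "u * G = G" "u * G' = G'" "G * u = G" "G' * u = G'"
      "u * K = K" "u * K' = K'"
    and sym: "G + star G = star I * I" "G' + star G' = star I' * I'"
    and section_eq: "I * S * I = I" "I * S * I' = I'" "I' * S' * I' = I'" "I' * S' * I = I"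
    and same: "I' * K' * star I' = I * K * star I"
    and TI: "I * T = 0" "I' * T' = 0"
    and adj: "star T * G = G' * T'"
    and TT: "T * T' * T = T" "T' * T * T' = T'"
begin

text \<open>Since \<open>G J = star I\<close>, pairing any \<open>x\<close> with \<open>J f\<close>
  under \<open>G\<close> depends only on \<open>I x\<close>. The product \<open>I J\<close> is the
  identity minus the Coxeter-Laplacian, hence common to both sides.\<close>

definition "J = K * star I"
definition "J' = K' * star I'"

lemma star_unit: "u * star I = star I" "u * star I' = star I'"
  using unit(2,3) by (metis star_mult unit(1))+

lemma GJ: "G * J = star I" "G' * J' = star I'"
  by (simp_all add: J_def J'_def mult.assoc[symmetric] GK star_unit)

lemma IJ: "I' * J' = I * J"
  using same by (simp add: J_def J'_def mult.assoc)

text \<open>For matrices, \<open>star (I' S')\<close> changes a function on the vertices only by a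
  constant, and constants are killed by \<open>star I\<close> and \<open>star I'\<close>.\<close>

lemma Jsec: "J * (star S' * star I') = J" "J' * (star S' * star I') = J'"
proof -
  have "star I * star S' * star I' = star I" using section_eq(4)
    by (metis star_mult mult.assoc)
  then show "J * (star S' * star I') = J" by (simp add: J_def mult.assoc)
  have "star I' * star S' * star I' = star I'" using section_eq(3)
    by (metis star_mult mult.assoc)
  then show "J' * (star S' * star I') = J'" by (simp add: J'_def mult.assoc)
qed

lemma starGT: "star G * T = - (G * T)" "star G' * T' = - (G' * T')"
proof -
  have "(G + star G) * T = 0" by (simp add: sym TI mult.assoc)
  then show "star G * T = - (G * T)" by (simp add: algebra_simps add_eq_0_iff)
  have "(G' + star G') * T' = 0" by (simp add: sym TI mult.assoc)
  then show "star G' * T' = - (G' * T')" by (simp add: algebra_simps add_eq_0_iff)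
qed

text \<open>The two signs that skewness on the radicals contributes cancel, so the adjunction also
  holds with the sides exchanged.\<close>

lemma adj': "G * T = star T' * G'"
proof -
  have "star G * T = star T' * star G'" using arg_cong[OF adj, of star] by (simp add: star_simps)
  moreover have "star T' * G' = - (star T' * star G')"
    using arg_cong[OF starGT(2), of star] by (simp add: star_simps)
  ultimately show ?thesis using starGT(1) by (metis add.inverse_inverse)
qed

text \<open>By the adjunction \<open>T = K (star T' G')\<close>, and \<open>G' J' = star I'\<close>
  is annihilated by \<open>star T'\<close> because \<open>I' T' = 0\<close>. Geometrically, the
  parts already matched are orthogonal to the images of \<open>J\<close> and
  \<open>J'\<close>.\<close>

lemma TJ: "T * J' = 0" "T' * J = 0"
proof -
  have z: "star T' * star I' = 0" "star T * star I = 0"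
    using TI by (metis star_mult star_zero)+
  have "T * J' = K * (G * T) * J'" by (simp add: mult.assoc[symmetric] GK unit)
  also have "\<dots> = K * (star T' * (G' * J'))" by (simp add: adj' mult.assoc)
  also have "\<dots> = 0" by (simp add: GJ z)
  finally show "T * J' = 0" .
  have "T' * J = K' * (G' * T') * J" by (simp add: mult.assoc[symmetric] GK unit)
  also have "\<dots> = K' * (star T * (G * J))" by (simp add: adj[symmetric] mult.assoc)
  also have "\<dots> = 0" by (simp add: GJ z)
  finally show "T' * J = 0" .
qed

text \<open>Two demands determine the shape: \<open>X0 J' = J\<close> and \<open>I X0 = I'\<close>.
  The first summand reads the vertex function off \<open>J' f\<close>, up to a constant that
  \<open>J\<close> kills, and applies \<open>J\<close>; the second lifts the rest of
  \<open>I'\<close> through the section \<open>S\<close>.\<close>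

definition "X0 = J * (star S' * G') + S * (I' * (1 - J' * (star S' * G')))"
text \<open>\<open>T' T\<close> and \<open>T T'\<close> are the projectors onto the matched
  sublattices. The map is \<open>T\<close> on the matched part and \<open>X0\<close>, compressed to
  the complements, elsewhere.\<close>

definition "X1 = T + (1 - T * T') * (X0 * (1 - T' * T))"
definition "E = star X1 * (G * X1) - G'"

lemma I_X0: "I * X0 = I'"
  unfolding X0_def
proof -
  have s: "I * (S * I') = I'" "I * (S * (I' * x)) = I' * x" for x
    using section_eq(2) by (simp_all add: mult.assoc[symmetric])
  have "I * (J * x) = I' * (J' * x)" for x using IJ by (simp add: mult.assoc[symmetric])
  then show "I * (J * (star S' * G') + S * (I' * (1 - J' * (star S' * G')))) = I'"
    by (simp add: algebra_simps s)
qed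

lemma X0_J': "X0 * J' = J"
  unfolding X0_def
  by (simp add: algebra_simps GJ Jsec)

lemma I_X1: "I * X1 = I'"
  unfolding X1_def
  by (simp add: algebra_simps TI mult_eq_assoc[OF TI(1)] mult_eq_assoc[OF I_X0] I_X0
      mult_eq_assoc[OF TI(2)])

lemma X1_J': "X1 * J' = J"
  unfolding X1_def
  by (simp add: algebra_simps TJ X0_J')

lemma X1_T': "X1 * T' = T * T'"
  unfolding X1_def by (simp add: algebra_simps TT[unfolded mult.assoc])

lemma T'_X1: "T' * X1 = T' * T"
  unfolding X1_def by (simp add: algebra_simps mult_eq_assoc[OF TT(2), unfolded mult.assoc])

text \<open>The symmetrised form \<open>G + star G\<close> is \<open>star I I\<close>, so its
  pullback along \<open>X1\<close> depends on \<open>I X1\<close> alone and equals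
  \<open>G' + star G'\<close>.\<close>

lemma star_E: "star E = - E"
proof -
  have "E + star E = star X1 * ((G + star G) * X1) - (G' + star G')"
    by (simp add: E_def star_simps algebra_simps)
  also have "star X1 * ((G + star G) * X1) = star (I * X1) * (I * X1)"
    by (simp add: sym star_simps mult.assoc)
  finally have "E + star E = 0" by (simp add: I_X1 sym)
  then show ?thesis by (simp add: add_eq_0_iff)
qed

text \<open>\<open>X1\<close> carries \<open>J'\<close> to \<open>J\<close>, and pairing with
  \<open>J\<close> sees a vector only through \<open>I\<close>, which \<open>X1\<close> transports
  to \<open>I'\<close>.\<close>

lemma E_J': "E * J' = 0"
proof -
  have "E * J' = star X1 * (G * (X1 * J')) - G' * J'" by (simp add: E_def algebra_simps)
  also have "\<dots> = star (I * X1) - star I'" by (simp add: X1_J' GJ star_simps)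
  finally show ?thesis by (simp add: I_X1)
qed

text \<open>On the matched sublattice \<open>X1\<close> agrees with \<open>T\<close>. Its pairings
  with arbitrary vectors are preserved too, because by adjunction they are seen through
  \<open>T' X1 = T' T\<close>.\<close>

lemma E_T': "E * T' = 0"
proof -
  have "E * T' = star X1 * (G * T * T') - G' * T'" by (simp add: E_def algebra_simps X1_T')
  also have "star X1 * (G * T * T') = star (T' * X1) * (G' * T')"
    by (simp add: adj' star_simps mult.assoc)
  also have "\<dots> = star T * ((star T' * G') * T')" by (simp add: T'_X1 star_simps mult.assoc)
  also have "\<dots> = (star T * G) * (T * T')" by (simp add: adj'[symmetric] mult.assoc)
  also have "\<dots> = G' * (T' * T * T')" by (simp add: adj mult.assoc)
  also have "\<dots> = G' * T'" by (simp add: TT)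
  finally show ?thesis by simp
qed

lemma E_unit: "E * u = E"
proof -
  have X0u: "X0 * u = X0" unfolding X0_def by (simp add: algebra_simps unit)
  have "X1 * u = X1" unfolding X1_def by (simp add: algebra_simps unit X0u)
  then show ?thesis by (simp add: E_def algebra_simps unit)
qed

definition "eps = star S' * (E * S')"

text \<open>The hypothesis says that \<open>T\<close> exhausts the nondegenerate part of the second radical.\<close>

lemma
  assumes full: "star (1 - S' * I') * (G' * ((1 - T' * T) * (1 - S' * I'))) = 0"
  shows E_eq: "E = star I' * (eps * I')" and eps_D: "eps * (I * J) = 0" and star_eps: "star eps = - eps"
proof -
  define N where "N = 1 - S' * I'"
  define M where "M = (1 - T' * T) * N"
  \<comment> \<open>\<open>N\<close> projects onto the kernel of \<open>I'\<close>, so the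
    hypothesis says that \<open>G' M\<close> annihilates this kernel. A functional doing so factors
    through \<open>I'\<close>, hence \<open>M\<close> lies in the image of \<open>J'\<close>, which
    \<open>E\<close> kills.\<close>
  have "G' * M = star I' * (star S' * (G' * M))"
    using full unfolding N_def[symmetric] M_def[symmetric]
    by (simp add: N_def star_simps algebra_simps)
  then have "K' * (G' * M) = J' * (star S' * (G' * M))" by (metis J'_def mult.assoc)
  then have "u * M = J' * (star S' * (G' * M))" by (simp add: mult_eq_assoc[OF GK(4)])
  then have "E * (u * M) = 0" by (simp add: mult.assoc[symmetric] E_J')
  then have EM: "E * M = 0" by (simp add: mult.assoc[symmetric] E_unit)
  have "E * N = E * M + E * T' * (T * N)" by (simp add: M_def algebra_simps)
  then have EN: "E * N = 0" by (simp add: EM E_T')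
  then have 1: "E * (S' * I') = E" by (simp add: N_def algebra_simps)
  then have "star (E * (S' * I')) = star E" by simp
  then have 2: "star I' * (star S' * E) = E" by (simp add: star_simps star_E mult.assoc)
  show "E = star I' * (eps * I')" unfolding eps_def
    using 1 2 by (simp add: mult.assoc)
  show "eps * (I * J) = 0"
  proof -
    have "eps * (I * J) = star S' * (E * (S' * I')) * J'"
      unfolding IJ[symmetric] by (simp add: eps_def mult.assoc)
    then show ?thesis by (simp add: 1 E_J' mult.assoc)
  qed
  show "star eps = - eps" by (simp add: eps_def star_simps star_E mult.assoc)
qed

text \<open>Subtracting \<open>J F I'\<close> lowers the form by
  \<open>star I' (F - star F) I'\<close>, which is exactly \<open>E\<close>, since pairing with
  \<open>J\<close> only sees \<open>I\<close>. The condition \<open>star (I J) F = 0\<close> removes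
  the quadratic term; \<open>I J F = 0\<close> places the correction in the kernel of
  \<open>I\<close>, where \<open>G\<close> is skew, and so fixes the sign of the second mixed
  term.\<close>

lemma isometry:
  assumes full: "star (1 - S' * I') * (G' * ((1 - T' * T) * (1 - S' * I'))) = 0"
    and F: "eps = F - star F" "I * J * F = 0" "star (I * J) * F = 0"
  shows "star (X1 - J * (F * I')) * (G * (X1 - J * (F * I'))) = G'"
proof -
  define Y where "Y = J * (F * I')"
  have a: "star X1 * (G * Y) = star I' * (F * I')"
  proof -
    have "star X1 * (G * Y) = star (I * X1) * (F * I')"
      by (simp add: Y_def mult_eq_assoc[OF GJ(1)] star_simps mult.assoc)
    then show ?thesis by (simp add: I_X1)
  qed
  have b: "star Y * (G * Y) = 0"
  proof -
    have "star Y * (G * Y) = star (F * I') * (star (I * J) * F) * I'"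
      by (simp add: Y_def mult_eq_assoc[OF GJ(1)] star_simps mult.assoc)
    then show ?thesis by (simp add: F)
  qed
  have c: "star Y * (G * X1) = - (star I' * (star F * I'))"
  proof -
    have "star Y * ((G + star G) * X1) = star (I * J * F * I') * I'"
      by (simp add: Y_def sym star_simps mult.assoc I_X1)
    also have "\<dots> = 0" unfolding F by (simp add: star_zero)
    finally have "star Y * (G * X1) = - (star Y * (star G * X1))"
      by (simp add: distrib_left distrib_right eq_neg_iff_add_eq_0)
    also have "star Y * (star G * X1) = star (F * I') * (star (G * J) * X1)"
      by (simp add: Y_def star_simps mult.assoc)
    also have "\<dots> = star I' * (star F * I')" by (simp add: GJ star_simps mult.assoc I_X1)
    finally show ?thesis .
  qed
  have "star (X1 - Y) * (G * (X1 - Y)) = G' + E - star I' * (F * I') + star I' * (star F * I')"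
    by (simp add: star_simps algebra_simps a b c) (simp add: E_def algebra_simps)
  also have "\<dots> = G'" using E_eq[OF full] by (simp add: F algebra_simps)
  finally show ?thesis unfolding Y_def .
qed

text \<open>All assumptions are symmetric in the two sides except the adjunction, whose mirror image
  is \<open>adj'\<close>. Either radical may thus play the role of the exhausted one.\<close>

lemma flip: "gram_pair star u I' I G' G K' K S' S T' T"
proof
  show "I * K * star I = I' * K' * star I'" using same by simp
  show "star T' * G' = G * T" using adj' by simp
qed (insert GK unit sym section_eq TI TT, assumption+)

text \<open>Adding a hyperbolic plane on both sides.\<close>

lemma extend:
  assumes w: "y * w = y" "k * w = k" "y' * w = y'" "k' * w = k'" "star w = w"
    and uu: "u * y = y" "u * k = k" "u * y' = y'" "u * k' = k'"
    and I: "I * y = 0" "I * k = 0" "I' * y' = 0" "I' * k' = 0"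
    and T: "T' * y = 0" "T' * k = 0" "T * y' = 0" "T * k' = 0"
    and b: "star y * (G * k) = w" "star y' * (G' * k') = w"
      "star y * (G * y) = 0" "star k * (G * k) = 0" "star y' * (G' * y') = 0" "star k' * (G' * k') = 0"
  defines "T2 \<equiv> T + y * (star k' * star G') + k * (star y' * G')"
    and "T2' \<equiv> T' + y' * (star k * star G) + k' * (star y * G)"
  shows "gram_pair star u I I' G G' K K' S S' T2 T2'"
    and "T2' * T2 = T' * T + y' * (star k' * star G') + k' * (star y' * G')"
    and "T2' * T2 * (T' * T) = T' * T" and "T2' * T2 * y' = y'"
    and "star k' * star G' * (T' * T) = 0" and "star k' * star G' * y' = w"
proof -
  \<comment> \<open>The added terms use dual bases of the hyperbolic planes:
    \<open>star k' star G'\<close> takes the value \<open>w\<close> on \<open>y'\<close> and 0 on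
    \<open>k'\<close>, while \<open>star y' G'\<close> does the opposite, so \<open>T2\<close> sends
    \<open>y'\<close> to \<open>y\<close> and \<open>k'\<close> to \<open>k\<close>. The idempotent
    \<open>w\<close> is the identity of the one-dimensional format in which these vectors
    live.\<close>
  have neg: "star G * v = - (G * v)" if "I * v = 0" for v
  proof -
    have "(G + star G) * v = 0" by (simp add: sym that mult.assoc)
    then show ?thesis by (simp add: algebra_simps add_eq_0_iff)
  qed
  have neg': "star G' * v = - (G' * v)" if "I' * v = 0" for v
  proof -
    have "(G' + star G') * v = 0" by (simp add: sym that mult.assoc)
    then show ?thesis by (simp add: algebra_simps add_eq_0_iff)
  qed
  have negs: "star v * star G = - (star v * G)" if "I * v = 0" for v
    using arg_cong[OF neg[OF that], of star] by (simp add: star_simps)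
  have negs': "star v * star G' = - (star v * G')" if "I' * v = 0" for v
    using arg_cong[OF neg'[OF that], of star] by (simp add: star_simps)
  have sy: "star G * y = - (G * y)" "star G * k = - (G * k)"
    "star G' * y' = - (G' * y')" "star G' * k' = - (G' * k')"
    using neg neg' I by auto
  have sy2: "star y * star G = - (star y * G)" "star k * star G = - (star k * G)"
    "star y' * star G' = - (star y' * G')" "star k' * star G' = - (star k' * G')"
    using negs negs' I by auto
  have ky: "star k * (G * y) = - w" "star k' * (G' * y') = - w"
  proof -
    have "star (star y * (G * k)) = w" using b w by simp
    then show "star k * (G * y) = - w" by (simp add: star_simps mult.assoc sy minus_equation_iff)
    have "star (star y' * (G' * k')) = w" using b w by simp
    then show "star k' * (G' * y') = - w" by (simp add: star_simps mult.assoc sy minus_equation_iff)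
  qed
  have sT: "star y * (G * T) = 0" "star k * (G * T) = 0" "star y' * (G' * T') = 0" "star k' * (G' * T') = 0"
  proof -
    have z: "star y * star T' = 0" "star k * star T' = 0" "star y' * star T = 0" "star k' * star T = 0"
      using T by (simp_all add: star_mult[symmetric] star_zero)
    show "star y * (G * T) = 0" "star k * (G * T) = 0"
      unfolding adj' by (simp_all add: mult_eq_assoc[OF z(1)] mult_eq_assoc[OF z(2)])
    show "star y' * (G' * T') = 0" "star k' * (G' * T') = 0"
      unfolding adj[symmetric] by (simp_all add: mult_eq_assoc[OF z(3)] mult_eq_assoc[OF z(4)])
  qed
  have so: "w * star y = star y" "w * star k = star k" "w * star y' = star y'" "w * star k' = star k'"
    using w(1-4)[THEN arg_cong[of _ _ star]] w(5) by (simp_all add: star_mult)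
  note rules = sT sT[THEN mult_eq_assoc, unfolded mult.assoc] T T[THEN mult_eq_assoc] b b[THEN mult_eq_assoc, unfolded mult.assoc]
    ky ky[THEN mult_eq_assoc, unfolded mult.assoc] so so[THEN mult_eq_assoc] TT[unfolded mult.assoc]
    TT[THEN mult_eq_assoc, unfolded mult.assoc] w(1-4) w(1-4)[THEN mult_eq_assoc]
  have T2: "T2 = T - y * (star k' * G') + k * (star y' * G')"
    and T2': "T2' = T' - y' * (star k * G) + k' * (star y * G)"
    by (auto simp: T2_def T2'_def sy2)
  have su: "star G * u = star G" "star G' * u = star G'" using unit(1,10,11) by (metis star_mult)+
  have prod: "T2 * T2' = T * T' - y * (star k * G) + k * (star y * G)"
    unfolding T2 T2' by (simp add: algebra_simps rules)
  show prod': "T2' * T2 = T' * T + y' * (star k' * star G') + k' * (star y' * G')"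
    unfolding T2 T2' by (simp add: algebra_simps rules sy2)
  show "T2' * T2 * (T' * T) = T' * T" "T2' * T2 * y' = y'"
    unfolding prod' by (simp_all add: algebra_simps rules sy sy2)
  show "star k' * star G' * (T' * T) = 0" "star k' * star G' * y' = w"
    by (simp_all add: sy2 mult.assoc rules)
  show "gram_pair star u I I' G G' K K' S S' T2 T2'"
  proof
    show "T2 * T2' * T2 = T2"
      unfolding prod unfolding T2 by (simp add: algebra_simps rules)
    show "T2' * T2 * T2' = T2'"
      unfolding prod' unfolding T2' by (simp add: algebra_simps rules sy2)
    show "star T2 * G = G' * T2'"
      unfolding T2_def T2'_def
      by (simp add: star_simps algebra_simps adj sy2 sy[THEN mult_eq_assoc])
    show "u * T2 = T2" "u * T2' = T2'" "T2 * u = T2" "T2' * u = T2'"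
      unfolding T2_def T2'_def
      by (simp_all add: algebra_simps unit uu uu[THEN mult_eq_assoc] su)
    show "I * T2 = 0" "I' * T2' = 0"
      unfolding T2_def T2'_def by (simp_all add: algebra_simps TI I I[THEN mult_eq_assoc])
  qed (insert GK unit sym section_eq same, assumption+)
qed

end

section \<open>Isometry of lattices with the same Coxeter-Laplacian\<close>

lemma ring_emb_mult_eq:
  "A * B = C \<Longrightarrow> dim_col A = dim_row B \<Longrightarrow> ring_emb A * ring_emb B = ring_emb C"
  using ring_emb_mult by metis

lemma ring_emb_unit:
  "dim_col A = n \<Longrightarrow> ring_emb A * ring_emb (1\<^sub>m n) = ring_emb A"
  "dim_row A = n \<Longrightarrow> ring_emb (1\<^sub>m n) * ring_emb A = ring_emb A"
  "dim_row A = n \<Longrightarrow> swap_biendo (ring_emb A) * ring_emb (1\<^sub>m n) = swap_biendo (ring_emb A)"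
  "dim_col A = n \<Longrightarrow> ring_emb (1\<^sub>m n) * swap_biendo (ring_emb A) = swap_biendo (ring_emb A)"
  "dim_row A = n \<Longrightarrow> ring_emb (1\<^sub>m n) * (ring_emb A * x) = ring_emb A * x"
  "dim_col A = n \<Longrightarrow> ring_emb (1\<^sub>m n) * (swap_biendo (ring_emb A) * x) = swap_biendo (ring_emb A) * x"
  "swap_biendo (ring_emb (1\<^sub>m n)) = ring_emb (1\<^sub>m n)"
proof -
  show r: "ring_emb A * ring_emb (1\<^sub>m n) = ring_emb A" if "dim_col A = n" for A
    using ring_emb_mult_eq[OF right_mult_one_mat[OF carrier_matI[OF refl that]]] that by simp
  show l: "ring_emb (1\<^sub>m n) * ring_emb A = ring_emb A" if "dim_row A = n" for A
    using ring_emb_mult_eq[OF left_mult_one_mat[OF carrier_matI[OF that refl]]] that by simp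
  show "swap_biendo (ring_emb (1\<^sub>m n)) = ring_emb (1\<^sub>m n)"
    by (simp flip: ring_emb_transpose)
  show "swap_biendo (ring_emb A) * ring_emb (1\<^sub>m n) = swap_biendo (ring_emb A)" if "dim_row A = n"
    using r[of "transpose_mat A"] that by (simp add: ring_emb_transpose)
  show lt: "ring_emb (1\<^sub>m n) * swap_biendo (ring_emb A) = swap_biendo (ring_emb A)" if "dim_col A = n"
    using l[of "transpose_mat A"] that by (simp add: ring_emb_transpose)
  show "ring_emb (1\<^sub>m n) * (ring_emb A * x) = ring_emb A * x" if "dim_row A = n"
    using l[OF that] by (simp add: mult.assoc[symmetric])
  show "ring_emb (1\<^sub>m n) * (swap_biendo (ring_emb A) * x) = swap_biendo (ring_emb A) * x" if "dim_col A = n"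
    using lt[OF that] by (simp add: mult.assoc[symmetric])
qed

section \<open>Permutation matrices acting on rows and columns\<close>

lemma perm_mat_dim [simp]: "dim_row (perm_mat m \<xi>) = m" "dim_col (perm_mat m \<xi>) = m"
  by (simp_all add: perm_mat_def)

lemma perm_mat_carrier [simp]: "perm_mat m \<xi> \<in> carrier_mat m m"
  by (rule carrier_matI) simp_all

lemma perm_mat_index:
  assumes "\<xi> permutes {..<m}" "i < m" "j < m"
  shows "perm_mat m \<xi> $$ (i, j) = (if i = \<xi> j then 1 else 0)"
  using assms permutes_in_image[OF assms(1), of j]
  by (simp add: perm_mat_def mat_of_cols_index unit_vec_def)

lemma perm_mat_mult_index:
  assumes \<xi>: "\<xi> permutes {..<m}" and A: "A \<in> carrier_mat m k" and ij: "i < m" "j < k"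
  shows "(perm_mat m \<xi> * A) $$ (i, j) = A $$ (inv \<xi> i, j)"
proof -
  have "(perm_mat m \<xi> * A) $$ (i, j) = (\<Sum>l<m. (if i = \<xi> l then 1 else 0) * A $$ (l, j))"
    using A ij by (simp add: scalar_prod_def perm_mat_index[OF \<xi>] atLeast0LessThan)
  also have "\<dots> = (\<Sum>l<m. if inv \<xi> i = l then A $$ (l, j) else 0)"
    using permutes_inverses[OF \<xi>] by (intro sum.cong) auto
  also have "\<dots> = A $$ (inv \<xi> i, j)"
    using ij permutes_in_image[OF permutes_inv[OF \<xi>], of i] by simp
  finally show ?thesis .
qed

lemma mult_perm_mat_index:
  assumes \<xi>: "\<xi> permutes {..<m}" and A: "A \<in> carrier_mat k m" and ij: "i < k" "j < m"
  shows "(A * perm_mat m \<xi>) $$ (i, j) = A $$ (i, \<xi> j)"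
proof -
  have "(A * perm_mat m \<xi>) $$ (i, j) = (\<Sum>l<m. A $$ (i, l) * (if l = \<xi> j then 1 else 0))"
    using A ij by (simp add: scalar_prod_def perm_mat_index[OF \<xi>] atLeast0LessThan)
  also have "\<dots> = (\<Sum>l<m. if l = \<xi> j then A $$ (i, l) else 0)"
    by (intro sum.cong) auto
  also have "\<dots> = A $$ (i, \<xi> j)"
    using ij permutes_in_image[OF \<xi>, of j] by simp
  finally show ?thesis .
qed

lemma perm_mat_transpose:
  assumes \<xi>: "\<xi> permutes {..<m}"
  shows "transpose_mat (perm_mat m \<xi>) = perm_mat m (inv \<xi>)"
proof (rule eq_matI)
  fix i j assume "i < dim_row (perm_mat m (inv \<xi>))" "j < dim_col (perm_mat m (inv \<xi>))"
  then show "transpose_mat (perm_mat m \<xi>) $$ (i, j) = perm_mat m (inv \<xi>) $$ (i, j)"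
    using permutes_inverses[OF \<xi>]
    by (auto simp: perm_mat_index[OF \<xi>] perm_mat_index[OF permutes_inv[OF \<xi>]])
qed simp_all

text \<open>Scalars are taken as matrices of size 1, so that multiplying a column by a number is a
  product in the embedding ring.\<close>

abbreviation scalar_mat :: "int \<Rightarrow> int mat" where
  "scalar_mat d \<equiv> mat 1 1 (\<lambda>_. d)"

lemma mult_scalar_mat_index:
  "A \<in> carrier_mat r 1 \<Longrightarrow> i < r \<Longrightarrow> (A * scalar_mat d) $$ (i, 0) = A $$ (i, 0) * d"
  by (simp add: scalar_prod_def)

lemma scalar_mat_cancel:
  assumes "A * scalar_mat d = B * scalar_mat d" "A \<in> carrier_mat r 1" "B \<in> carrier_mat r 1" "d \<noteq> 0"
  shows "A = B"
proof (rule eq_matI)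
  fix i j assume "i < dim_row B" "j < dim_col B"
  then have i: "i < r" "j = 0" using assms by auto
  have "A $$ (i, 0) * d = B $$ (i, 0) * d"
    using arg_cong[OF assms(1), of "\<lambda>X. X $$ (i, 0)"]
    unfolding mult_scalar_mat_index[OF assms(2) i(1)] mult_scalar_mat_index[OF assms(3) i(1)] .
  then show "A $$ (i, j) = B $$ (i, j)" using assms(4) i by simp
qed (use assms in auto)

lemma Gcd_linear_combination:
  fixes f :: "nat \<Rightarrow> int"
  shows "\<exists>x. (\<Sum>i<n. x i * f i) = Gcd (f ` {..<n})"
proof (induction n)
  case (Suc n)
  then obtain x where x: "(\<Sum>i<n. x i * f i) = Gcd (f ` {..<n})" by blast
  obtain a b where ab: "a * f n + b * Gcd (f ` {..<n}) = gcd (f n) (Gcd (f ` {..<n}))"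
    using bezout_int by blast
  have "(\<Sum>i<Suc n. (if i = n then a else b * x i) * f i) = (\<Sum>i<n. b * x i * f i) + a * f n"
    by simp
  also have "(\<Sum>i<n. b * x i * f i) = b * Gcd (f ` {..<n})"
    by (simp add: x[symmetric] sum_distrib_left mult.assoc)
  also have "b * Gcd (f ` {..<n}) + a * f n = Gcd (f ` {..<Suc n})"
    using ab by (simp add: lessThan_Suc)
  finally show ?case by (intro exI)
qed simp

text \<open>
  \<open>I\<close> is the incidence matrix of a connected quiver, \<open>G\<close> the upper triangular Gram matrix of its
  form and \<open>K\<close> the inverse of \<open>G\<close>; \<open>S\<close> expresses \<open>e\<^sub>i - e\<^sub>z\<close> by the columns of \<open>I\<close>, with a root
  vertex \<open>z\<close>.
\<close>

locale coxeter_datum =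
  fixes m n z :: nat and I G K S :: "int mat" and \<xi> :: "nat \<Rightarrow> nat"
  assumes I: "I \<in> carrier_mat m n" and G: "G \<in> carrier_mat n n" and K: "K \<in> carrier_mat n n"
    and S: "S \<in> carrier_mat n m" and z: "z < m"
    and GK: "G * K = 1\<^sub>m n" "K * G = 1\<^sub>m n"
    and sym: "G + transpose_mat G = transpose_mat I * I"
    and IS: "I * S = mat m m (\<lambda>(i, j). (if i = j then 1 else 0) - (if i = z then 1 else 0))"
    and col_sum: "j < n \<Longrightarrow> (\<Sum>i<m. I $$ (i, j)) = 0"
    and perm: "\<xi> permutes {..<m}"
    and laplacian: "1\<^sub>m m - I * K * transpose_mat I = perm_mat m \<xi>"
begin

lemmas dims [simp] = carrier_matD[OF I] carrier_matD[OF G] carrier_matD[OF K] carrier_matD[OF S]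

text \<open>Multiplication by \<open>I S\<close> subtracts the column sums from row \<open>z\<close>
  and changes nothing else.\<close>

lemma section_mult:
  assumes A: "A \<in> carrier_mat m k" and c: "\<And>j. j < k \<Longrightarrow> (\<Sum>i<m. A $$ (i, j)) = 0"
  shows "I * S * A = A"
proof (rule eq_matI)
  fix i j assume "i < dim_row A" "j < dim_col A"
  then have ij: "i < m" "j < k" using A by auto
  have "(I * S * A) $$ (i, j) =
      (\<Sum>l<m. ((if i = l then 1 else 0) - (if i = z then 1 else 0)) * A $$ (l, j))"
    unfolding IS using A ij by (simp add: scalar_prod_def atLeast0LessThan)
  also have "\<dots> = (\<Sum>l<m. if i = l then A $$ (l, j) else 0) -
      (if i = z then 1 else 0) * (\<Sum>l<m. A $$ (l, j))"
    unfolding sum_distrib_left sum_subtractf[symmetric] by (intro sum.cong) auto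
  also have "\<dots> = A $$ (i, j)" using c ij by simp
  finally show "(I * S * A) $$ (i, j) = A $$ (i, j)" .
qed (use A in auto)

lemma section_I: "I * S * I = I"
  by (rule section_mult[OF I col_sum])

lemma laplacian': "I * (K * transpose_mat I) = 1\<^sub>m m - perm_mat m \<xi>"
proof -
  have "I * (K * transpose_mat I) = I * K * transpose_mat I"
    using I K by (simp add: assoc_mult_mat[of _ m n _ n _ m])
  also have "\<dots> = 1\<^sub>m m - (1\<^sub>m m - I * K * transpose_mat I)"
    by (rule eq_matI) auto
  finally show ?thesis unfolding laplacian .
qed

lemma one_minus_perm_index:
  assumes "A \<in> carrier_mat m k" "i < m" "j < k"
  shows "((1\<^sub>m m - perm_mat m \<xi>) * A) $$ (i, j) = A $$ (i, j) - A $$ (inv \<xi> i, j)"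
  using assms perm_mat_mult_index[OF perm assms]
  by (subst minus_mult_distrib_mat[of _ m m _ _ k]) auto

text \<open>The value is its own negative by skewness on the kernel of \<open>I\<close>; as the
  integers have no 2-torsion, the form is alternating there.\<close>

lemma form_zero:
  assumes y: "y \<in> carrier_mat n 1" and "I * y = 0\<^sub>m m 1"
  shows "transpose_mat y * (G * y) = 0\<^sub>m 1 1"
proof -
  note [simp] = carrier_matD[OF y]
  define b where "b = transpose_mat y * (G * y)"
  have "b + transpose_mat b = transpose_mat y * ((G + transpose_mat G) * y)"
    by (rule ring_emb_inj) (simp_all add: b_def ring_emb_simps swap.star_simps algebra_simps)
  also have "\<dots> = transpose_mat (I * y) * (I * y)"
    unfolding sym by (rule ring_emb_inj) (simp_all add: ring_emb_simps swap.star_simps algebra_simps)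
  finally have e: "b + transpose_mat b = 0\<^sub>m 1 1" by (simp add: assms(2))
  have b: "b \<in> carrier_mat 1 1" by (auto simp: b_def)
  then have "b $$ (0, 0) + b $$ (0, 0) = 0"
    using arg_cong[OF e, of "\<lambda>X. X $$ (0, 0)"] by auto
  then show ?thesis unfolding b_def[symmetric] using b by (intro eq_matI) auto
qed

text \<open>\<open>P\<close> is the projector onto the part of the radical already split off. If the
  complement carries any nonzero pairing, it contains a pair of value exactly 1: a vector
  \<open>k\<close> whose pairings with the radical have gcd \<open>d\<close> becomes divisible by
  \<open>d\<close> after subtracting a radical vector from the image of \<open>J\<close>, which
  pairs to zero with the radical.\<close>

lemma hyperbolic_pair:
  assumes P: "P \<in> carrier_mat n n" "P * P = P" "I * P = 0\<^sub>m m n"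
      "P * (K * transpose_mat I) = 0\<^sub>m n m" "transpose_mat P * G = G * P"
    and nz: "transpose_mat (1\<^sub>m n - S * I) * (G * ((1\<^sub>m n - P) * (1\<^sub>m n - S * I))) \<noteq> 0\<^sub>m n n"
  obtains y k where "y \<in> carrier_mat n 1" "k \<in> carrier_mat n 1" "I * y = 0\<^sub>m m 1" "I * k = 0\<^sub>m m 1"
    "P * y = 0\<^sub>m n 1" "P * k = 0\<^sub>m n 1" "transpose_mat y * (G * k) = 1\<^sub>m 1"
proof -
  define N where "N = 1\<^sub>m n - S * I"
  define U where "U = transpose_mat N * (G * ((1\<^sub>m n - P) * N))"
  have [simp]: "dim_row P = n" "dim_col P = n" using P by auto
  have [simp]: "dim_row N = n" "dim_col N = n" by (simp_all add: N_def)
  have [simp]: "dim_row U = n" "dim_col U = n" by (simp_all add: U_def)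
  have "\<not> (\<forall>i<n. \<forall>j<n. U $$ (i, j) = 0)"
    using nz unfolding N_def[symmetric] U_def[symmetric] by (auto intro: eq_matI)
  then obtain r j where rj: "r < n" "j < n" "U $$ (r, j) \<noteq> 0" by blast
  \<comment> \<open>Column \<open>j\<close> of the nonzero matrix \<open>U\<close> supplies the
    vector \<open>k\<close>; the entries of \<open>c\<close> are its pairings with the columns of
    \<open>N\<close>, which span the radical.\<close>
  define e where "e = mat n 1 (\<lambda>(i, _). if i = j then 1 else 0 :: int)"
  define k where "k = (1\<^sub>m n - P) * (N * e)"
  define c where "c = transpose_mat N * (G * k)"
  have [simp]: "dim_row e = n" "dim_col e = 1" "dim_row k = n" "dim_col k = 1"
    "dim_row c = n" "dim_col c = 1" by (simp_all add: e_def k_def c_def)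
  have "c = U * e"
    by (rule ring_emb_inj) (simp_all add: c_def k_def U_def ring_emb_simps mult.assoc)
  then have "c $$ (r, 0) = U $$ (r, j)"
    using rj by (simp add: e_def scalar_prod_def if_distrib cong: if_cong)
  then have cr: "c $$ (r, 0) \<noteq> 0" using rj by simp
  define d where "d = Gcd ((\<lambda>i. c $$ (i, 0)) ` {..<n})"
  have dvd: "d dvd c $$ (i, 0)" if "i < n" for i
    unfolding d_def using that by (intro Gcd_dvd) auto
  have d0: "d \<noteq> 0" using dvd[OF rj(1)] cr by auto
  define u where "u = mat n 1 (\<lambda>(i, _). c $$ (i, 0) div d)"
  define \<delta> where "\<delta> = scalar_mat d"
  have [simp]: "dim_row u = n" "dim_col u = 1" "dim_row \<delta> = 1" "dim_col \<delta> = 1"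
    by (simp_all add: u_def \<delta>_def)
  have cu: "c = u * \<delta>"
    using dvd by (intro eq_matI) (auto simp: u_def \<delta>_def scalar_prod_def)
  obtain x where x: "(\<Sum>i<n. x i * c $$ (i, 0)) = d"
    using Gcd_linear_combination[of "\<lambda>i. c $$ (i, 0)" n] unfolding d_def by blast
  define \<zeta> where "\<zeta> = mat 1 n (\<lambda>(_, i). x i)"
  have [simp]: "dim_row \<zeta> = 1" "dim_col \<zeta> = n" by (simp_all add: \<zeta>_def)
  have "\<zeta> * c = \<delta>"
    by (rule eq_matI) (auto simp: \<zeta>_def \<delta>_def scalar_prod_def x atLeast0LessThan)
  moreover have "\<zeta> * c = (\<zeta> * u) * \<delta>"
    unfolding cu by (rule ring_emb_inj) (simp_all add: ring_emb_simps mult.assoc)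
  ultimately have "(\<zeta> * u) * \<delta> = 1\<^sub>m 1 * \<delta>" by (simp add: \<delta>_def)
  then have \<zeta>u: "\<zeta> * u = 1\<^sub>m 1"
    unfolding \<delta>_def by (rule scalar_mat_cancel) (use d0 in \<open>auto intro: carrier_matI\<close>)

  define J where "J = K * transpose_mat I"
  have [simp]: "dim_row J = n" "dim_col J = m" by (simp_all add: J_def)
  have GJ: "G * J = transpose_mat I"
  proof -
    have "G * J = (G * K) * transpose_mat I"
      unfolding J_def by (rule ring_emb_inj) (simp_all add: ring_emb_simps mult.assoc)
    then show ?thesis by (simp add: GK)
  qed
  have GJe: "ring_emb G * (ring_emb J * x) = swap_biendo (ring_emb I) * x" for x
    using mult_eq_assoc[OF ring_emb_mult_eq[OF GJ]] by (simp add: ring_emb_transpose)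
  have IN: "I * N = 0\<^sub>m m n"
  proof -
    have "I * N = I - I * S * I"
      unfolding N_def by (rule ring_emb_inj)
        (simp_all add: ring_emb_simps algebra_simps ring_emb_unit)
    then show ?thesis unfolding section_I by (simp add: minus_r_inv_mat[OF I])
  qed
  \<comment> \<open>In terms of \<open>f\<close> below, \<open>G k = c + I^T f\<close> with
    \<open>c\<close> divisible by \<open>d\<close>. Hence \<open>k = d v + J f\<close>, and only
    \<open>J f\<close> obstructs the division of \<open>k\<close> by \<open>d\<close>.\<close>
  define v where "v = K * u"
  have [simp]: "dim_row v = n" "dim_col v = 1" by (simp_all add: v_def)
  have Gv: "G * v = u"
  proof -
    have "G * v = (G * K) * u"
      unfolding v_def by (rule ring_emb_inj) (simp_all add: ring_emb_simps mult.assoc)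
    then show ?thesis by (simp add: GK carrier_matI)
  qed
  define f where "f = transpose_mat S * (G * k)"
  have [simp]: "dim_row f = m" "dim_col f = 1" by (simp_all add: f_def)
  define f1 where "f1 = mat m 1 (\<lambda>(i, _). f $$ (i, 0) div d)"
  define f2 where "f2 = mat m 1 (\<lambda>(i, _). f $$ (i, 0) mod d)"
  have [simp]: "dim_row f1 = m" "dim_col f1 = 1" "dim_row f2 = m" "dim_col f2 = 1"
    by (simp_all add: f1_def f2_def)
  have f: "f = f1 * \<delta> + f2"
    by (rule eq_matI) (auto simp: f1_def f2_def \<delta>_def scalar_prod_def)
  have v\<delta>: "v * \<delta> = k - J * f"
  proof -
    have "v * \<delta> = K * (u * \<delta>)"
      unfolding v_def by (rule ring_emb_inj) (simp_all add: ring_emb_simps mult.assoc)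
    also have "\<dots> = K * c" by (simp add: cu)
    also have "\<dots> = (K * G) * k - J * f"
      unfolding c_def N_def J_def f_def
      by (rule ring_emb_inj) (simp_all add: ring_emb_simps swap.star_simps algebra_simps ring_emb_unit)
    finally show ?thesis by (simp add: GK carrier_matI)
  qed
  have Ik: "I * k = 0\<^sub>m m 1"
  proof -
    have "I * k = (I * N) * e - (I * P) * (N * e)"
      unfolding k_def by (rule ring_emb_inj)
        (simp_all add: ring_emb_simps algebra_simps ring_emb_unit)
    then show ?thesis unfolding IN P by (simp add: carrier_matI)
  qed
  have IJ: "I * J = 1\<^sub>m m - perm_mat m \<xi>" unfolding J_def by (rule laplacian')
  have If: "(I * v) * \<delta> + (I * J) * f = 0\<^sub>m m 1"
  proof -
    have "(I * v) * \<delta> + (I * J) * f = I * (v * \<delta>) + I * (J * f)"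
      by (rule ring_emb_inj) (simp_all add: ring_emb_simps mult.assoc)
    also have "\<dots> = I * k"
      unfolding v\<delta> by (rule ring_emb_inj) (simp_all add: ring_emb_simps algebra_simps)
    finally show ?thesis by (simp add: Ik)
  qed
  \<comment> \<open>Modulo \<open>d\<close> the equation says that \<open>f\<close> takes congruent
    values along each orbit of \<xi>. Congruent values have equal residues, so \<open>f2\<close> is
    invariant over the integers and not merely modulo \<open>d\<close>.\<close>
  have If2: "(I * J) * f2 = 0\<^sub>m m 1"
  proof (rule eq_matI)
    fix i l assume il: "i < dim_row (0\<^sub>m m 1 :: int mat)" "l < dim_col (0\<^sub>m m 1 :: int mat)"
    then have i: "i < m" "l = 0" by auto
    have \<rho>: "inv \<xi> i < m" using permutes_in_image[OF permutes_inv[OF perm], of i] i by simp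
    have "((I * v) * \<delta>) $$ (i, 0) + ((I * J) * f) $$ (i, 0) = 0"
      using arg_cong[OF If, of "\<lambda>X. X $$ (i, 0)"] i by (simp del: index_mult_mat(1))
    then have "f $$ (i, 0) - f $$ (inv \<xi> i, 0) = (- (I * v) $$ (i, 0)) * d"
      unfolding IJ \<delta>_def
      using i by (simp add: one_minus_perm_index[of _ 1] mult_scalar_mat_index[of _ m, unfolded One_nat_def]
          carrier_matI algebra_simps del: index_mult_mat(1))
    then have "d dvd f $$ (i, 0) - f $$ (inv \<xi> i, 0)" by simp
    then have "f $$ (i, 0) mod d = f $$ (inv \<xi> i, 0) mod d" by (simp add: mod_eq_dvd_iff)
    then show "((I * J) * f2) $$ (i, l) = 0\<^sub>m m 1 $$ (i, l)"
      unfolding IJ using i \<rho> 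
      by (simp add: one_minus_perm_index[of _ 1] carrier_matI f2_def del: index_mult_mat(1))
  qed simp_all
  \<comment> \<open>Keeping only the remainder leaves \<open>d k0 = k - J f2\<close>, where
    \<open>J f2\<close> lies in the radical and is orthogonal to it.\<close>
  define k0 where "k0 = v + J * f1"
  have [simp]: "dim_row k0 = n" "dim_col k0 = 1" by (simp_all add: k0_def)
  have k0\<delta>: "k0 * \<delta> = k - J * f2"
  proof -
    have "k0 * \<delta> = v * \<delta> + J * (f1 * \<delta>)"
      unfolding k0_def by (rule ring_emb_inj) (simp_all add: ring_emb_simps algebra_simps)
    also have "\<dots> = k - J * f2"
      unfolding v\<delta> f by (rule ring_emb_inj) (simp_all add: ring_emb_simps algebra_simps)
    finally show ?thesis .
  qed
  have Ik0: "I * k0 = 0\<^sub>m m 1"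
  proof (rule scalar_mat_cancel[OF _ _ _ d0])
    have "(I * k0) * \<delta> = I * (k0 * \<delta>)"
      by (rule ring_emb_inj) (simp_all add: ring_emb_simps mult.assoc)
    also have "\<dots> = I * k - (I * J) * f2"
      unfolding k0\<delta> by (rule ring_emb_inj) (simp_all add: ring_emb_simps algebra_simps)
    finally show "(I * k0) * scalar_mat d = 0\<^sub>m m 1 * scalar_mat d"
      by (simp add: Ik If2 \<delta>_def)
  qed (auto intro: carrier_matI)
  have Pk0: "P * k0 = 0\<^sub>m n 1"
  proof (rule scalar_mat_cancel[OF _ _ _ d0])
    have "(P * k0) * \<delta> = P * (k0 * \<delta>)"
      by (rule ring_emb_inj) (simp_all add: ring_emb_simps mult.assoc)
    also have "\<dots> = P * (N * e) - (P * P) * (N * e) - (P * J) * f2"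
      unfolding k0\<delta> k_def by (rule ring_emb_inj) (simp_all add: ring_emb_simps algebra_simps ring_emb_unit)
    also have "\<dots> = 0\<^sub>m n 1" unfolding P J_def by (intro eq_matI) auto
    finally show "(P * k0) * scalar_mat d = 0\<^sub>m n 1 * scalar_mat d"
      by (simp add: \<delta>_def)
  qed (auto intro: carrier_matI)
  \<comment> \<open>As \<open>N\<close> is idempotent, \<open>c\<close> is unchanged by the
    transpose of \<open>N\<close>, and cancelling \<open>d\<close> passes this on to
    \<open>u\<close>.\<close>
  have Nu: "transpose_mat N * u = u"
  proof (rule scalar_mat_cancel[OF _ _ _ d0])
    have "(transpose_mat N * u) * \<delta> = transpose_mat N * c"
      unfolding cu by (rule ring_emb_inj) (simp_all add: ring_emb_simps mult.assoc)
    also have "\<dots> = transpose_mat (N * N) * (G * k)"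
      unfolding c_def by (rule ring_emb_inj) (simp_all add: ring_emb_simps swap.star_simps mult.assoc)
    also have "N * N = N - S * (I * N)"
      by (subst (1) N_def, rule ring_emb_inj) (simp_all add: ring_emb_simps algebra_simps ring_emb_unit)
    also have "\<dots> = N" unfolding IN by (intro eq_matI) auto
    finally show "(transpose_mat N * u) * scalar_mat d = u * scalar_mat d"
      by (simp only: c_def[symmetric] cu \<delta>_def[symmetric])
  qed (auto intro: carrier_matI)
  \<comment> \<open>The Bezout coefficients \<zeta> combine the pairings \<open>u\<close>, whose gcd
    is 1, into the value 1.\<close>
  define y where "y = (1\<^sub>m n - P) * (N * transpose_mat \<zeta>)"
  have [simp]: "dim_row y = n" "dim_col y = 1" by (simp_all add: y_def)
  have e1: "1\<^sub>m 1 - 0\<^sub>m 1 1 = (1\<^sub>m 1 :: int mat)"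
    by (rule eq_matI) auto
  show ?thesis
  proof (rule that[of y k0])
    show "y \<in> carrier_mat n 1" "k0 \<in> carrier_mat n 1" by (auto intro: carrier_matI)
    have "I * y = (I * N) * transpose_mat \<zeta> - (I * P) * (N * transpose_mat \<zeta>)"
      unfolding y_def by (rule ring_emb_inj)
        (simp_all add: ring_emb_simps algebra_simps ring_emb_unit)
    then show "I * y = 0\<^sub>m m 1" unfolding IN P by (simp add: carrier_matI)
    have "P * y = P * (N * transpose_mat \<zeta>) - (P * P) * (N * transpose_mat \<zeta>)"
      unfolding y_def by (rule ring_emb_inj)
        (simp_all add: ring_emb_simps algebra_simps ring_emb_unit)
    then show "P * y = 0\<^sub>m n 1" unfolding P by (simp add: carrier_matI)
    have "transpose_mat y * (G * k0) = \<zeta> * (transpose_mat N * (G * k0)) -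
        \<zeta> * (transpose_mat N * ((transpose_mat P * G) * k0))"
      unfolding y_def by (rule ring_emb_inj)
        (simp_all add: ring_emb_simps swap.star_simps algebra_simps ring_emb_unit)
    also have "(transpose_mat P * G) * k0 = G * (P * k0)"
      unfolding P by (rule ring_emb_inj) (simp_all add: ring_emb_simps mult.assoc)
    also have "\<dots> = 0\<^sub>m n 1" by (simp add: Pk0)
    also have "\<zeta> * (transpose_mat N * (G * k0)) =
        \<zeta> * (transpose_mat N * (G * v)) + \<zeta> * (transpose_mat (I * N) * f1)"
      unfolding k0_def by (rule ring_emb_inj) (simp_all add: ring_emb_simps swap.star_simps
          algebra_simps GJe)
    also have "\<dots> = \<zeta> * u" unfolding Gv Nu IN by (simp add: carrier_matI)
    finally show "transpose_mat y * (G * k0) = 1\<^sub>m 1" unfolding \<zeta>u by (simp add: e1[unfolded One_nat_def])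
  qed (fact Ik0 Pk0)+
qed

end

text \<open>A finite measure of the rank of an idempotent: its image is reduced modulo 2, and
  inclusion of these sets replaces the comparison of ranks.\<close>

definition image_mod2 :: "int mat \<Rightarrow> (nat \<Rightarrow> int) set" where
  "image_mod2 P = range (\<lambda>x i. mat_act P x i mod 2)"

lemma image_mod2_subset:
  "dim_row P = n \<Longrightarrow> image_mod2 P \<subseteq> {f. \<forall>i. (i \<in> {..<n} \<longrightarrow> f i \<in> {0, 1}) \<and> (i \<notin> {..<n} \<longrightarrow> f i = 0)}"
  by (auto simp: image_mod2_def mat_act_def)

lemma finite_bits: "finite {f :: nat \<Rightarrow> int. \<forall>i. (i \<in> {..<n} \<longrightarrow> f i \<in> {0, 1}) \<and> (i \<notin> {..<n} \<longrightarrow> f i = 0)}"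
  by (rule finite_set_of_finite_funs) auto

text \<open>The functional \<open>a\<close> vanishes on the image of \<open>P\<close> and takes the
  odd value 1 on \<open>y\<close>, so the class of \<open>y\<close> modulo 2 is new.\<close>

lemma image_mod2_psubset:
  assumes P: "P \<in> carrier_mat n n" "P2 \<in> carrier_mat n n" and y: "y \<in> carrier_mat n 1" and a: "a \<in> carrier_mat 1 n"
    and eqs: "P2 * P = P" "P2 * y = y" "a * P = 0\<^sub>m 1 n" "a * y = 1\<^sub>m 1"
  shows "image_mod2 P \<subset> image_mod2 P2"
proof
  note [simp] = carrier_matD[OF P(1)] carrier_matD[OF P(2)] carrier_matD[OF y] carrier_matD[OF a]
  have "mat_act P x = mat_act P2 (mat_act P x)" for x
    using mat_act_mult[of P2 P x] unfolding eqs by simp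
  then have "(\<lambda>i. mat_act P x i mod 2) = (\<lambda>i. mat_act P2 (mat_act P x) i mod 2)" for x by metis
  then show "image_mod2 P \<subseteq> image_mod2 P2"
    unfolding image_mod2_def by auto
  define Y where "Y = mat_act y (\<lambda>_. 1)"
  have "Y = mat_act P2 Y"
    unfolding Y_def using mat_act_mult[of P2 y "\<lambda>_. 1"] unfolding eqs by simp
  then have Y2: "(\<lambda>i. Y i mod 2) \<in> image_mod2 P2"
    unfolding image_mod2_def by (intro range_eqI[of _ _ Y]) simp
  have "(\<lambda>i. Y i mod 2) \<notin> image_mod2 P"
  proof
    assume "(\<lambda>i. Y i mod 2) \<in> image_mod2 P"
    then obtain x where x: "(\<lambda>i. Y i mod 2) = (\<lambda>i. mat_act P x i mod 2)"
      unfolding image_mod2_def by auto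
    have "mat_act a Y 0 mod 2 = (\<Sum>j<n. (a $$ (0, j) * (Y j mod 2)) mod 2) mod 2"
      by (simp add: mat_act_def mod_sum_eq mod_mult_right_eq)
    also have "\<dots> = (\<Sum>j<n. (a $$ (0, j) * (mat_act P x j mod 2)) mod 2) mod 2"
      using x by (simp add: fun_eq_iff)
    also have "\<dots> = mat_act a (mat_act P x) 0 mod 2"
      by (simp add: mat_act_def[of a] mod_sum_eq mod_mult_right_eq)
    also have "mat_act a (mat_act P x) = mat_act (0\<^sub>m 1 n) x"
      using mat_act_mult[of a P x] by (simp add: eqs)
    also have "mat_act (0\<^sub>m 1 n) x 0 = 0" by (simp add: mat_act_def)
    also have "mat_act a Y 0 = mat_act (1\<^sub>m 1) (\<lambda>_. 1) 0"
      unfolding Y_def using mat_act_mult[of a y "\<lambda>_. 1"] by (simp add: eqs)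
    finally show False by (simp add: mat_act_def)
  qed
  with Y2 show "image_mod2 P \<noteq> image_mod2 P2" by blast
qed

text \<open>Invariance makes \<open>e\<close> constant on pairs of orbits, and its value on two
  points of one orbit is a diagonal entry, hence 0. Once the orbits are ordered, \<open>F\<close> is
  the part of \<open>e\<close> above the diagonal; depending on orbits only, it is invariant
  too.\<close>

lemma (in coxeter_datum) alternating_invariant_split:
  assumes e: "e \<in> carrier_mat m m" and alt: "transpose_mat e = - e"
    and inv: "e * (1\<^sub>m m - perm_mat m \<xi>) = 0\<^sub>m m m"
  obtains F where "F \<in> carrier_mat m m" "e = F - transpose_mat F"
    "(1\<^sub>m m - perm_mat m \<xi>) * F = 0\<^sub>m m m" "transpose_mat (1\<^sub>m m - perm_mat m \<xi>) * F = 0\<^sub>m m m"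
proof -
  note [simp] = carrier_matD[OF e]
  have \<xi>m: "\<xi> i < m" if "i < m" for i using permutes_in_image[OF perm, of i] that by simp
  have \<rho>m: "inv \<xi> i < m" if "i < m" for i
    using permutes_in_image[OF permutes_inv[OF perm], of i] that by simp
  have sk: "e $$ (j, i) = - e $$ (i, j)" if "i < m" "j < m" for i j
    using arg_cong[OF alt, of "\<lambda>X. X $$ (i, j)"] that by simp
  have right: "e $$ (i, \<xi> j) = e $$ (i, j)" if "i < m" "j < m" for i j
  proof -
    have "(e * (1\<^sub>m m - perm_mat m \<xi>)) $$ (i, j) = (e * 1\<^sub>m m) $$ (i, j) - (e * perm_mat m \<xi>) $$ (i, j)"
      using that e by (subst mult_minus_distrib_mat[of _ m m _ m]) auto
    also have "\<dots> = e $$ (i, j) - e $$ (i, \<xi> j)"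
      using that e by (simp add: mult_perm_mat_index[OF perm e] del: index_mult_mat(1))
    finally show ?thesis using inv that by simp
  qed
  have left: "e $$ (\<xi> i, j) = e $$ (i, j)" if "i < m" "j < m" for i j
    using that right[of j i] sk[of j i] sk[of j "\<xi> i"] \<xi>m by simp
  have pm: "permutation \<xi>" using perm by (auto simp: permutation_permutes)
  \<comment> \<open>The smallest element labels an orbit, and the labels order the orbits
    linearly.\<close>
  define r where "r i = Min (orbit \<xi> i)" for i
  have r\<xi>: "r (\<xi> i) = r i" for i unfolding r_def permutation_orbit_step[OF pm] ..
  have pow: "(\<xi> ^^ k) i < m \<and> (j < m \<longrightarrow> e $$ ((\<xi> ^^ k) i, j) = e $$ (i, j) \<and> e $$ (j, (\<xi> ^^ k) i) = e $$ (j, i))"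
    if "i < m" for i j k
    using that by (induction k) (auto simp: \<xi>m left right)
  have rm: "r i < m" and rl: "j < m \<Longrightarrow> e $$ (r i, j) = e $$ (i, j)" and rr: "j < m \<Longrightarrow> e $$ (j, r i) = e $$ (j, i)"
    if "i < m" for i j
  proof -
    have "r i \<in> orbit \<xi> i" unfolding r_def
      using permutation_self_in_orbit[OF pm, of i] finite_orbit by (intro Min_in) auto
    then obtain k where "r i = (\<xi> ^^ k) i" unfolding orbit_altdef by auto
    with pow[OF that] show "r i < m" "j < m \<Longrightarrow> e $$ (r i, j) = e $$ (i, j)" "j < m \<Longrightarrow> e $$ (j, r i) = e $$ (j, i)"
      by auto
  qed
  have zero: "e $$ (i, j) = 0" if "i < m" "j < m" "r i = r j" for i j
  proof -
    have "e $$ (i, j) = e $$ (r i, r i)"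
      using that rl[of i "r i"] rr[of j i] rm by simp
    then show ?thesis using sk[of "r i" "r i"] rm[OF that(1)] by simp
  qed
  define F where "F = mat m m (\<lambda>(i, j). if r i < r j then e $$ (i, j) else 0)"
  have F: "F \<in> carrier_mat m m" by (simp add: F_def)
  show ?thesis
  proof (rule that[of F])
    show "F \<in> carrier_mat m m" by (rule F)
    show "e = F - transpose_mat F"
    proof (rule eq_matI)
      fix i j assume "i < dim_row (F - transpose_mat F)" "j < dim_col (F - transpose_mat F)"
      then have "i < m" "j < m" by (auto simp: F_def)
      then show "e $$ (i, j) = (F - transpose_mat F) $$ (i, j)"
        using sk[of i j] zero[of i j] by (cases "r i" "r j" rule: linorder_cases) (auto simp: F_def)
    qed (auto simp: F_def)
    have r\<rho>: "r (inv \<xi> i) = r i" for i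
      using r\<xi>[of "inv \<xi> i"] permutes_inverses[OF perm] by simp
    have e\<rho>: "e $$ (inv \<xi> i, j) = e $$ (i, j)" if "i < m" "j < m" for i j
      using left[of "inv \<xi> i" j] permutes_inverses[OF perm] that \<rho>m by simp
    show "(1\<^sub>m m - perm_mat m \<xi>) * F = 0\<^sub>m m m"
    proof (rule eq_matI)
      fix i j assume "i < dim_row (0\<^sub>m m m :: int mat)" "j < dim_col (0\<^sub>m m m :: int mat)"
      then have ij: "i < m" "j < m" by auto
      show "((1\<^sub>m m - perm_mat m \<xi>) * F) $$ (i, j) = 0\<^sub>m m m $$ (i, j)"
        unfolding one_minus_perm_index[OF F ij] using ij \<rho>m r\<rho> e\<rho> by (simp add: F_def)
    qed (auto simp: F_def)
    show "transpose_mat (1\<^sub>m m - perm_mat m \<xi>) * F = 0\<^sub>m m m"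
    proof (rule eq_matI)
      fix i j assume "i < dim_row (0\<^sub>m m m :: int mat)" "j < dim_col (0\<^sub>m m m :: int mat)"
      then have ij: "i < m" "j < m" by auto
      have "transpose_mat (1\<^sub>m m - perm_mat m \<xi>) = 1\<^sub>m m - perm_mat m (inv \<xi>)"
        by (simp add: transpose_minus[of _ m m] perm_mat_transpose[OF perm])
      then have "(transpose_mat (1\<^sub>m m - perm_mat m \<xi>) * F) $$ (i, j) = F $$ (i, j) - (perm_mat m (inv \<xi>) * F) $$ (i, j)"
        using F ij by (subst \<open>_ = 1\<^sub>m m - _\<close>, subst minus_mult_distrib_mat[of _ m m _ _ m]) auto
      also have "(perm_mat m (inv \<xi>) * F) $$ (i, j) = F $$ (\<xi> i, j)"
        using perm_mat_mult_index[OF permutes_inv[OF perm] F ij]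
        by (simp add: permutes_inv_inv[OF perm])
      finally show "(transpose_mat (1\<^sub>m m - perm_mat m \<xi>) * F) $$ (i, j) = 0\<^sub>m m m $$ (i, j)"
        using ij \<xi>m r\<xi> left by (simp add: F_def)
    qed (auto simp: F_def)
  qed
qed

section \<open>Extending partial isometries between the radicals\<close>

definition partial_isometry ::
    "nat \<Rightarrow> int mat \<Rightarrow> int mat \<Rightarrow> int mat \<Rightarrow> int mat \<Rightarrow> int mat \<Rightarrow> int mat \<Rightarrow> int mat \<Rightarrow> int mat \<Rightarrow> int mat \<Rightarrow> int mat \<Rightarrow> bool" where
  "partial_isometry n I I' G G' K K' S S' T T' \<longleftrightarrow> T \<in> carrier_mat n n \<and> T' \<in> carrier_mat n n \<and>
     gram_pair swap_biendo (ring_emb (1\<^sub>m n)) (ring_emb I) (ring_emb I') (ring_emb G) (ring_emb G')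
       (ring_emb K) (ring_emb K') (ring_emb S) (ring_emb S') (ring_emb T) (ring_emb T')"

text \<open>The part of the radical not yet exhausted by a partial isometry.\<close>

definition residue :: "nat \<Rightarrow> int mat \<Rightarrow> int mat \<Rightarrow> int mat \<Rightarrow> int mat \<Rightarrow> int mat" where
  "residue n I G S P = transpose_mat (1\<^sub>m n - S * I) * (G * ((1\<^sub>m n - P) * (1\<^sub>m n - S * I)))"

text \<open>The permutation is shared but the roots \<open>z\<close> and \<open>z'\<close> may
  differ: relabelling the vertices so that the permutations agree moves the root.\<close>

locale coxeter_pair =
  A: coxeter_datum m n z I G K S \<xi> + B: coxeter_datum m n z' I' G' K' S' \<xi>
  for m n z z' :: nat and I I' G G' K K' S S' :: "int mat" and \<xi> :: "nat \<Rightarrow> nat"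
begin

abbreviation "linked T T' \<equiv> partial_isometry n I I' G G' K K' S S' T T'"

lemma linked_zero: "linked (0\<^sub>m n n) (0\<^sub>m n n)"
  unfolding partial_isometry_def
proof (intro conjI)
  show "gram_pair swap_biendo (ring_emb (1\<^sub>m n)) (ring_emb I) (ring_emb I') (ring_emb G) (ring_emb G')
    (ring_emb K) (ring_emb K') (ring_emb S) (ring_emb S') (ring_emb (0\<^sub>m n n)) (ring_emb (0\<^sub>m n n))"
  proof
    show "ring_emb G * ring_emb K = ring_emb (1\<^sub>m n)" "ring_emb K * ring_emb G = ring_emb (1\<^sub>m n)"
      "ring_emb G' * ring_emb K' = ring_emb (1\<^sub>m n)" "ring_emb K' * ring_emb G' = ring_emb (1\<^sub>m n)"
      using A.GK B.GK by (simp_all add: ring_emb_mult[symmetric])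
    show "ring_emb G + swap_biendo (ring_emb G) = swap_biendo (ring_emb I) * ring_emb I"
      using arg_cong[OF A.sym, of ring_emb] by (simp add: ring_emb_simps)
    show "ring_emb G' + swap_biendo (ring_emb G') = swap_biendo (ring_emb I') * ring_emb I'"
      using arg_cong[OF B.sym, of ring_emb] by (simp add: ring_emb_simps)
    show "ring_emb I * ring_emb S * ring_emb I = ring_emb I"
      using arg_cong[OF A.section_I, of ring_emb] by (simp add: ring_emb_simps)
    show "ring_emb I' * ring_emb S' * ring_emb I' = ring_emb I'"
      using arg_cong[OF B.section_I, of ring_emb] by (simp add: ring_emb_simps)
    show "ring_emb I * ring_emb S * ring_emb I' = ring_emb I'"
      using arg_cong[OF A.section_mult[OF B.I B.col_sum], of ring_emb] by (simp add: ring_emb_simps)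
    show "ring_emb I' * ring_emb S' * ring_emb I = ring_emb I"
      using arg_cong[OF B.section_mult[OF A.I A.col_sum], of ring_emb] by (simp add: ring_emb_simps)
    have "I' * (K' * transpose_mat I') = I * (K * transpose_mat I)"
      unfolding A.laplacian' B.laplacian' ..
    from arg_cong[OF this, of ring_emb]
    show "ring_emb I' * ring_emb K' * swap_biendo (ring_emb I') = ring_emb I * ring_emb K * swap_biendo (ring_emb I)"
      by (simp add: ring_emb_simps mult.assoc)
  qed (simp_all add: ring_emb_simps ring_emb_unit swap.star_simps)
qed simp_all

lemma isometry_of_full:
  assumes "linked T T'" and full: "residue n I' G' S' (T' * T) = 0\<^sub>m n n"
  shows "\<exists>X\<in>carrier_mat n n. transpose_mat X * G * X = G'"
proof -
  have T: "T \<in> carrier_mat n n" "T' \<in> carrier_mat n n" using assms(1) by (auto simp: partial_isometry_def)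
  note [simp] = carrier_matD[OF T(1)] carrier_matD[OF T(2)]
  interpret gp: gram_pair swap_biendo "ring_emb (1\<^sub>m n)" "ring_emb I" "ring_emb I'" "ring_emb G" "ring_emb G'"
    "ring_emb K" "ring_emb K'" "ring_emb S" "ring_emb S'" "ring_emb T" "ring_emb T'"
    using assms(1) by (simp add: partial_isometry_def)
  let ?e = ring_emb and ?s = swap_biendo
  \<comment> \<open>The 1 of the ring is larger than the embedded identity matrix. The surplus
    disappears because it meets \<open>G'\<close>, which absorbs
    \<open>ring_emb (1\<^sub>m n)\<close>.\<close>
  have full': "?s (1 - ?e S' * ?e I') * (?e G' * ((1 - ?e T' * ?e T) * (1 - ?e S' * ?e I'))) = 0"
  proof -
    have "?e (1\<^sub>m n) * (1 - ?e S' * ?e I') = ?e (1\<^sub>m n - S' * I')"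
      "?s (?e (1\<^sub>m n) * (1 - ?e S' * ?e I')) = ?s (?e (1\<^sub>m n - S' * I'))"
      by (simp_all add: ring_emb_simps ring_emb_unit algebra_simps)
    have "?s (1 - ?e S' * ?e I') * (?e G' * ((1 - ?e T' * ?e T) * (1 - ?e S' * ?e I')))
      = ?s (1 - ?e S' * ?e I') * (?e (1\<^sub>m n) * (?e G' * ((?e (1\<^sub>m n) - ?e T' * ?e T) * (?e (1\<^sub>m n) * (1 - ?e S' * ?e I')))))
        + ?s (1 - ?e S' * ?e I') * (?e G' * ((1 - ?e (1\<^sub>m n)) * (1 - ?e S' * ?e I')))"
      by (simp add: algebra_simps ring_emb_unit)
    also have "?e G' * ((1 - ?e (1\<^sub>m n)) * (1 - ?e S' * ?e I')) = 0"
      by (simp add: algebra_simps ring_emb_unit)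
    also have "?s (1 - ?e S' * ?e I') * (?e (1\<^sub>m n) * (?e G' * ((?e (1\<^sub>m n) - ?e T' * ?e T) * (?e (1\<^sub>m n) * (1 - ?e S' * ?e I')))))
      = ?e (residue n I' G' S' (T' * T))"
      unfolding residue_def
      by (simp add: ring_emb_simps ring_emb_unit swap.star_simps algebra_simps)
    finally show ?thesis by (simp add: full ring_emb_zero)
  qed
  define J where "J = K * transpose_mat I"
  define J' where "J' = K' * transpose_mat I'"
  have [simp]: "dim_row J = n" "dim_col J = m" "dim_row J' = n" "dim_col J' = m"
    by (simp_all add: J_def J'_def)
  have eJ: "?e J = gp.J" "?e J' = gp.J'"
    by (simp_all add: J_def J'_def gp.J_def gp.J'_def ring_emb_simps)
  define X0 where "X0 = J * (transpose_mat S' * G') + S * (I' * (1\<^sub>m n - J' * (transpose_mat S' * G')))"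
  have [simp]: "dim_row X0 = n" "dim_col X0 = n" by (simp_all add: X0_def)
  have eX0: "?e X0 = gp.X0"
    by (simp add: X0_def gp.X0_def ring_emb_simps eJ[symmetric] ring_emb_unit algebra_simps)
  define X1 where "X1 = T + (1\<^sub>m n - T * T') * (X0 * (1\<^sub>m n - T' * T))"
  have [simp]: "dim_row X1 = n" "dim_col X1 = n" by (simp_all add: X1_def)
  have eX1: "?e X1 = gp.X1"
    by (simp add: X1_def gp.X1_def ring_emb_simps eX0[symmetric] ring_emb_unit algebra_simps)
  define E where "E = transpose_mat X1 * (G * X1) - G'"
  have [simp]: "dim_row E = n" "dim_col E = n" by (simp_all add: E_def)
  have eE: "?e E = gp.E"
    by (simp add: E_def gp.E_def ring_emb_simps eX1[symmetric])
  define eps where "eps = transpose_mat S' * (E * S')"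
  have [simp]: "dim_row eps = m" "dim_col eps = m" by (simp_all add: eps_def)
  have eeps: "?e eps = gp.eps"
    by (simp add: eps_def gp.eps_def ring_emb_simps eE[symmetric])
  have IJ: "I * J = 1\<^sub>m m - perm_mat m \<xi>" unfolding J_def by (rule A.laplacian')
  have 1: "eps * (1\<^sub>m m - perm_mat m \<xi>) = 0\<^sub>m m m"
    unfolding IJ[symmetric] using gp.eps_D[OF full']
    by (intro ring_emb_inj) (simp_all add: ring_emb_simps eJ eeps)
  have e0: "transpose_mat eps + eps = 0\<^sub>m m m"
    using gp.star_eps[OF full'] by (intro ring_emb_inj) (simp_all add: ring_emb_simps eeps)
  then have 2: "transpose_mat eps = - eps"
  proof (intro eq_matI)
    fix i j assume "i < dim_row (- eps)" "j < dim_col (- eps)"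
    then show "transpose_mat eps $$ (i, j) = (- eps) $$ (i, j)"
      using arg_cong[OF e0, of "\<lambda>X. X $$ (i, j)"] by (simp add: eq_neg_iff_add_eq_0)
  qed simp_all
  obtain F where F: "F \<in> carrier_mat m m" "eps = F - transpose_mat F"
    "(1\<^sub>m m - perm_mat m \<xi>) * F = 0\<^sub>m m m" "transpose_mat (1\<^sub>m m - perm_mat m \<xi>) * F = 0\<^sub>m m m"
    by (rule A.alternating_invariant_split[OF carrier_matI[of eps m m] 2 1]) simp_all
  note [simp] = carrier_matD[OF F(1)]
  define X where "X = X1 - J * (F * I')"
  have [simp]: "dim_row X = n" "dim_col X = n" by (simp_all add: X_def)
  have eX: "?e X = gp.X1 - gp.J * (?e F * ?e I')"
    by (simp add: X_def ring_emb_simps eX1 eJ)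
  have "?s (gp.X1 - gp.J * (?e F * ?e I')) * (?e G * (gp.X1 - gp.J * (?e F * ?e I'))) = ?e G'"
  proof (rule gp.isometry[OF full'])
    show "gp.eps = ?e F - ?s (?e F)"
      using arg_cong[OF F(2), of ?e] by (simp add: eeps ring_emb_simps)
    show "?e I * gp.J * ?e F = 0"
      using arg_cong[OF F(3)[folded IJ], of ?e] by (simp add: eJ ring_emb_simps)
    show "?s (?e I * gp.J) * ?e F = 0"
      using arg_cong[OF F(4)[folded IJ], of ?e] by (simp add: eJ ring_emb_simps)
  qed
  then have "transpose_mat X * G * X = G'"
    by (intro ring_emb_inj) (simp_all add: ring_emb_simps eX mult.assoc)
  then show ?thesis by (intro bexI[of _ X]) (auto intro: carrier_matI)
qed

text \<open>As long as both radicals have something left to pair, each offers a hyperbolic plane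
  orthogonal to the matched part, and these two planes are matched with one another.\<close>

lemma linked_extend:
  assumes l: "linked T T'"
    and nz: "residue n I G S (T * T') \<noteq> 0\<^sub>m n n" "residue n I' G' S' (T' * T) \<noteq> 0\<^sub>m n n"
  shows "\<exists>T2 T2'. linked T2 T2' \<and> image_mod2 (T' * T) \<subset> image_mod2 (T2' * T2)"
proof -
  have T: "T \<in> carrier_mat n n" "T' \<in> carrier_mat n n" using l by (auto simp: partial_isometry_def)
  note [simp] = carrier_matD[OF T(1)] carrier_matD[OF T(2)]
  interpret gp: gram_pair swap_biendo "ring_emb (1\<^sub>m n)" "ring_emb I" "ring_emb I'" "ring_emb G" "ring_emb G'"
    "ring_emb K" "ring_emb K'" "ring_emb S" "ring_emb S'" "ring_emb T" "ring_emb T'"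
    using l by (simp add: partial_isometry_def)
  let ?e = ring_emb and ?s = swap_biendo
  note TT = gp.TT gp.TT[THEN mult_eq_assoc]
  obtain y k where yk: "y \<in> carrier_mat n 1" "k \<in> carrier_mat n 1" "I * y = 0\<^sub>m m 1" "I * k = 0\<^sub>m m 1"
    "T * T' * y = 0\<^sub>m n 1" "T * T' * k = 0\<^sub>m n 1" "transpose_mat y * (G * k) = 1\<^sub>m 1"
  proof (rule A.hyperbolic_pair[of "T * T'"])
    show "T * T' \<in> carrier_mat n n" by (auto intro: carrier_matI)
    show "T * T' * (T * T') = T * T'"
      by (rule ring_emb_inj) (simp_all add: ring_emb_simps gp.TT[THEN mult_eq_assoc, unfolded mult.assoc]
        gp.TT[unfolded mult.assoc] mult.assoc)
    show "I * (T * T') = 0\<^sub>m m n"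
      by (rule ring_emb_inj) (simp_all add: ring_emb_simps mult_eq_assoc[OF gp.TI(1)])
    show "T * T' * (K * transpose_mat I) = 0\<^sub>m n m"
      by (rule ring_emb_inj) (simp_all add: ring_emb_simps mult.assoc gp.TJ(2)[unfolded gp.J_def])
    show "transpose_mat (T * T') * G = G * (T * T')"
      by (rule ring_emb_inj) (simp_all add: ring_emb_simps swap.star_simps mult.assoc gp.adj
         mult_eq_assoc[OF gp.adj'] )
    show "transpose_mat (1\<^sub>m n - S * I) * (G * ((1\<^sub>m n - T * T') * (1\<^sub>m n - S * I))) \<noteq> 0\<^sub>m n n"
      using nz(1) by (simp add: residue_def)
  qed
  obtain y' k' where yk': "y' \<in> carrier_mat n 1" "k' \<in> carrier_mat n 1" "I' * y' = 0\<^sub>m m 1" "I' * k' = 0\<^sub>m m 1"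
    "T' * T * y' = 0\<^sub>m n 1" "T' * T * k' = 0\<^sub>m n 1" "transpose_mat y' * (G' * k') = 1\<^sub>m 1"
  proof (rule B.hyperbolic_pair[of "T' * T"])
    show "T' * T \<in> carrier_mat n n" by (auto intro: carrier_matI)
    show "T' * T * (T' * T) = T' * T"
      by (rule ring_emb_inj) (simp_all add: ring_emb_simps gp.TT[THEN mult_eq_assoc, unfolded mult.assoc]
        gp.TT[unfolded mult.assoc] mult.assoc)
    show "I' * (T' * T) = 0\<^sub>m m n"
      by (rule ring_emb_inj) (simp_all add: ring_emb_simps mult_eq_assoc[OF gp.TI(2)])
    show "T' * T * (K' * transpose_mat I') = 0\<^sub>m n m"
      by (rule ring_emb_inj) (simp_all add: ring_emb_simps mult.assoc gp.TJ(1)[unfolded gp.J'_def])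
    show "transpose_mat (T' * T) * G' = G' * (T' * T)"
      by (rule ring_emb_inj) (simp_all add: ring_emb_simps swap.star_simps mult.assoc gp.adj'[symmetric]
         mult_eq_assoc[OF gp.adj[symmetric]])
    show "transpose_mat (1\<^sub>m n - S' * I') * (G' * ((1\<^sub>m n - T' * T) * (1\<^sub>m n - S' * I'))) \<noteq> 0\<^sub>m n n"
      using nz(2) by (simp add: residue_def)
  qed
  note [simp] = carrier_matD[OF yk(1)] carrier_matD[OF yk(2)] carrier_matD[OF yk'(1)] carrier_matD[OF yk'(2)]
  define T2 where "T2 = T + y * (transpose_mat k' * transpose_mat G') + k * (transpose_mat y' * G')"
  define T2' where "T2' = T' + y' * (transpose_mat k * transpose_mat G) + k' * (transpose_mat y * G)"
  have [simp]: "dim_row T2 = n" "dim_col T2 = n" "dim_row T2' = n" "dim_col T2' = n"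
    by (simp_all add: T2_def T2'_def)
  have eT2: "?e T2 = ?e T + ?e y * (?s (?e k') * ?s (?e G')) + ?e k * (?s (?e y') * ?e G')"
    and eT2': "?e T2' = ?e T' + ?e y' * (?s (?e k) * ?s (?e G)) + ?e k' * (?s (?e y) * ?e G)"
    by (simp_all add: T2_def T2'_def ring_emb_simps)
  have z: "?e T * (?e T' * ?e y) = 0" "?e T * (?e T' * ?e k) = 0" "?e T' * (?e T * ?e y') = 0" "?e T' * (?e T * ?e k') = 0"
    using yk(5,6)[THEN arg_cong[of _ _ ?e]] yk'(5,6)[THEN arg_cong[of _ _ ?e]]
    by (simp_all add: ring_emb_simps mult.assoc)
  have z2: "?e T' * ?e y = 0" "?e T' * ?e k = 0" "?e T * ?e y' = 0" "?e T * ?e k' = 0"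
    using mult_eq_assoc[OF gp.TT(2), of "?e y"] mult_eq_assoc[OF gp.TT(2), of "?e k"]
      mult_eq_assoc[OF gp.TT(1), of "?e y'"] mult_eq_assoc[OF gp.TT(1), of "?e k'"] z
      gp.TT
    by (metis mult.assoc mult_zero_right)+
  have ex: "gram_pair ?s (?e (1\<^sub>m n)) (?e I) (?e I') (?e G) (?e G') (?e K) (?e K') (?e S) (?e S') (?e T2) (?e T2')"
    "?e T2' * ?e T2 * (?e T' * ?e T) = ?e T' * ?e T" "?e T2' * ?e T2 * ?e y' = ?e y'"
    "?s (?e k') * ?s (?e G') * (?e T' * ?e T) = 0" "?s (?e k') * ?s (?e G') * ?e y' = ?e (1\<^sub>m 1)"
  proof -
    have w: "?e y * ?e (1\<^sub>m 1) = ?e y" "?e k * ?e (1\<^sub>m 1) = ?e k" "?e y' * ?e (1\<^sub>m 1) = ?e y'"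
      "?e k' * ?e (1\<^sub>m 1) = ?e k'" "?s (?e (1\<^sub>m 1)) = ?e (1\<^sub>m 1)"
      by (simp_all add: ring_emb_unit del: One_nat_def)
    have uu: "?e (1\<^sub>m n) * ?e y = ?e y" "?e (1\<^sub>m n) * ?e k = ?e k" "?e (1\<^sub>m n) * ?e y' = ?e y'" "?e (1\<^sub>m n) * ?e k' = ?e k'"
      by (simp_all add: ring_emb_unit)
    have I0: "?e I * ?e y = 0" "?e I * ?e k = 0" "?e I' * ?e y' = 0" "?e I' * ?e k' = 0"
      using yk(3,4)[THEN arg_cong[of _ _ ?e]] yk'(3,4)[THEN arg_cong[of _ _ ?e]]
      by (simp_all add: ring_emb_simps)
    have b1: "?s (?e y) * (?e G * ?e k) = ?e (1\<^sub>m 1)" "?s (?e y') * (?e G' * ?e k') = ?e (1\<^sub>m 1)"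
      using yk(7)[THEN arg_cong[of _ _ ?e]] yk'(7)[THEN arg_cong[of _ _ ?e]]
      by (simp_all add: ring_emb_simps)
    have b0: "?s (?e y) * (?e G * ?e y) = 0" "?s (?e k) * (?e G * ?e k) = 0"
      "?s (?e y') * (?e G' * ?e y') = 0" "?s (?e k') * (?e G' * ?e k') = 0"
      using A.form_zero[OF yk(1,3), THEN arg_cong[of _ _ ?e]] A.form_zero[OF yk(2,4), THEN arg_cong[of _ _ ?e]]
        B.form_zero[OF yk'(1,3), THEN arg_cong[of _ _ ?e]] B.form_zero[OF yk'(2,4), THEN arg_cong[of _ _ ?e]]
      by (simp_all add: ring_emb_simps)
    note ext = gp.extend[OF w uu I0 z2 b1 b0, folded eT2 eT2']
    show "gram_pair ?s (?e (1\<^sub>m n)) (?e I) (?e I') (?e G) (?e G') (?e K) (?e K') (?e S) (?e S') (?e T2) (?e T2')"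
      "?e T2' * ?e T2 * (?e T' * ?e T) = ?e T' * ?e T" "?e T2' * ?e T2 * ?e y' = ?e y'"
      "?s (?e k') * ?s (?e G') * (?e T' * ?e T) = 0" "?s (?e k') * ?s (?e G') * ?e y' = ?e (1\<^sub>m 1)"
      by (fact ext(1), fact ext(3), fact ext(4), fact ext(5), fact ext(6))
  qed
  have "linked T2 T2'"
    unfolding partial_isometry_def using ex(1) by (auto intro: carrier_matI)
  \<comment> \<open>The separating functional is the pairing with \<open>k'\<close>: it kills the
    old matched part and is 1 on the new vector \<open>y'\<close>.\<close>
  moreover have "image_mod2 (T' * T) \<subset> image_mod2 (T2' * T2)"
  proof (rule image_mod2_psubset[where n = n and y = y' and a = "transpose_mat k' * transpose_mat G'"])
    show "T2' * T2 * (T' * T) = T' * T"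
      using ex(2) by (intro ring_emb_inj) (simp_all add: ring_emb_simps)
    show "T2' * T2 * y' = y'"
      using ex(3) by (intro ring_emb_inj) (simp_all add: ring_emb_simps)
    show "transpose_mat k' * transpose_mat G' * (T' * T) = 0\<^sub>m 1 n"
      using ex(4) by (intro ring_emb_inj) (simp_all add: ring_emb_simps)
    show "transpose_mat k' * transpose_mat G' * y' = 1\<^sub>m 1"
      using ex(5) by (intro ring_emb_inj) (simp_all add: ring_emb_simps)
  qed (auto intro: carrier_matI)
  ultimately show ?thesis by blast
qed

text \<open>Every extension strictly enlarges a subset of the finite set of binary vectors of length
  \<open>n\<close>, so extending must stop.\<close>

lemma exists_full:
  "\<exists>T T'. linked T T' \<and> (residue n I G S (T * T') = 0\<^sub>m n n \<or> residue n I' G' S' (T' * T) = 0\<^sub>m n n)"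
proof (rule ccontr)
  assume no: "\<not> ?thesis"
  define B :: "(nat \<Rightarrow> int) set" where
    "B = {f. \<forall>i. (i \<in> {..<n} \<longrightarrow> f i \<in> {0, 1}) \<and> (i \<notin> {..<n} \<longrightarrow> f i = 0)}"
  have fin: "finite B" unfolding B_def by (rule finite_bits)
  have sub: "image_mod2 (T' * T) \<subseteq> B" if "linked T T'" for T T'
    unfolding B_def using that by (intro image_mod2_subset) (auto simp: partial_isometry_def)
  have "\<exists>T T'. linked T T' \<and> k \<le> card (image_mod2 (T' * T))" for k
  proof (induction k)
    case 0
    show ?case using linked_zero by auto
  next
    case (Suc k)
    then obtain T T' where T: "linked T T'" "k \<le> card (image_mod2 (T' * T))" by blast
    obtain T2 T2' where T2: "linked T2 T2'" "image_mod2 (T' * T) \<subset> image_mod2 (T2' * T2)"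
      using linked_extend[OF T(1)] no T(1) by blast
    have "card (image_mod2 (T' * T)) < card (image_mod2 (T2' * T2))"
      using T2(2) finite_subset[OF sub[OF T2(1)] fin] by (intro psubset_card_mono)
    with T T2 show ?case by (intro exI[of _ T2] exI[of _ T2']) auto
  qed
  then obtain T T' where "linked T T'" "Suc (card B) \<le> card (image_mod2 (T' * T))" by blast
  with sub card_mono[OF fin] show False by (meson Suc_n_not_le_n le_trans)
qed

end

text \<open>Which radical is exhausted first is left open, whence the disjunction; both alternatives
  become congruences once unimodularity makes \<open>X\<close> invertible.\<close>

theorem coxeter_datum_isometry:
  assumes A: "coxeter_datum m n z I G K S \<xi>" and B: "coxeter_datum m n z' I' G' K' S' \<xi>"
  shows "\<exists>X\<in>carrier_mat n n. transpose_mat X * G * X = G' \<or> transpose_mat X * G' * X = G"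
proof -
  interpret AB: coxeter_pair m n z z' I I' G G' K K' S S' \<xi> using A B by (simp add: coxeter_pair_def)
  interpret BA: coxeter_pair m n z' z I' I G' G K' K S' S \<xi> using A B by (simp add: coxeter_pair_def)
  obtain T T' where T: "AB.linked T T'"
    and full: "residue n I G S (T * T') = 0\<^sub>m n n \<or> residue n I' G' S' (T' * T) = 0\<^sub>m n n"
    using AB.exists_full by blast
  have T': "BA.linked T' T"
    using T gram_pair.flip unfolding partial_isometry_def by blast
  from full show ?thesis
  proof
    assume "residue n I G S (T * T') = 0\<^sub>m n n"
    from BA.isometry_of_full[OF T' this] show ?thesis by blast
  next
    assume "residue n I' G' S' (T' * T) = 0\<^sub>m n n"
    from AB.isometry_of_full[OF T this] show ?thesis by blast
  qed
qed

section \<open>Triangular Gram matrices\<close>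

lemma mult_mat_unit_vec:
  fixes A :: "int mat"
  assumes "A \<in> carrier_mat r n" "j < n"
  shows "A *\<^sub>v unit_vec n j = col A j"
proof (rule eq_vecI)
  fix i assume "i < dim_vec (col A j)"
  then have "i < r" "row A i \<in> carrier_vec n" using assms by auto
  then show "(A *\<^sub>v unit_vec n j) $ i = col A j $ i"
    using assms by (simp add: scalar_prod_right_unit)
qed (use assms in simp)

lemma unit_vec_form:
  fixes A :: "int mat"
  assumes "A \<in> carrier_mat n n" "i < n" "j < n"
  shows "unit_vec n i \<bullet> (A *\<^sub>v unit_vec n j) = A $$ (i, j)"
proof -
  have "col A j \<in> carrier_vec n" using assms by auto
  then show ?thesis
    using assms by (simp add: scalar_prod_left_unit mult_mat_unit_vec[OF assms(1)])
qed

lemma polar_form_unit_vec: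
  assumes A: "A \<in> carrier_mat n n" and q: "\<And>x. x \<in> carrier_vec n \<Longrightarrow> q x = x \<bullet> (A *\<^sub>v x)"
    and ij: "i < n" "j < n"
  shows "polar_form q (unit_vec n i) (unit_vec n j) = A $$ (i, j) + A $$ (j, i)"
proof -
  have "A *\<^sub>v (unit_vec n i + unit_vec n j) = A *\<^sub>v unit_vec n i + A *\<^sub>v unit_vec n j"
    by (rule mult_add_distrib_mat_vec[OF A]) auto
  moreover have "A *\<^sub>v unit_vec n i \<in> carrier_vec n" "A *\<^sub>v unit_vec n j \<in> carrier_vec n"
    using A by auto
  ultimately show ?thesis
    using A by (simp add: polar_form_def q scalar_prod_add_distrib[of _ n] add_scalar_prod_distrib[of _ n]
        unit_vec_form ij)
qed

lemma tri_gram_eqI: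
  assumes A: "A \<in> carrier_mat n n" "upper_triangular A"
    and q: "\<And>x. x \<in> carrier_vec n \<Longrightarrow> q x = x \<bullet> (A *\<^sub>v x)"
  shows "tri_gram n q = A"
  unfolding tri_gram_def
proof (rule the_equality)
  fix B assume B: "B \<in> carrier_mat n n \<and> upper_triangular B \<and> (\<forall>x\<in>carrier_vec n. q x = x \<bullet> (B *\<^sub>v x))"
  show "B = A"
  proof (rule eq_matI)
    fix i j assume "i < dim_row A" "j < dim_col A"
    then have ij: "i < n" "j < n" using A by auto
    have e: "A $$ (i, j) + A $$ (j, i) = B $$ (i, j) + B $$ (j, i)"
      using polar_form_unit_vec[of A n q i j] polar_form_unit_vec[of B n q i j] A q B ij by simp
    show "B $$ (i, j) = A $$ (i, j)"
      using e upper_triangularD[OF A(2), of i j] upper_triangularD[OF A(2), of j i]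
        upper_triangularD[of B i j] upper_triangularD[of B j i] A B ij
      by (cases i j rule: linorder_cases) auto
  qed (use A B in auto)
qed (use assms in blast)

lemma gram_eqI:
  assumes A: "A \<in> carrier_mat n n" and q: "\<And>x. x \<in> carrier_vec n \<Longrightarrow> q x = x \<bullet> (A *\<^sub>v x)"
  shows "gram n q = A + transpose_mat A"
  using A polar_form_unit_vec[OF A q] by (intro eq_matI) (auto simp: gram_def)

lemma int_mat_inverse_eqI:
  assumes "G \<in> carrier_mat n n" "K \<in> carrier_mat n n" "G * K = 1\<^sub>m n" "K * G = 1\<^sub>m n"
  shows "int_mat_inverse n G = K"
  unfolding int_mat_inverse_def
proof (rule the_equality)
  fix B assume B: "B \<in> carrier_mat n n \<and> inverts_mat G B \<and> inverts_mat B G"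
  then have "B * G = 1\<^sub>m n" using assms by (auto simp: inverts_mat_def)
  have "B = B * (G * K)" using B by (simp add: assms right_mult_one_mat[of B n])
  also have "\<dots> = (B * G) * K" using B assms by (simp add: assoc_mult_mat[of _ n n _ n _ n])
  also have "\<dots> = K" using \<open>B * G = 1\<^sub>m n\<close> assms by simp
  finally show "B = K" .
qed (use assms in \<open>auto simp: inverts_mat_def\<close>)

lemma unimodular_inverse:
  assumes G: "(G :: int mat) \<in> carrier_mat n n" and d: "det G = 1"
  obtains K where "K \<in> carrier_mat n n" "G * K = 1\<^sub>m n" "K * G = 1\<^sub>m n"
proof -
  have "1 \<cdot>\<^sub>m 1\<^sub>m n = (1\<^sub>m n :: int mat)" by (rule eq_matI) auto
  then show ?thesis using adj_mat[OF G] d that[of "adj_mat G"] by simp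
qed

section \<open>Quivers\<close>

definition arrow_rel :: "nat \<Rightarrow> (nat \<Rightarrow> nat) \<Rightarrow> (nat \<Rightarrow> nat) \<Rightarrow> (nat \<times> nat) set" where
  "arrow_rel n s t = (\<Union>j<n. {(s j, t j), (t j, s j)})"

text \<open>The transposition of the last listed arrow acts first, which matches back substitution
  in an upper triangular system.\<close>

definition arrow_perm :: "(nat \<Rightarrow> nat) \<Rightarrow> (nat \<Rightarrow> nat) \<Rightarrow> nat list \<Rightarrow> nat \<Rightarrow> nat" where
  "arrow_perm s t js = foldr (\<lambda>j f. Transposition.transpose (s j) (t j) \<circ> f) js id"

locale arrows =
  fixes m n :: nat and s t :: "nat \<Rightarrow> nat"
  assumes vert: "j < n \<Longrightarrow> s j < m" "j < n \<Longrightarrow> t j < m"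
    and loopless: "j < n \<Longrightarrow> s j \<noteq> t j"
begin

definition Inc :: "int mat" where
  "Inc = mat m n (\<lambda>(i, j). (if i = s j then 1 else 0) - (if i = t j then 1 else 0))"

definition Tri :: "int mat" where
  "Tri = mat n n (\<lambda>(i, j). if i < j then (transpose_mat Inc * Inc) $$ (i, j) else if i = j then 1 else 0)"

lemma Inc_carrier [simp]: "Inc \<in> carrier_mat m n" "dim_row Inc = m" "dim_col Inc = n"
  by (simp_all add: Inc_def)

lemma Tri_carrier [simp]: "Tri \<in> carrier_mat n n" "dim_row Tri = n" "dim_col Tri = n"
  by (simp_all add: Tri_def)

lemma Tri_upper: "upper_triangular Tri"
  by (auto simp: Tri_def upper_triangular_def)

lemma Inc_gram_index:
  "i < n \<Longrightarrow> j < n \<Longrightarrow> (transpose_mat Inc * Inc) $$ (i, j) = (\<Sum>k<m. Inc $$ (k, i) * Inc $$ (k, j))"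
  by (simp add: scalar_prod_def atLeast0LessThan)

lemma sum_Inc_mult:
  assumes "j < n"
  shows "(\<Sum>k<m. Inc $$ (k, j) * f k) = f (s j) - f (t j)"
proof -
  have "(\<Sum>k<m. Inc $$ (k, j) * f k) = (\<Sum>k<m. (if k = s j then f k else 0) - (if k = t j then f k else 0))"
    using assms by (intro sum.cong) (auto simp: Inc_def)
  also have "\<dots> = f (s j) - f (t j)"
    using vert[OF assms] by (simp add: sum_subtractf)
  finally show ?thesis .
qed

lemma Inc_gram_diag: "j < n \<Longrightarrow> (transpose_mat Inc * Inc) $$ (j, j) = 2"
  using vert[of j] loopless[of j] by (simp add: Inc_gram_index sum_Inc_mult del: index_mult_mat) (simp add: Inc_def)

lemma Tri_sym: "Tri + transpose_mat Tri = transpose_mat Inc * Inc"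
proof (rule eq_matI)
  fix i j assume "i < dim_row (transpose_mat Inc * Inc)" "j < dim_col (transpose_mat Inc * Inc)"
  then have ij: "i < n" "j < n" by auto
  have "(transpose_mat Inc * Inc) $$ (j, i) = (transpose_mat Inc * Inc) $$ (i, j)"
    using ij by (simp add: Inc_gram_index mult.commute del: index_mult_mat)
  then show "(Tri + transpose_mat Tri) $$ (i, j) = (transpose_mat Inc * Inc) $$ (i, j)"
    using ij Inc_gram_diag[of i] by (cases i j rule: linorder_cases) (simp_all add: Tri_def del: index_mult_mat)
qed simp_all

lemma col_sum: "j < n \<Longrightarrow> (\<Sum>i<m. Inc $$ (i, j)) = 0"
  using sum_Inc_mult[of j "\<lambda>_. 1"] by simp

lemma det_Tri: "det Tri = 1"
proof -
  have "diag_mat Tri = map (\<lambda>_. 1) [0..<n]"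
    unfolding diag_mat_def by (auto simp: Tri_def)
  then show ?thesis
    using det_upper_triangular[OF Tri_upper Tri_carrier(1)] by (simp add: prod_list_replicate map_replicate_const)
qed

lemma arrow_perm_permutes:
  "set js \<subseteq> {..<n} \<Longrightarrow> arrow_perm s t js permutes {..<m}"
proof (induction js)
  case Nil
  then show ?case by (simp add: arrow_perm_def permutes_id[unfolded id_def])
next
  case (Cons j js)
  then have "arrow_perm s t js permutes {..<m}" "Transposition.transpose (s j) (t j) permutes {..<m}"
    using vert by (auto intro: permutes_swap_id)
  then have "Transposition.transpose (s j) (t j) \<circ> arrow_perm s t js permutes {..<m}"
    by (rule permutes_compose)
  then show ?case by (simp add: arrow_perm_def comp_def)
qed

text \<open>
  \<open>1 - I G\<^sup>-\<^sup>1 I\<^sup>t\<^sup>r\<close> is the product of the reflections at the columns of \<open>I\<close>, and these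
  reflections are transpositions of coordinates.
\<close>

lemma Inc_laplacian:
  assumes K: "K \<in> carrier_mat n n" "Tri * K = 1\<^sub>m n"
  shows "1\<^sub>m m - Inc * K * transpose_mat Inc = perm_mat m (arrow_perm s t [0..<n])"
proof (rule eq_matI)
  note [simp] = carrier_matD[OF K(1)]
  define C where "C = K * transpose_mat Inc"
  have [simp]: "dim_row C = n" "dim_col C = m" by (simp_all add: C_def)
  have TC: "Tri * C = transpose_mat Inc"
  proof -
    have "Tri * C = (Tri * K) * transpose_mat Inc"
      unfolding C_def by (rule assoc_mult_mat[of _ n n _ n _ m, symmetric]) (use K in auto)
    then show ?thesis by (simp add: K)
  qed
  fix i v assume "i < dim_row (perm_mat m (arrow_perm s t [0..<n]))" "v < dim_col (perm_mat m (arrow_perm s t [0..<n]))"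
  then have i: "i < m" and v: "v < m" by auto
  \<comment> \<open>\<open>x k\<close> is the basis vector of \<open>v\<close> after the reflections
    at the arrows \<open>k\<close>, ..., \<open>n - 1\<close>. Upper triangularity lets row
    \<open>k\<close> of \<open>Tri * C = transpose_mat Inc\<close> compute row \<open>k\<close> of
    \<open>C\<close> from the later rows, so the induction descends from \<open>n\<close>.\<close>
  define x where "x k i = (if i = v then 1 else 0) - (\<Sum>j=k..<n. C $$ (j, v) * Inc $$ (i, j))" for k i
  have xk: "\<forall>i<m. x k i = (if i = arrow_perm s t [k..<n] v then 1 else 0)" if "k \<le> n" for k
    using that
  proof (induction k rule: inc_induct)
    case base
    then show ?case by (simp add: x_def arrow_perm_def)
  next
    case (step k)
    define w where "w = arrow_perm s t [Suc k..<n] v"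
    have w: "w < m"
      using permutes_in_image[OF arrow_perm_permutes[of "[Suc k..<n]"], of v] v by (simp add: w_def subset_eq)
    have k: "k < n" using step by simp
    \<comment> \<open>The coefficient is the inner product of column \<open>k\<close> with the
      current basis vector, that of \<open>w\<close>, as in the formula for the reflection at a
      vector of norm 2.\<close>
    have c: "C $$ (k, v) = Inc $$ (w, k)"
    proof -
      have tri: "Tri $$ (k, j) = (\<Sum>l<m. Inc $$ (l, k) * Inc $$ (l, j))" if "j \<in> {Suc k..<n}" for j
        using that k by (simp add: Tri_def Inc_gram_index del: index_mult_mat)
      have "Inc $$ (v, k) = (Tri * C) $$ (k, v)" unfolding TC using k v by simp
      also have "\<dots> = (\<Sum>j\<in>{..<n}. Tri $$ (k, j) * C $$ (j, v))"
        using k v by (simp add: scalar_prod_def atLeast0LessThan)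
      also have "\<dots> = (\<Sum>j\<in>{k..<n}. Tri $$ (k, j) * C $$ (j, v))"
        using k by (intro sum.mono_neutral_right) (auto simp: Tri_def)
      also have "\<dots> = C $$ (k, v) + (\<Sum>j\<in>{Suc k..<n}. Tri $$ (k, j) * C $$ (j, v))"
        using k by (simp add: sum.atLeast_Suc_lessThan Tri_def)
      also have "(\<Sum>j\<in>{Suc k..<n}. Tri $$ (k, j) * C $$ (j, v)) =
          (\<Sum>j\<in>{Suc k..<n}. \<Sum>l<m. Inc $$ (l, k) * (C $$ (j, v) * Inc $$ (l, j)))"
        by (intro sum.cong refl) (simp add: tri sum_distrib_left sum_distrib_right mult_ac)
      also have "\<dots> = (\<Sum>l<m. Inc $$ (l, k) * (\<Sum>j\<in>{Suc k..<n}. C $$ (j, v) * Inc $$ (l, j)))"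
        by (subst sum.swap) (simp add: sum_distrib_left)
      also have "\<dots> = (\<Sum>l<m. Inc $$ (l, k) * ((if l = v then 1 else 0) - (if l = w then 1 else 0)))"
      proof (intro sum.cong refl)
        fix l assume "l \<in> {..<m}"
        then have "x (Suc k) l = (if l = w then 1 else 0)" using step.IH by (simp add: w_def)
        then have "(\<Sum>j\<in>{Suc k..<n}. C $$ (j, v) * Inc $$ (l, j)) = (if l = v then 1 else 0) - (if l = w then 1 else 0)"
          by (simp add: x_def)
        then show "Inc $$ (l, k) * (\<Sum>j\<in>{Suc k..<n}. C $$ (j, v) * Inc $$ (l, j)) =
          Inc $$ (l, k) * ((if l = v then 1 else 0) - (if l = w then 1 else 0))" by simp
      qed
      also have "\<dots> = Inc $$ (v, k) - Inc $$ (w, k)"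
      proof -
        have "(\<Sum>l<m. Inc $$ (l, k) * ((if l = v then 1 else 0) - (if l = w then 1 else 0))) =
            (\<Sum>l<m. (if l = v then Inc $$ (l, k) else 0) - (if l = w then Inc $$ (l, k) else 0))"
          by (intro sum.cong) auto
        then show ?thesis using v w by (simp add: sum_subtractf)
      qed
      finally show ?thesis by simp
    qed
    have perm: "arrow_perm s t [k..<n] v = Transposition.transpose (s k) (t k) w"
      using k by (simp add: arrow_perm_def w_def upt_conv_Cons)
    show ?case
    proof (intro allI impI)
      fix i assume i: "i < m"
      have "x k i = x (Suc k) i - C $$ (k, v) * Inc $$ (i, k)"
        using k by (simp add: x_def sum.atLeast_Suc_lessThan)
      also have "\<dots> = (if i = w then 1 else 0) - Inc $$ (w, k) * Inc $$ (i, k)"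
        using step.IH i by (simp add: c w_def)
      also have "\<dots> = (if i = Transposition.transpose (s k) (t k) w then 1 else 0)"
        using i w k loopless[OF k] by (auto simp: Inc_def Transposition.transpose_def)
      finally show "x k i = (if i = arrow_perm s t [k..<n] v then 1 else 0)" by (simp add: perm)
    qed
  qed
  have "(1\<^sub>m m - Inc * K * transpose_mat Inc) $$ (i, v) = (1\<^sub>m m - Inc * C) $$ (i, v)"
    unfolding C_def by (subst assoc_mult_mat[of _ m n _ n _ m]) (use K in auto)
  also have "\<dots> = x 0 i"
    using i v by (simp add: x_def scalar_prod_def mult.commute)
  also have "\<dots> = (if i = arrow_perm s t [0..<n] v then 1 else 0)" using xk[of 0] i by simp
  also have "\<dots> = perm_mat m (arrow_perm s t [0..<n]) $$ (i, v)"
    using i v by (subst perm_mat_index[OF arrow_perm_permutes]) auto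
  finally show "(1\<^sub>m m - Inc * K * transpose_mat Inc) $$ (i, v) = perm_mat m (arrow_perm s t [0..<n]) $$ (i, v)" .
qed (use K in auto)

text \<open>A walk, read as a signed sum of its arrows, has the difference of its end points as
  boundary.\<close>

lemma Inc_reach:
  assumes "(u, v) \<in> (arrow_rel n s t)\<^sup>*"
  shows "\<exists>x. \<forall>i<m. (\<Sum>j<n. Inc $$ (i, j) * x j) = (if i = v then 1 else 0) - (if i = u then 1 else 0)"
  using assms
proof (induction rule: rtrancl_induct)
  case base
  show ?case by (rule exI[of _ "\<lambda>_. 0"]) simp
next
  case (step v w)
  then obtain x where x: "\<forall>i<m. (\<Sum>j<n. Inc $$ (i, j) * x j) = (if i = v then 1 else 0) - (if i = u then 1 else 0)"
    by blast
  from step.hyps(2) obtain j0 where j0: "j0 < n" and vw: "v = s j0 \<and> w = t j0 \<or> v = t j0 \<and> w = s j0"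
    by (auto simp: arrow_rel_def)
  \<comment> \<open>A column is source minus target, so running along an arrow in its direction
    counts -1.\<close>
  define \<epsilon> :: int where "\<epsilon> = (if v = s j0 then -1 else 1)"
  have *: "(\<Sum>j<n. Inc $$ (i, j) * (x j + (if j = j0 then \<epsilon> else 0))) = (if i = w then 1 else 0) - (if i = u then 1 else 0)"
    if i: "i < m" for i
  proof -
    have "(\<Sum>j<n. Inc $$ (i, j) * (x j + (if j = j0 then \<epsilon> else 0))) =
        (\<Sum>j<n. Inc $$ (i, j) * x j) + (\<Sum>j<n. if j = j0 then Inc $$ (i, j) * \<epsilon> else 0)"
      unfolding sum.distrib[symmetric] by (intro sum.cong) (auto simp: distrib_left)
    also have "\<dots> = (if i = v then 1 else 0) - (if i = u then 1 else 0) + Inc $$ (i, j0) * \<epsilon>"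
      using x i j0 by simp
    also have "\<dots> = (if i = w then 1 else 0) - (if i = u then 1 else 0)"
      using vw j0 i loopless[OF j0] by (auto simp: Inc_def \<epsilon>_def)
    finally show ?thesis .
  qed
  show ?case by (rule exI, intro allI impI, rule *)
qed

lemma coxeter_datum_Inc:
  assumes m: "0 < m" and conn: "\<And>v. v < m \<Longrightarrow> (0, v) \<in> (arrow_rel n s t)\<^sup>*"
    and K: "K \<in> carrier_mat n n" "Tri * K = 1\<^sub>m n" "K * Tri = 1\<^sub>m n"
  shows "\<exists>S. coxeter_datum m n 0 Inc Tri K S (arrow_perm s t [0..<n])"
proof -
  have "\<forall>v. \<exists>x. v < m \<longrightarrow> (\<forall>i<m. (\<Sum>j<n. Inc $$ (i, j) * x j) = (if i = v then 1 else 0) - (if i = 0 then 1 else 0))"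
    using Inc_reach[OF conn] by blast
  then obtain x where x: "\<And>v i. v < m \<Longrightarrow> i < m \<Longrightarrow>
      (\<Sum>j<n. Inc $$ (i, j) * x v j) = (if i = v then 1 else 0) - (if i = 0 then 1 else 0)"
    by metis
  define S where "S = mat n m (\<lambda>(j, v). x v j)"
  have "coxeter_datum m n 0 Inc Tri K S (arrow_perm s t [0..<n])"
  proof
    show "Inc * S = mat m m (\<lambda>(i, j). (if i = j then 1 else 0) - (if i = 0 then 1 else 0))"
      by (rule eq_matI) (auto simp: S_def scalar_prod_def x atLeast0LessThan)
    show "arrow_perm s t [0..<n] permutes {..<m}" by (rule arrow_perm_permutes) auto
    show "1\<^sub>m m - Inc * K * transpose_mat Inc = perm_mat m (arrow_perm s t [0..<n])"
      by (rule Inc_laplacian[OF K(1,2)])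
  qed (use m K Tri_sym col_sum in \<open>simp_all add: S_def\<close>)
  then show ?thesis ..
qed

end

lemma quiver_arrows:
  "quiver m n Q \<Longrightarrow> loopfree_digraph Q \<Longrightarrow> arrows m n (tail Q) (head Q)"
  unfolding quiver_def
proof
  assume Q: "verts Q = {..<m} \<and> arcs Q = {..<n} \<and> wf_digraph Q" and lf: "loopfree_digraph Q"
  fix j assume "j < n"
  then have j: "j \<in> arcs Q" using Q by simp
  show "tail Q j < m" "head Q j < m"
    using wf_digraph.tail_in_verts[OF _ j] wf_digraph.head_in_verts[OF _ j] Q by auto
  show "tail Q j \<noteq> head Q j" by (rule loopfree_digraph.no_loops[OF lf j])
qed

lemma connected_iff_arrow_rel:
  assumes Q: "quiver m n Q"
  shows "Digraph_Component.connected Q \<longleftrightarrow>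
    m \<noteq> 0 \<and> (\<forall>u<m. \<forall>v<m. (u, v) \<in> (arrow_rel n (tail Q) (head Q))\<^sup>*)"
proof -
  let ?R = "arrow_rel n (tail Q) (head Q)"
  have verts: "verts Q = {..<m}" and arcs: "arcs Q = {..<n}" and wf: "wf_digraph Q"
    using Q by (auto simp: quiver_def)
  have R: "parcs (mk_symmetric Q) = ?R"
    by (simp add: parcs_mk_symmetric arcs arrow_rel_def)
  have in_verts: "v < m" if "(u, v) \<in> ?R" for u v
    using that wf_digraph.tail_in_verts[OF wf] wf_digraph.head_in_verts[OF wf]
    by (auto simp: arrow_rel_def verts arcs)
  have "(u, v) \<in> rtrancl_on {..<m} ?R \<longleftrightarrow> (u, v) \<in> ?R\<^sup>*" if u: "u < m" for u v
  proof
    show "(u, v) \<in> rtrancl_on {..<m} ?R \<Longrightarrow> (u, v) \<in> ?R\<^sup>*" by (rule rtrancl_on_rtranclI)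
    assume "(u, v) \<in> ?R\<^sup>*"
    then show "(u, v) \<in> rtrancl_on {..<m} ?R"
      by (induction rule: rtrancl_induct)
        (use u in_verts in \<open>auto intro: rtrancl_on_into_rtrancl_on\<close>)
  qed
  then show ?thesis
    unfolding connected_def strongly_connected_def reachable_def
    by (auto simp: verts R lessThan_empty_iff)
qed

lemma (in arrows) incidence_mat_eq:
  assumes "tail Q = s" "head Q = t"
  shows "incidence_mat m n Q = Inc"
  using vert unfolding incidence_mat_def assms
  by (intro eq_matI) (auto simp: Inc_def mat_of_cols_index unit_vec_def)

lemma (in arrows) quiver_form_eq:
  assumes st: "tail Q = s" "head Q = t" and x: "x \<in> carrier_vec n"
  shows "quiver_form m n Q x = x \<bullet> (Tri *\<^sub>v x)"
    and "(Inc *\<^sub>v x) \<bullet> (Inc *\<^sub>v x) = 2 * (x \<bullet> (Tri *\<^sub>v x))"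
proof -
  have "(Inc *\<^sub>v x) \<bullet> (Inc *\<^sub>v x) = x \<bullet> ((transpose_mat Inc * Inc) *\<^sub>v x)"
    using x transpose_vec_mult_scalar[of Inc m n x "Inc *\<^sub>v x"] comm_scalar_prod[of x n "transpose_mat Inc *\<^sub>v (Inc *\<^sub>v x)"]
      mult_mat_vec_carrier[of Inc m n x] mult_mat_vec_carrier[of "transpose_mat Inc" n m "Inc *\<^sub>v x"]
    by (simp add: assoc_mult_mat_vec[of _ n m _ n])
  also have "\<dots> = x \<bullet> (Tri *\<^sub>v x) + x \<bullet> (transpose_mat Tri *\<^sub>v x)"
    unfolding Tri_sym[symmetric] using x
    using scalar_prod_add_distrib[of x n "Tri *\<^sub>v x" "transpose_mat Tri *\<^sub>v x"]
      mult_mat_vec_carrier[of "transpose_mat Tri" n n x] mult_mat_vec_carrier[of Tri n n x]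
    by (subst add_mult_distrib_mat_vec[of _ n n]) auto
  also have "x \<bullet> (transpose_mat Tri *\<^sub>v x) = x \<bullet> (Tri *\<^sub>v x)"
    using x transpose_vec_mult_scalar[of Tri n n x x] comm_scalar_prod[of x n "transpose_mat Tri *\<^sub>v x"]
      mult_mat_vec_carrier[of "transpose_mat Tri" n n x]
    by simp
  finally show 2: "(Inc *\<^sub>v x) \<bullet> (Inc *\<^sub>v x) = 2 * (x \<bullet> (Tri *\<^sub>v x))" by simp
  show "quiver_form m n Q x = x \<bullet> (Tri *\<^sub>v x)"
    using x by (simp add: quiver_form_def incidence_mat_eq[OF st] 2)
qed

lemma (in arrows) tri_gram_quiver_form:
  assumes st: "tail Q = s" "head Q = t"
  shows "tri_gram n (quiver_form m n Q) = Tri"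
    and "gram n (quiver_form m n Q) = transpose_mat Inc * Inc"
  using tri_gram_eqI[OF Tri_carrier(1) Tri_upper quiver_form_eq(1)[OF st]]
    gram_eqI[OF Tri_carrier(1) quiver_form_eq(1)[OF st]] Tri_sym by simp_all

lemma perm_mat_inj:
  assumes "\<xi> permutes {..<m}" "\<xi>' permutes {..<m}" "perm_mat m \<xi> = perm_mat m \<xi>'"
  shows "\<xi> = \<xi>'"
proof
  fix v
  show "\<xi> v = \<xi>' v"
  proof (cases "v < m")
    case True
    have "perm_mat m \<xi> $$ (\<xi> v, v) = 1"
      using True assms(1) permutes_in_image[OF assms(1), of v] by (simp add: perm_mat_index)
    then show ?thesis
      using True assms permutes_in_image[OF assms(1), of v]
      by (simp add: perm_mat_index[OF assms(2)] split: if_splits)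
  next
    case False
    then show ?thesis using assms(1,2) by (simp add: permutes_def)
  qed
qed

lemma quiver_coxeter_datum:
  assumes Q: "quiver m n Q" and lf: "loopfree_digraph Q" and conn: "Digraph_Component.connected Q"
  defines "q \<equiv> quiver_form m n Q"
  obtains K S \<xi> where "coxeter_datum m n 0 (incidence_mat m n Q) (tri_gram n q) K S \<xi>"
    "quiver_cycle_type m n Q = orbit_partition m \<xi>"
    "coxeter_mat n q = - (transpose_mat (tri_gram n q) * K)"
    "gram n q = transpose_mat (incidence_mat m n Q) * incidence_mat m n Q"
    "upper_triangular (tri_gram n q)" "det (tri_gram n q) = 1"
proof -
  interpret arrows m n "tail Q" "head Q" by (rule quiver_arrows[OF Q lf])
  note eqs = incidence_mat_eq[OF refl refl] tri_gram_quiver_form[OF refl refl]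
  obtain K where K: "K \<in> carrier_mat n n" "Tri * K = 1\<^sub>m n" "K * Tri = 1\<^sub>m n"
    by (rule unimodular_inverse[OF Tri_carrier(1) det_Tri])
  have m: "0 < m" and c: "\<And>v. v < m \<Longrightarrow> (0, v) \<in> (arrow_rel n (tail Q) (head Q))\<^sup>*"
    using conn unfolding connected_iff_arrow_rel[OF Q] by auto
  define \<xi> where "\<xi> = arrow_perm (tail Q) (head Q) [0..<n]"
  obtain S where S: "coxeter_datum m n 0 Inc Tri K S \<xi>"
    using coxeter_datum_Inc[OF m c K] unfolding \<xi>_def by blast
  interpret cd: coxeter_datum m n 0 Inc Tri K S \<xi> by (rule S)
  have inv: "int_mat_inverse n Tri = K" by (rule int_mat_inverse_eqI[OF Tri_carrier(1) K])
  have lap: "coxeter_laplacian m n Q = perm_mat m \<xi>"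
    unfolding coxeter_laplacian_def eqs inv by (rule cd.laplacian)
  have "(THE \<xi>. \<xi> permutes {..<m} \<and> coxeter_laplacian m n Q = perm_mat m \<xi>) = \<xi>"
    by (rule the_equality) (use cd.perm lap perm_mat_inj in auto)
  then have "quiver_cycle_type m n Q = orbit_partition m \<xi>"
    by (simp add: quiver_cycle_type_def)
  then show ?thesis
    using that[of K S \<xi>] S Tri_upper det_Tri unfolding q_def eqs
    by (simp add: coxeter_mat_def eqs inv)
qed

section \<open>Forms of Dynkin type A come from quivers\<close>

text \<open>Used to turn the group isomorphism in the definition of the Dynkin type, which is given
  as additive, into a matrix.\<close>

lemma additive_vec_sum:
  fixes \<phi> :: "int vec \<Rightarrow> int"
  assumes add: "\<And>x y. x \<in> carrier_vec n \<Longrightarrow> y \<in> carrier_vec n \<Longrightarrow> \<phi> (x + y) = \<phi> x + \<phi> y"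
    and x: "x \<in> carrier_vec n"
  shows "\<phi> x = (\<Sum>j<n. x $ j * \<phi> (unit_vec n j))"
proof -
  have zero: "\<phi> (0\<^sub>v n) = 0" using add[of "0\<^sub>v n" "0\<^sub>v n"] by simp
  have smult_nat: "\<phi> (int k \<cdot>\<^sub>v v) = int k * \<phi> v" if v: "v \<in> carrier_vec n" for k v
  proof (induction k)
    case 0
    have "0 \<cdot>\<^sub>v v = 0\<^sub>v n" using v by (intro eq_vecI) auto
    then show ?case by (simp add: zero)
  next
    case (Suc k)
    have "int (Suc k) \<cdot>\<^sub>v v = int k \<cdot>\<^sub>v v + v" using v by (intro eq_vecI) (auto simp: algebra_simps)
    then show ?case using v Suc by (simp add: add algebra_simps)
  qed
  have smult: "\<phi> (k \<cdot>\<^sub>v v) = k * \<phi> v" if v: "v \<in> carrier_vec n" for k v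
  proof (cases "0 \<le> k")
    case True
    then show ?thesis using smult_nat[OF v, of "nat k"] by simp
  next
    case False
    have "k \<cdot>\<^sub>v v + int (nat (- k)) \<cdot>\<^sub>v v = 0\<^sub>v n"
      using v False by (intro eq_vecI) (auto simp: algebra_simps)
    then have "\<phi> (k \<cdot>\<^sub>v v) + \<phi> (int (nat (- k)) \<cdot>\<^sub>v v) = 0"
      using v zero add[of "k \<cdot>\<^sub>v v" "int (nat (- k)) \<cdot>\<^sub>v v"] by simp
    then show ?thesis using smult_nat[OF v, of "nat (- k)"] False by simp
  qed
  define p where "p k = vec n (\<lambda>i. if i < k then x $ i else 0)" for k
  have p: "\<phi> (p k) = (\<Sum>j<k. x $ j * \<phi> (unit_vec n j))" if "k \<le> n" for k
    using that
  proof (induction k)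
    case 0
    have "p 0 = 0\<^sub>v n" unfolding p_def by (intro eq_vecI) auto
    then show ?case by (simp add: zero)
  next
    case (Suc k)
    have "p (Suc k) = p k + x $ k \<cdot>\<^sub>v unit_vec n k"
      unfolding p_def using Suc.prems by (intro eq_vecI) (auto simp: less_Suc_eq)
    moreover have "p k \<in> carrier_vec n" by (simp add: p_def)
    ultimately show ?case using Suc by (simp add: add smult)
  qed
  have "p n = x" unfolding p_def using x by (intro eq_vecI) auto
  with p[of n] show ?thesis by simp
qed

text \<open>A nonzero vector with sum 0 has a positive and a negative entry; each contributes at
  least 1 to the norm 2, so nothing else is left.\<close>

lemma root_of_norm:
  fixes v :: "nat \<Rightarrow> int"
  assumes sum: "(\<Sum>i<m. v i) = 0" and norm: "(\<Sum>i<m. (v i)\<^sup>2) = 2"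
  shows "\<exists>a b. a < m \<and> b < m \<and> a \<noteq> b \<and>
    (\<forall>i<m. v i = (if i = a then 1 else 0) - (if i = b then 1 else 0))"
proof -
  have "\<exists>a<m. v a > 0"
  proof (rule ccontr)
    assume no: "\<not> ?thesis"
    then have le: "v i \<le> 0" if "i < m" for i using that by (meson not_le)
    have "(\<Sum>i<m. - v i) = 0 \<longleftrightarrow> (\<forall>i\<in>{..<m}. - v i = 0)"
      by (intro sum_nonneg_eq_0_iff) (simp_all add: le)
    then have "\<forall>i<m. v i = 0" using sum by (simp add: sum_negf)
    then show False using norm by simp
  qed
  then obtain a where a: "a < m" "v a > 0" by blast
  have "\<exists>b<m. v b < 0"
  proof (rule ccontr)
    assume no: "\<not> ?thesis"
    then have le: "0 \<le> v i" if "i < m" for i using that by (meson not_le)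
    have "(\<Sum>i<m. v i) = 0 \<longleftrightarrow> (\<forall>i\<in>{..<m}. v i = 0)"
      by (intro sum_nonneg_eq_0_iff) (simp_all add: le)
    then show False using sum a by auto
  qed
  then obtain b where b: "b < m" "v b < 0" by blast
  have ab: "a \<noteq> b" using a b by auto
  have "(\<Sum>i<m. (v i)\<^sup>2) = (v a)\<^sup>2 + ((v b)\<^sup>2 + (\<Sum>i\<in>{..<m} - {a} - {b}. (v i)\<^sup>2))"
    using a b ab by (subst sum.remove[of _ a], simp, simp, subst sum.remove[of _ b]) auto
  moreover have "(v a)\<^sup>2 \<ge> 1" "(v b)\<^sup>2 \<ge> 1" using a b
    by (simp_all add: int_one_le_iff_zero_less)
  moreover have "(\<Sum>i\<in>{..<m} - {a} - {b}. (v i)\<^sup>2) \<ge> 0" by (intro sum_nonneg) auto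
  ultimately have sq: "(v a)\<^sup>2 = 1" "(v b)\<^sup>2 = 1" and rest: "(\<Sum>i\<in>{..<m} - {a} - {b}. (v i)\<^sup>2) = 0"
    using norm by linarith+
  have "v a = 1" "v b = -1" using sq a b by (auto simp: power2_eq_1_iff)
  moreover have "v i = 0" if "i < m" "i \<noteq> a" "i \<noteq> b" for i
  proof -
    have "\<forall>i\<in>{..<m} - {a} - {b}. (v i)\<^sup>2 = 0" using rest by (subst (asm) sum_nonneg_eq_0_iff) auto
    then show ?thesis using that by auto
  qed
  ultimately show ?thesis using a b ab by (intro exI[of _ a] exI[of _ b]) auto
qed

text \<open>
  \<open>path_coord r z\<close> are the coordinates of \<open>\<Sum> z\<^sub>i (e\<^sub>i - e\<^bsub>i+1\<^esub>)\<close>: this is the usual embedding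
  of the root lattice of type A.
\<close>

definition path_coord :: "nat \<Rightarrow> (nat \<Rightarrow> int) \<Rightarrow> nat \<Rightarrow> int" where
  "path_coord r z i = (if i < r then z i else 0) - (if 0 < i then z (i - 1) else 0)"

lemma sum_path_coord: "(\<Sum>i<Suc r. path_coord r z i) = 0"
proof -
  have "(\<Sum>i<Suc r. if 0 < i then z (i - 1) else 0) = (\<Sum>i<r. z i)"
    unfolding sum.lessThan_Suc_shift by simp
  then show ?thesis by (simp add: path_coord_def sum_subtractf)
qed

text \<open>Each coefficient occurs in two coordinates with opposite signs, and the cross terms of
  the squares are the edges of the diagram.\<close>

lemma sum_path_coord_square:
  assumes z: "x \<in> carrier_vec r"
  shows "(\<Sum>i<Suc r. (path_coord r (\<lambda>i. x $ i) i)\<^sup>2) = 2 * graph_form r dynkin_A x"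
proof -
  define a where "a i = (if i < r then x $ i else 0)" for i
  define b where "b i = (if 0 < i then x $ (i - 1) else 0)" for i
  have "(\<Sum>i<Suc r. (path_coord r (\<lambda>i. x $ i) i)\<^sup>2) = (\<Sum>i<Suc r. (a i)\<^sup>2) + (\<Sum>i<Suc r. (b i)\<^sup>2) - 2 * (\<Sum>i<Suc r. a i * b i)"
    unfolding path_coord_def a_def[symmetric] b_def[symmetric]
    by (simp add: power2_diff sum.distrib sum_subtractf sum_distrib_left mult.assoc)
  also have "(\<Sum>i<Suc r. (a i)\<^sup>2) = (\<Sum>i<r. (x $ i)\<^sup>2)" by (simp add: a_def)
  also have "(\<Sum>i<Suc r. (b i)\<^sup>2) = (\<Sum>i<r. (x $ i)\<^sup>2)"
    unfolding sum.lessThan_Suc_shift by (simp add: b_def)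
  also have "(\<Sum>i<Suc r. a i * b i) = (\<Sum>i<r. a (Suc i) * x $ i)"
    unfolding sum.lessThan_Suc_shift by (simp add: b_def)
  also have "\<dots> = (\<Sum>i\<in>{i. Suc i < r}. x $ i * x $ Suc i)"
    by (rule sum.mono_neutral_cong_right) (auto simp: a_def)
  also have "\<dots> = (\<Sum>(i, j)\<in>{(i, j). i < j \<and> j < r \<and> dynkin_A i j}. x $ i * x $ j)"
    by (rule sum.reindex_bij_witness[of _ fst "\<lambda>i. (i, Suc i)"]) (auto simp: dynkin_A_def)
  finally show ?thesis using z by (simp add: graph_form_def)
qed

lemma subgroup_rad:
  assumes "G = A + transpose_mat A" "A \<in> carrier_mat n n" "gram n q = G"
  shows "rad n q \<lhd> monoid_vec TYPE(int) n"
proof -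
  interpret V: comm_group "monoid_vec TYPE(int) n" by (rule comm_group_vec)
  have G: "G \<in> carrier_mat n n" using assms by auto
  have "subgroup (rad n q) (monoid_vec TYPE(int) n)"
  proof (rule V.subgroupI)
    show "rad n q \<subseteq> carrier (monoid_vec TYPE(int) n)" by (auto simp: rad_def monoid_vec_simps)
    have "0\<^sub>v n \<in> rad n q" using G by (auto simp: rad_def assms(3))
    then show "rad n q \<noteq> {}" by blast
    fix x assume x: "x \<in> rad n q"
    then have xc: "x \<in> carrier_vec n" by (simp add: rad_def)
    have "m_inv (monoid_vec TYPE(int) n) x = - x"
      by (rule V.inv_equality) (use xc in \<open>auto simp: monoid_vec_simps\<close>)
    moreover have "G *\<^sub>v (- x) = - (G *\<^sub>v x)"
      using G xc by (intro eq_vecI) auto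
    ultimately show "m_inv (monoid_vec TYPE(int) n) x \<in> rad n q"
      using x xc by (simp add: rad_def assms(3))
    fix y assume y: "y \<in> rad n q"
    then show "x \<otimes>\<^bsub>monoid_vec TYPE(int) n\<^esub> y \<in> rad n q"
      using x G by (simp add: rad_def assms(3) monoid_vec_simps mult_add_distrib_mat_vec[of _ n n])
  qed
  then show ?thesis by (rule V.subgroup_imp_normal)
qed

text \<open>The quotient by the radical followed by the embedding of the root lattice is an additive
  map \<open>l\<close> with squared norm \<open>2 q\<close>. As \<open>q\<close> is a unit form,
  each basis vector goes to a vector of norm 2, that is, to a root, and this root is an
  arrow.\<close>

lemma Quad_A_quiver:
  assumes q: "q \<in> Quad_A c n" and m: "m = n - c + 1"
  shows "\<exists>Q. quiver m n Q \<and> loopfree_digraph Q \<and> Digraph_Component.connected Q \<and> q = quiver_form m n Q"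
proof -
  define r where "r = n - c"
  have mr: "m = Suc r" using m by (simp add: r_def)
  let ?V = "monoid_vec TYPE(int) n"
  obtain A where A: "A \<in> carrier_mat n n" "\<And>x. x \<in> carrier_vec n \<Longrightarrow> q x = x \<bullet> (A *\<^sub>v x)"
    and ext: "q \<in> extensional (carrier_vec n)" and unit: "\<And>i. i < n \<Longrightarrow> q (unit_vec n i) = 1"
    using q by (auto simp: Quad_A_def unit_form_def integral_quadratic_form_def)
  have gram: "gram n q = A + transpose_mat A" by (rule gram_eqI[OF A])
  interpret N: normal "rad n q" ?V by (rule subgroup_rad[OF refl A(1) gram])
  obtain h where h: "h \<in> iso (?V Mod rad n q) (monoid_vec TYPE(int) r)"
    and hq: "\<And>x. x \<in> carrier_vec n \<Longrightarrow> graph_form r dynkin_A (h (rad n q #>\<^bsub>?V\<^esub> x)) = q x"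
    using q by (auto simp: Quad_A_def has_dynkin_type_def r_def)
  define f where "f x = h (rad n q #>\<^bsub>?V\<^esub> x)" for x
  have cos: "rad n q #>\<^bsub>?V\<^esub> x \<in> carrier (?V Mod rad n q)" if "x \<in> carrier_vec n" for x
    using that by (auto simp: FactGroup_def RCOSETS_def monoid_vec_simps)
  have hom: "h \<in> hom (?V Mod rad n q) (monoid_vec TYPE(int) r)"
    and bij: "bij_betw h (carrier (?V Mod rad n q)) (carrier_vec r)"
    using h by (auto simp: iso_def monoid_vec_simps)
  have fc: "f x \<in> carrier_vec r" if "x \<in> carrier_vec n" for x
    using hom_in_carrier[OF hom cos[OF that]] by (simp add: f_def monoid_vec_simps)
  have fadd: "f (x + y) = f x + f y" if "x \<in> carrier_vec n" "y \<in> carrier_vec n" for x y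
    using hom_mult[OF hom cos[OF that(1)] cos[OF that(2)]] N.rcos_sum[of x y] that
    by (simp add: f_def FactGroup_def monoid_vec_simps)
  have fsurj: "\<exists>x\<in>carrier_vec n. f x = y" if "y \<in> carrier_vec r" for y
  proof -
    from bij that obtain C where C: "C \<in> carrier (?V Mod rad n q)" "h C = y"
      unfolding bij_betw_def by (metis imageE)
    then show ?thesis by (auto simp: FactGroup_def RCOSETS_def monoid_vec_simps f_def)
  qed
  define l where "l x i = path_coord r (\<lambda>k. f x $ k) i" for x i
  have ladd: "l (x + y) i = l x i + l y i" if "x \<in> carrier_vec n" "y \<in> carrier_vec n" "i < m" for x y i
    using that fc[OF that(1)] fc[OF that(2)] mr
    by (auto simp: l_def fadd path_coord_def)
  have lsum: "(\<Sum>i<m. l x i) = 0" for x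
    unfolding l_def mr by (rule sum_path_coord)
  have lq: "(\<Sum>i<m. (l x i)\<^sup>2) = 2 * q x" if "x \<in> carrier_vec n" for x
    unfolding l_def mr using sum_path_coord_square[OF fc[OF that]] hq[OF that] by (simp add: f_def)
  have "\<forall>j. \<exists>a b. j < n \<longrightarrow> a < m \<and> b < m \<and> a \<noteq> b \<and>
      (\<forall>i<m. l (unit_vec n j) i = (if i = a then 1 else 0) - (if i = b then 1 else 0))"
  proof (intro allI)
    fix j
    show "\<exists>a b. j < n \<longrightarrow> a < m \<and> b < m \<and> a \<noteq> b \<and>
      (\<forall>i<m. l (unit_vec n j) i = (if i = a then 1 else 0) - (if i = b then 1 else 0))"
      using root_of_norm[OF lsum[of "unit_vec n j"]] lq[of "unit_vec n j"] unit[of j] by (cases "j < n") auto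
  qed
  then obtain s t where st: "\<And>j. j < n \<Longrightarrow> s j < m" "\<And>j. j < n \<Longrightarrow> t j < m" "\<And>j. j < n \<Longrightarrow> s j \<noteq> t j"
    and lunit: "\<And>i j. j < n \<Longrightarrow> i < m \<Longrightarrow> l (unit_vec n j) i = (if i = s j then 1 else 0) - (if i = t j then 1 else 0)"
    by metis
  interpret ar: arrows m n s t using st by unfold_locales auto
  define Q :: "(nat, nat) pre_digraph" where "Q = \<lparr>verts = {..<m}, arcs = {..<n}, tail = s, head = t\<rparr>"
  have Q: "quiver m n Q" using st by (auto simp: quiver_def Q_def wf_digraph_def)
  have lf: "loopfree_digraph Q"
    using Q st by (auto simp: loopfree_digraph_def loopfree_digraph_axioms_def quiver_def Q_def)
  have l: "l x i = (\<Sum>j<n. x $ j * l (unit_vec n j) i)" if "x \<in> carrier_vec n" "i < m" for x i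
    by (rule additive_vec_sum[of n "\<lambda>x. l x i", OF _ that(1)]) (use ladd that in auto)
  have Inc: "ar.Inc *\<^sub>v x = vec m (l x)" if "x \<in> carrier_vec n" for x
  proof (rule eq_vecI)
    fix i assume "i < dim_vec (vec m (l x))"
    then have i: "i < m" by simp
    have "l x i = (\<Sum>j<n. x $ j * l (unit_vec n j) i)" by (rule l[OF that i])
    also have "\<dots> = (\<Sum>j<n. ar.Inc $$ (i, j) * x $ j)"
      using i by (intro sum.cong refl) (simp add: lunit ar.Inc_def)
    finally show "(ar.Inc *\<^sub>v x) $ i = vec m (l x) $ i"
      using that i by (simp add: scalar_prod_def atLeast0LessThan)
  qed simp
  have "q x = quiver_form m n Q x" if x: "x \<in> carrier_vec n" for x
  proof -
    have "(ar.Inc *\<^sub>v x) \<bullet> (ar.Inc *\<^sub>v x) = 2 * q x"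
      unfolding Inc[OF x] using lq[OF x] by (simp add: scalar_prod_def atLeast0LessThan power2_eq_square)
    moreover have "incidence_mat m n Q = ar.Inc" by (rule ar.incidence_mat_eq) (simp_all add: Q_def)
    ultimately show ?thesis using x by (simp add: quiver_form_def)
  qed
  then have "q = quiver_form m n Q"
    using ext by (intro extensionalityI[of _ "carrier_vec n"]) (auto simp: quiver_form_def)
  moreover have "Digraph_Component.connected Q"
    unfolding connected_iff_arrow_rel[OF Q]
  proof (intro conjI allI impI)
    show "m \<noteq> 0" by (simp add: mr)
    fix u v assume u: "u < m" and v: "v < m"
    \<comment> \<open>If \<open>v\<close> were outside the component \<open>C\<close> of
      \<open>u\<close>, the sum of the coordinates over \<open>C\<close> would vanish on all arrows,
      hence on the whole image of \<open>l\<close>. But this image is the full root lattice and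
      contains \<open>e_u - e_v\<close>.\<close>
    define C where "C = {w. (u, w) \<in> (arrow_rel n s t)\<^sup>*}"
    define \<chi> where "\<chi> x = (\<Sum>i\<in>{..<m} \<inter> C. l x i)" for x
    have \<chi>unit: "\<chi> (unit_vec n j) = 0" if j: "j < n" for j
    proof -
      have "(s j, t j) \<in> arrow_rel n s t" "(t j, s j) \<in> arrow_rel n s t"
        using j by (auto simp: arrow_rel_def)
      then have C: "s j \<in> C \<longleftrightarrow> t j \<in> C" unfolding C_def by (auto intro: rtrancl_into_rtrancl)
      have "\<chi> (unit_vec n j) = (\<Sum>i\<in>{..<m} \<inter> C. (if i = s j then 1 else 0) - (if i = t j then 1 else 0))"
        unfolding \<chi>_def using j by (intro sum.cong) (auto simp: lunit)
      also have "\<dots> = 0" using C st[OF j] by (simp add: sum_subtractf)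
      finally show ?thesis .
    qed
    have \<chi>: "\<chi> x = (\<Sum>j<n. x $ j * \<chi> (unit_vec n j))" if "x \<in> carrier_vec n" for x
      by (rule additive_vec_sum[OF _ that]) (auto simp: \<chi>_def ladd sum.distrib)
    have \<chi>0: "\<chi> x = 0" if "x \<in> carrier_vec n" for x
      unfolding \<chi>[OF that] by (simp add: \<chi>unit)
    \<comment> \<open>These are the coefficients of \<open>e_u - e_v\<close> in the simple roots: a
      signed indicator of the path between \<open>u\<close> and \<open>v\<close>.\<close>
    obtain x where x: "x \<in> carrier_vec n" "f x = vec r (\<lambda>i. (if u \<le> i then 1 else 0) - (if v \<le> i then 1 else 0))"
      using fsurj[of "vec r (\<lambda>i. (if u \<le> i then 1 else 0) - (if v \<le> i then 1 else 0))"] by auto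
    have "l x i = (if i = u then 1 else 0) - (if i = v then 1 else 0)" if "i < m" for i
      using that u v unfolding l_def path_coord_def x(2) mr by auto
    then have "\<chi> x = (\<Sum>i\<in>{..<m} \<inter> C. (if i = u then 1 else 0) - (if i = v then 1 else 0))"
      unfolding \<chi>_def by (intro sum.cong) auto
    also have "\<dots> = (if u \<in> C then 1 else 0) - (if v \<in> C then 1 else 0)"
      using u v by (simp add: sum_subtractf)
    finally have "v \<in> C" using \<chi>0[OF x(1)] by (auto simp: C_def split: if_splits)
    then show "(u, v) \<in> (arrow_rel n (tail Q) (head Q))\<^sup>*" by (simp add: C_def Q_def)
  qed
  ultimately show ?thesis using Q lf by blast
qed

section \<open>Orbit partitions of permutations\<close>

lemma permutes_permutation: "\<xi> permutes {..<m::nat} \<Longrightarrow> permutation \<xi>"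
  by (auto simp: permutation_permutes)

lemma orbit_funpow: "y \<in> orbit f x \<Longrightarrow> \<exists>k. (f ^^ k) x = y"
  by (auto simp: orbit_altdef)

lemma orbit_same: "permutation \<xi> \<Longrightarrow> y \<in> orbit \<xi> x \<Longrightarrow> orbit \<xi> y = orbit \<xi> x"
  by (rule orbit_cyclic_eq3[OF cyclic_on_orbit'])

lemma funpow_eq_iff_mod_card_orbit:
  assumes p: "permutation \<xi>"
  shows "(\<xi> ^^ i) x = (\<xi> ^^ j) x \<longleftrightarrow> i mod card (orbit \<xi> x) = j mod card (orbit \<xi> x)"
proof -
  have self: "x \<in> orbit \<xi> x" by (rule permutation_self_in_orbit[OF p])
  define c where "c = funpow_dist1 \<xi> x x"
  have inj: "inj_on (\<lambda>n. (\<xi> ^^ n) x) {0..<c}"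
    unfolding c_def by (rule inj_on_funpow_dist1[OF self])
  have orb: "orbit \<xi> x = (\<lambda>n. (\<xi> ^^ n) x) ` {0..<c}"
    unfolding c_def by (rule orbit_conv_funpow_dist1[OF self])
  have card: "card (orbit \<xi> x) = c" unfolding orb using card_image[OF inj] by simp
  have period: "(\<xi> ^^ c) x = x"
    unfolding c_def using self by (rule funpow_dist1_prop)
  have "c > 0" by (simp add: c_def)
  then have "(\<xi> ^^ (i mod c)) x = (\<xi> ^^ (j mod c)) x \<longleftrightarrow> i mod c = j mod c"
    using inj_on_eq_iff[OF inj, of "i mod c" "j mod c"] by simp
  then show ?thesis unfolding card using funpow_mod_eq[OF period] by simp
qed

lemma orbit_permutes_subset: "\<xi> permutes {..<m} \<Longrightarrow> x < m \<Longrightarrow> orbit \<xi> x \<subseteq> {..<m}"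
  using permutes_orbit_subset[of \<xi> "{..<m}" x] by simp

lemma card_orbit_pos:
  assumes "\<xi> permutes {..<m::nat}" shows "card (orbit \<xi> x) > 0"
  using permutation_self_in_orbit[OF permutes_permutation[OF assms], of x]
    finite_orbit by (fastforce simp: card_gt_0_iff)

lemma mset_orbit_partition:
  "mset (orbit_partition m \<xi>) = image_mset card (mset_set (orbit \<xi> ` {..<m}))"
  by (simp add: orbit_partition_def)

lemma set_orbit_partition: "set (orbit_partition m \<xi>) = card ` orbit \<xi> ` {..<m}"
  using arg_cong[OF mset_orbit_partition[of m \<xi>], of set_mset] by simp

lemma length_orbit_partition: "length (orbit_partition m \<xi>) = card (orbit \<xi> ` {..<m})"
  using arg_cong[OF mset_orbit_partition[of m \<xi>], of size] by simp

lemma orbit_partition_Part: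
  assumes \<xi>: "\<xi> permutes {..<m}"
  shows "orbit_partition m \<xi> \<in> Part m"
  unfolding Part_def
proof (intro CollectI conjI)
  note p = permutes_permutation[OF \<xi>]
  show "sorted_wrt (\<ge>) (orbit_partition m \<xi>)"
    by (simp add: orbit_partition_def sorted_wrt_rev)
  show "\<forall>k\<in>set (orbit_partition m \<xi>). 0 < k"
    unfolding set_orbit_partition using card_orbit_pos[OF \<xi>] by auto
  have "sum_list (orbit_partition m \<xi>) = sum card (orbit \<xi> ` {..<m})"
    by (simp add: mset_orbit_partition sum_unfold_sum_mset flip: sum_mset_sum_list)
  also have "\<dots> = card (\<Union>(orbit \<xi> ` {..<m}))"
  proof (rule card_Union_disjoint[symmetric])
    show "pairwise disjnt (orbit \<xi> ` {..<m})"
      unfolding pairwise_def disjnt_def using orbit_same[OF p] by blast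
    show "finite A" if "A \<in> orbit \<xi> ` {..<m}" for A
      using that orbit_permutes_subset[OF \<xi>] by (auto intro: finite_subset)
  qed
  also have "\<Union>(orbit \<xi> ` {..<m}) = {..<m}"
    using orbit_permutes_subset[OF \<xi>] permutation_self_in_orbit[OF p] by blast
  finally show "sum_list (orbit_partition m \<xi>) = m" by simp
qed

lemma funpow_eq_id_iff:
  assumes \<xi>: "\<xi> permutes {..<m}"
  shows "(\<forall>v<m. (\<xi> ^^ t) v = v) \<longleftrightarrow> Lcm (set (orbit_partition m \<xi>)) dvd t"
proof -
  have "(\<xi> ^^ t) v = v \<longleftrightarrow> card (orbit \<xi> v) dvd t" for v
    using funpow_eq_iff_mod_card_orbit[OF permutes_permutation[OF \<xi>], of t v 0] by (simp add: dvd_eq_mod_eq_0)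
  then show ?thesis
    by (auto simp: Lcm_dvd_iff set_orbit_partition)
qed

lemma image_mset_eq_bij_betw:
  assumes "finite A" "finite B" "image_mset f (mset_set A) = image_mset g (mset_set B)"
  shows "\<exists>b. bij_betw b A B \<and> (\<forall>x\<in>A. g (b x) = f x)"
  using assms
proof (induction A arbitrary: B rule: finite_induct)
  case empty
  then have "B = {}" by (auto simp: mset_set_empty_iff)
  then show ?case by (auto simp: bij_betw_def)
next
  case (insert a A)
  have "f a \<in># image_mset g (mset_set B)"
    using insert by (simp flip: insert.prems(2))
  then obtain b0 where b0: "b0 \<in> B" "g b0 = f a" using insert.prems(1) by auto
  have "mset_set B = add_mset b0 (mset_set (B - {b0}))"
    using b0 insert.prems(1) by (metis mset_set.remove)
  then have "image_mset f (mset_set A) = image_mset g (mset_set (B - {b0}))"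
    using insert b0 by simp
  with insert obtain b where b: "bij_betw b A (B - {b0})" "\<forall>x\<in>A. g (b x) = f x" by blast
  have "bij_betw (b(a := b0)) A (B - {b0})"
    using b(1) insert.hyps(2) by (subst bij_betw_cong[of _ _ b]) auto
  then have "bij_betw (b(a := b0)) (insert a A) (insert b0 (B - {b0}))"
    using notIn_Un_bij_betw[of a A "b(a := b0)" "B - {b0}"] insert.hyps(2) by simp
  moreover have "insert b0 (B - {b0}) = B" using b0 by auto
  ultimately have bb: "bij_betw (b(a := b0)) (insert a A) B" by (simp only:)
  show ?case
    by (rule exI[of _ "b(a := b0)"], rule conjI[OF bb]) (use b b0 insert.hyps(2) in auto)
qed

text \<open>Orbits of equal size are matched and a base point is chosen in each; \<sigma> carries
  the k-th iterate of a base point to the k-th iterate of its partner, which is well defined because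
  both orbits have the same length.\<close>

lemma conjugate_of_orbit_partition:
  assumes \<xi>: "\<xi> permutes {..<m}" and \<eta>: "\<eta> permutes {..<m}"
    and eq: "orbit_partition m \<xi> = orbit_partition m \<eta>"
  obtains \<sigma> where "\<sigma> permutes {..<m}" "\<And>v. \<sigma> (\<xi> v) = \<eta> (\<sigma> v)"
proof -
  note p = permutes_permutation[OF \<xi>] and p' = permutes_permutation[OF \<eta>]
  have "image_mset card (mset_set (orbit \<xi> ` {..<m})) = image_mset card (mset_set (orbit \<eta> ` {..<m}))"
    using eq by (simp flip: mset_orbit_partition)
  then obtain b where b: "bij_betw b (orbit \<xi> ` {..<m}) (orbit \<eta> ` {..<m})"
    and bc: "\<And>x. x < m \<Longrightarrow> card (b (orbit \<xi> x)) = card (orbit \<xi> x)"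
    using image_mset_eq_bij_betw[of "orbit \<xi> ` {..<m}" "orbit \<eta> ` {..<m}" card card] by auto
  define rep :: "nat set \<Rightarrow> nat" where "rep A = (SOME x. x \<in> A)" for A
  have bo: "b (orbit \<xi> x) \<in> orbit \<eta> ` {..<m}" if "x < m" for x
    using b that by (auto simp: bij_betw_def)
  have rep: "rep (orbit \<xi> x) \<in> orbit \<xi> x" for x
    unfolding rep_def using permutation_self_in_orbit[OF p, of x] by (rule someI)
  have rep': "rep (b (orbit \<xi> x)) \<in> b (orbit \<xi> x)" if "x < m" for x
  proof -
    from bo[OF that] obtain y where "b (orbit \<xi> x) = orbit \<eta> y" by auto
    then show ?thesis
      using someI[of "\<lambda>z. z \<in> orbit \<eta> y" y] permutation_self_in_orbit[OF p', of y] by (simp add: rep_def)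
  qed
  have orep: "orbit \<xi> (rep (orbit \<xi> x)) = orbit \<xi> x" for x by (rule orbit_same[OF p rep])
  have orep': "orbit \<eta> (rep (b (orbit \<xi> x))) = b (orbit \<xi> x)" if "x < m" for x
  proof -
    from bo[OF that] obtain y where y: "b (orbit \<xi> x) = orbit \<eta> y" by auto
    show ?thesis using orbit_same[OF p', of "rep (b (orbit \<xi> x))" y] rep'[OF that] y by simp
  qed
  have "\<exists>k. (\<xi> ^^ k) (rep (orbit \<xi> x)) = x" for x
  proof -
    have "x \<in> orbit \<xi> (rep (orbit \<xi> x))" unfolding orep by (rule permutation_self_in_orbit[OF p])
    then show ?thesis by (rule orbit_funpow)
  qed
  then obtain k where k: "\<And>x. (\<xi> ^^ k x) (rep (orbit \<xi> x)) = x" by metis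
  define \<sigma> where "\<sigma> x = (if x < m then (\<eta> ^^ k x) (rep (b (orbit \<xi> x))) else x)" for x
  have \<xi>m: "\<xi> x < m \<longleftrightarrow> x < m" for x using permutes_in_image[OF \<xi>, of x] by simp
  have iff: "(\<eta> ^^ i) (rep (b (orbit \<xi> x))) = (\<eta> ^^ j) (rep (b (orbit \<xi> x))) \<longleftrightarrow>
      (\<xi> ^^ i) (rep (orbit \<xi> x)) = (\<xi> ^^ j) (rep (orbit \<xi> x))" if "x < m" for x i j
    unfolding funpow_eq_iff_mod_card_orbit[OF p] funpow_eq_iff_mod_card_orbit[OF p'] orep orep'[OF that] bc[OF that] ..
  have \<sigma>orb: "orbit \<eta> (\<sigma> x) = b (orbit \<xi> x)" if "x < m" for x
  proof -
    have "(\<eta> ^^ k x) (rep (b (orbit \<xi> x))) \<in> orbit \<eta> (rep (b (orbit \<xi> x)))"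
      using permutation_self_in_orbit[OF p'] by (rule funpow_in_orbit)
    then show ?thesis
      using that orbit_same[OF p', of "\<sigma> x" "rep (b (orbit \<xi> x))"] orep'[OF that] by (simp add: \<sigma>_def)
  qed
  have comm: "\<sigma> (\<xi> x) = \<eta> (\<sigma> x)" for x
  proof (cases "x < m")
    case True
    have o: "orbit \<xi> (\<xi> x) = orbit \<xi> x" by (rule permutation_orbit_step[OF p])
    have "(\<xi> ^^ k (\<xi> x)) (rep (orbit \<xi> x)) = \<xi> x" using k[of "\<xi> x"] unfolding o .
    also have "\<dots> = (\<xi> ^^ Suc (k x)) (rep (orbit \<xi> x))" using k[of x] by simp
    finally have "(\<eta> ^^ k (\<xi> x)) (rep (b (orbit \<xi> x))) = (\<eta> ^^ Suc (k x)) (rep (b (orbit \<xi> x)))"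
      unfolding iff[OF True] .
    then show ?thesis using True by (simp add: \<sigma>_def \<xi>m o)
  next
    case False
    then show ?thesis using \<xi> \<eta> by (simp add: \<sigma>_def permutes_def)
  qed
  have "\<sigma> permutes {..<m}"
  proof (rule bij_imp_permutes)
    have "inj_on \<sigma> {..<m}"
    proof (rule inj_onI)
      fix x y assume "x \<in> {..<m}" "y \<in> {..<m}" and e: "\<sigma> x = \<sigma> y"
      then have x: "x < m" and y: "y < m" by auto
      have "b (orbit \<xi> x) = b (orbit \<xi> y)" using \<sigma>orb[OF x] \<sigma>orb[OF y] e by simp
      then have o: "orbit \<xi> x = orbit \<xi> y"
        using b x y by (auto simp: bij_betw_def dest: inj_onD)
      have "(\<xi> ^^ k x) (rep (orbit \<xi> x)) = (\<xi> ^^ k y) (rep (orbit \<xi> x))"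
        using e x y unfolding iff[OF x, symmetric] by (simp add: \<sigma>_def o)
      also have "\<dots> = y" unfolding o by (rule k)
      finally show "x = y" unfolding k .
    qed
    moreover have "\<sigma> ` {..<m} \<subseteq> {..<m}"
    proof (rule image_subsetI)
      fix x assume "x \<in> {..<m}"
      then have x: "x < m" by simp
      from bo[OF x] obtain y where y: "y < m" "b (orbit \<xi> x) = orbit \<eta> y" by auto
      have "\<sigma> x \<in> orbit \<eta> (\<sigma> x)" by (rule permutation_self_in_orbit[OF p'])
      then show "\<sigma> x \<in> {..<m}" using \<sigma>orb[OF x] y orbit_permutes_subset[OF \<eta> y(1)] by auto
    qed
    ultimately show "bij_betw \<sigma> {..<m} {..<m}"
      using endo_inj_surj[of "{..<m}" \<sigma>] by (simp add: bij_betw_def)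
  qed (simp add: \<sigma>_def)
  then show ?thesis using comm by (rule that)
qed

text \<open>The standard permutation of cycle type \<pi>: consecutive intervals with the parts of
  \<pi> as lengths, each rotated by one step.\<close>

fun block_cycle :: "nat list \<Rightarrow> nat \<Rightarrow> nat" where
  "block_cycle [] v = v"
| "block_cycle (k # \<pi>) v = (if v < k then (if Suc v < k then Suc v else 0) else k + block_cycle \<pi> (v - k))"

lemma block_cycle_less: "v < sum_list \<pi> \<Longrightarrow> block_cycle \<pi> v < sum_list \<pi>"
  by (induction \<pi> arbitrary: v) auto

lemma block_cycle_outside: "sum_list \<pi> \<le> v \<Longrightarrow> block_cycle \<pi> v = v"
  by (induction \<pi> arbitrary: v) auto

lemma block_cycle_inj: "block_cycle \<pi> v = block_cycle \<pi> w \<Longrightarrow> v = w"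
proof (induction \<pi> arbitrary: v w)
  case (Cons k \<pi>)
  show ?case
    using Cons.prems Cons.IH[of "v - k" "w - k"]
    by (auto split: if_splits)
qed simp

lemma block_cycle_permutes: "block_cycle \<pi> permutes {..<sum_list \<pi>}"
proof (rule bij_imp_permutes)
  have "inj_on (block_cycle \<pi>) {..<sum_list \<pi>}" by (auto intro: inj_onI dest: block_cycle_inj)
  moreover have "block_cycle \<pi> ` {..<sum_list \<pi>} \<subseteq> {..<sum_list \<pi>}"
    using block_cycle_less by auto
  ultimately show "bij_betw (block_cycle \<pi>) {..<sum_list \<pi>} {..<sum_list \<pi>}"
    using endo_inj_surj[of "{..<sum_list \<pi>}" "block_cycle \<pi>"] by (simp add: bij_betw_def)
qed (simp add: block_cycle_outside)

lemma orbit_block_cycle_low: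
  assumes "v < k"
  shows "orbit (block_cycle (k # \<pi>)) v = {..<k}"
proof -
  let ?f = "block_cycle (k # \<pi>)"
  have p: "permutation ?f" using permutes_permutation[OF block_cycle_permutes] .
  have pow: "(?f ^^ j) 0 = j mod k" for j
  proof (induction j)
    case (Suc j)
    have "j mod k < k" using assms by simp
    with Suc show ?case by (auto simp: mod_Suc)
  qed simp
  have "orbit ?f 0 = {j mod k | j. 0 < j}" unfolding orbit_altdef pow ..
  also have "\<dots> = {..<k}"
  proof (intro equalityI subsetI)
    fix i assume i: "i \<in> {..<k}"
    then show "i \<in> {j mod k | j. 0 < j}" by (intro CollectI exI[of _ "i + k"]) auto
  qed (use assms in auto)
  finally have "orbit ?f 0 = {..<k}" .
  then show ?thesis using orbit_same[OF p, of v 0] assms by simp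
qed

lemma orbit_block_cycle_high:
  "orbit (block_cycle (k # \<pi>)) (k + v) = (+) k ` orbit (block_cycle \<pi>) v"
proof -
  have "(block_cycle (k # \<pi>) ^^ j) (k + v) = k + (block_cycle \<pi> ^^ j) v" for j
    by (induction j) auto
  then show ?thesis unfolding orbit_altdef by auto
qed

lemma orbits_block_cycle:
  assumes "\<forall>k\<in>set \<pi>. 0 < k"
  shows "image_mset card (mset_set (orbit (block_cycle \<pi>) ` {..<sum_list \<pi>})) = mset \<pi>"
  using assms
proof (induction \<pi>)
  case (Cons k \<pi>)
  let ?O = "orbit (block_cycle \<pi>) ` {..<sum_list \<pi>}"
  have split: "{..<sum_list (k # \<pi>)} = {..<k} \<union> (+) k ` {..<sum_list \<pi>}"
    by (auto simp: image_iff) (metis add_diff_inverse_nat lessThan_iff less_diff_conv2 nat_add_left_cancel_less not_le_imp_less le_add_diff_inverse)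
  have "orbit (block_cycle (k # \<pi>)) ` {..<sum_list (k # \<pi>)} = insert {..<k} ((`) ((+) k) ` ?O)"
    unfolding split image_Un image_image orbit_block_cycle_high
    using Cons.prems by (auto simp: orbit_block_cycle_low simp del: block_cycle.simps)
  moreover have "{..<k} \<notin> (`) ((+) k) ` ?O"
  proof
    assume "{..<k} \<in> (`) ((+) k) ` ?O"
    then obtain A where "{..<k} = (+) k ` A" by auto
    moreover have "0 \<in> {..<k}" using Cons.prems by simp
    ultimately show False using Cons.prems by auto
  qed
  moreover have inj: "inj_on ((`) ((+) k)) ?O" by (auto simp: inj_on_def inj_image_eq_iff)
  moreover have "image_mset card (mset_set ((`) ((+) k) ` ?O)) = image_mset card (mset_set ?O)"
    using inj by (simp add: image_mset_mset_set[symmetric] image_mset.compositionality comp_def card_image)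
  ultimately show ?case using Cons by (simp del: block_cycle.simps)
qed simp

lemma orbit_partition_block_cycle:
  assumes "\<pi> \<in> Part m"
  shows "orbit_partition m (block_cycle \<pi>) = \<pi>"
proof -
  have \<pi>: "sorted_wrt (\<ge>) \<pi>" "\<forall>k\<in>set \<pi>. 0 < k" "sum_list \<pi> = m" using assms by (auto simp: Part_def)
  have "orbit_partition m (block_cycle \<pi>) = rev (sort \<pi>)"
    unfolding orbit_partition_def using orbits_block_cycle[OF \<pi>(2)] by (simp add: \<pi>(3) sorted_list_of_multiset_mset)
  also have "sort \<pi> = rev \<pi>" using \<pi>(1) by (intro properties_for_sort) (simp_all add: sorted_wrt_rev)
  finally show ?thesis by simp
qed

section \<open>Characteristic polynomials of permutation matrices\<close>

text \<open>The first row of the characteristic matrix has entries only in its first and last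
  column, and both minors are triangular.\<close>

lemma char_poly_cycle:
  assumes k: "0 < k"
  shows "char_poly (perm_mat k (block_cycle [k])) = monom 1 k - 1"
\<comment> \<open>For \<open>k = 1\<close> the two entries of the first row fall on the same
  position.\<close>
proof (cases "k = 1")
  case True
  have "char_poly_matrix (perm_mat 1 (block_cycle [1])) = mat 1 1 (\<lambda>_. [:-1, 1:])"
    using perm_mat_index[OF block_cycle_permutes[of "[1]"], of 0 0]
    by (intro eq_matI) (auto simp: char_poly_matrix_def)
  then have "char_poly (perm_mat 1 (block_cycle [1])) = [:-1, 1:]"
    by (simp add: char_poly_def det_single del: One_nat_def)
  then show ?thesis using True by (simp add: monom_altdef one_pCons)
next
  case False
  with k have k2: "2 \<le> k" by simp
  let ?P = "perm_mat k (block_cycle [k])"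
  define M where "M = char_poly_matrix ?P"
  have P: "?P $$ (i, j) = (if i = block_cycle [k] j then 1 else 0)" if "i < k" "j < k" for i j
    using perm_mat_index[of "block_cycle [k]" k] block_cycle_permutes[of "[k]"] that by simp
  have Mij: "M $$ (i, j) = (if i = j then [:0, 1:] else 0) - (if i = (if Suc j < k then Suc j else 0) then 1 else 0)"
    if "i < k" "j < k" for i j
    using that P[OF that] by (auto simp: M_def char_poly_matrix_def one_pCons)
  have Mc: "M \<in> carrier_mat k k" by (rule carrier_matI) (simp_all add: M_def char_poly_matrix_def)
  note [simp] = carrier_matD[OF Mc]
  have "det M = (\<Sum>j<k. M $$ (0, j) * cofactor M 0 j)"
    by (rule laplace_expansion_row[OF Mc]) (use k in simp)
  also have "\<dots> = (\<Sum>j\<in>{0, k - 1}. M $$ (0, j) * cofactor M 0 j)"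
  proof (rule sum.mono_neutral_right)
    show "\<forall>j\<in>{..<k} - {0, k - 1}. M $$ (0, j) * cofactor M 0 j = 0"
      using k by (auto simp: Mij)
  qed (use k in auto)
  also have "\<dots> = [:0, 1:] * cofactor M 0 0 - cofactor M 0 (k - 1)"
    using k2 by (auto simp: Mij)
  also have "cofactor M 0 0 = [:0, 1:] ^ (k - 1)"
  proof -
    define D where "D = mat_delete M 0 0"
    have Dc: "D \<in> carrier_mat (k - 1) (k - 1)" by (rule carrier_matI) (simp_all add: D_def mat_delete_def)
    have Dij: "D $$ (i, j) = M $$ (Suc i, Suc j)" if "i < k - 1" "j < k - 1" for i j
      using that by (simp add: D_def mat_delete_def)
    have "det D = prod_list (diag_mat D)"
    proof (rule det_lower_triangular[OF _ Dc])
      fix i j assume "i < j" "j < k - 1"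
      then show "D $$ (i, j) = 0" by (auto simp: Dij Mij)
    qed
    also have "diag_mat D = map (\<lambda>_. [:0, 1:]) [0..<k - 1]"
      using Dc by (auto simp: diag_mat_def Dij Mij)
    finally show ?thesis by (simp add: cofactor_def D_def[symmetric] map_replicate_const prod_list_replicate)
  qed
  \<comment> \<open>The diagonal of the minor consists of -1, so its determinant cancels the sign of
    the cofactor.\<close>
  also have "cofactor M 0 (k - 1) = 1"
  proof -
    define D where "D = mat_delete M 0 (k - 1)"
    have Dc: "D \<in> carrier_mat (k - 1) (k - 1)" by (rule carrier_matI) (simp_all add: D_def mat_delete_def)
    have Dij: "D $$ (i, j) = M $$ (Suc i, j)" if "i < k - 1" "j < k - 1" for i j
      using that by (simp add: D_def mat_delete_def)
    have "det D = prod_list (diag_mat D)"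
    proof (rule det_upper_triangular[OF _ Dc])
      show "upper_triangular D" using Dc by (auto simp: upper_triangular_def Dij Mij)
    qed
    also have "diag_mat D = map (\<lambda>_. -1) [0..<k - 1]"
      using Dc by (auto simp: diag_mat_def Dij Mij)
    finally show ?thesis
      by (simp add: cofactor_def D_def[symmetric, unfolded One_nat_def] map_replicate_const prod_list_replicate flip: power_mult_distrib)
  qed
  finally have "det M = [:0, 1:] ^ Suc (k - 1) - 1" by simp
  then show ?thesis using k by (simp add: char_poly_def M_def[symmetric] monom_altdef)
qed

lemma char_poly_block_cycle:
  assumes "\<forall>k\<in>set \<pi>. 0 < k"
  shows "char_poly (perm_mat (sum_list \<pi>) (block_cycle \<pi>)) = (\<Prod>k\<leftarrow>\<pi>. monom 1 k - 1)"
  using assms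
proof (induction \<pi>)
  case Nil
  then show ?case by (simp add: char_poly_def char_poly_matrix_def det_dim_zero carrier_matI)
next
  case (Cons k \<pi>)
  let ?m = "sum_list \<pi>"
  let ?A = "char_poly_matrix (perm_mat k (block_cycle [k]))"
  let ?B = "char_poly_matrix (perm_mat ?m (block_cycle \<pi>))"
  have idx: "perm_mat (sum_list \<rho>) (block_cycle \<rho>) $$ (i, j) = (if i = block_cycle \<rho> j then 1 else 0)"
    if "i < sum_list \<rho>" "j < sum_list \<rho>" for \<rho> i j
    using perm_mat_index[OF block_cycle_permutes[of \<rho>]] that by simp
  have idk: "perm_mat k (block_cycle [k]) $$ (i, j) = (if i = block_cycle [k] j then 1 else 0)"
    if "i < k" "j < k" for i j
    using idx[of i "[k]" j] that by simp
  have A: "?A \<in> carrier_mat k k" and B: "?B \<in> carrier_mat ?m ?m"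
    by (simp_all add: char_poly_matrix_def carrier_matI)
  have "char_poly_matrix (perm_mat (sum_list (k # \<pi>)) (block_cycle (k # \<pi>))) =
      four_block_mat ?A (0\<^sub>m k ?m) (0\<^sub>m ?m k) ?B"
  proof (rule eq_matI)
    fix i j assume "i < dim_row (four_block_mat ?A (0\<^sub>m k ?m) (0\<^sub>m ?m k) ?B)"
      "j < dim_col (four_block_mat ?A (0\<^sub>m k ?m) (0\<^sub>m ?m k) ?B)"
    then have "i < k + ?m" "j < k + ?m" using A B by (auto simp: char_poly_matrix_def)
    then show "char_poly_matrix (perm_mat (sum_list (k # \<pi>)) (block_cycle (k # \<pi>))) $$ (i, j) =
        four_block_mat ?A (0\<^sub>m k ?m) (0\<^sub>m ?m k) ?B $$ (i, j)"
      using idx[of i "k # \<pi>" j] idk[of i j] idx[of "i - k" \<pi> "j - k"] block_cycle_less[of "j - k" \<pi>]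
      by (auto simp: char_poly_matrix_def index_mat_four_block)
  qed (simp_all add: char_poly_matrix_def)
  then have "char_poly (perm_mat (sum_list (k # \<pi>)) (block_cycle (k # \<pi>))) = det ?A * det ?B"
    unfolding char_poly_def using det_four_block_mat_upper_right_zero[OF A refl _ B, of "0\<^sub>m ?m k"] by simp
  also have "\<dots> = (monom 1 k - 1) * (\<Prod>k\<leftarrow>\<pi>. monom 1 k - 1)"
    using Cons char_poly_cycle[of k] by (simp add: char_poly_def)
  finally show ?case by (simp del: block_cycle.simps)
qed

section \<open>From block cycles to arbitrary permutations\<close>

lemma perm_mat_comp:
  assumes "\<xi> permutes {..<m}" "\<eta> permutes {..<m}"
  shows "perm_mat m \<xi> * perm_mat m \<eta> = perm_mat m (\<xi> \<circ> \<eta>)"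
proof (rule eq_matI)
  fix i j assume "i < dim_row (perm_mat m (\<xi> \<circ> \<eta>))" "j < dim_col (perm_mat m (\<xi> \<circ> \<eta>))"
  then have ij: "i < m" "j < m" by auto
  have "\<eta> j < m" using permutes_in_image[OF assms(2), of j] ij by simp
  then show "(perm_mat m \<xi> * perm_mat m \<eta>) $$ (i, j) = perm_mat m (\<xi> \<circ> \<eta>) $$ (i, j)"
    using ij mult_perm_mat_index[OF assms(2) perm_mat_carrier ij] permutes_compose[OF assms(2,1)]
    by (simp add: perm_mat_index assms del: index_mult_mat)
qed simp_all

lemma perm_mat_id: "perm_mat m id = 1\<^sub>m m"
  by (rule eq_matI) (auto simp: perm_mat_index[OF permutes_id])

lemma perm_mat_inverse:
  assumes "\<sigma> permutes {..<m}"
  shows "perm_mat m \<sigma> * perm_mat m (inv \<sigma>) = 1\<^sub>m m" "perm_mat m (inv \<sigma>) * perm_mat m \<sigma> = 1\<^sub>m m"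
  using permutes_inv_o[OF assms]
  by (simp_all add: perm_mat_comp assms permutes_inv[OF assms] perm_mat_id)

lemma char_poly_perm_mat:
  assumes \<xi>: "\<xi> permutes {..<m}"
  shows "char_poly (perm_mat m \<xi>) = (\<Prod>k\<leftarrow>orbit_partition m \<xi>. monom 1 k - 1)"
proof -
  define \<pi> where "\<pi> = orbit_partition m \<xi>"
  have \<pi>: "\<pi> \<in> Part m" unfolding \<pi>_def by (rule orbit_partition_Part[OF \<xi>])
  then have pos: "\<forall>k\<in>set \<pi>. 0 < k" and sum: "sum_list \<pi> = m" by (auto simp: Part_def)
  have b: "block_cycle \<pi> permutes {..<m}" using block_cycle_permutes[of \<pi>] sum by simp
  have "orbit_partition m \<xi> = orbit_partition m (block_cycle \<pi>)"
    using orbit_partition_block_cycle[OF \<pi>] by (simp add: \<pi>_def)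
  then obtain \<sigma> where \<sigma>: "\<sigma> permutes {..<m}" "\<And>v. \<sigma> (\<xi> v) = block_cycle \<pi> (\<sigma> v)"
    using conjugate_of_orbit_partition[OF \<xi> b] by blast
  have i\<sigma>: "inv \<sigma> permutes {..<m}" by (rule permutes_inv[OF \<sigma>(1)])
  have "\<xi> = inv \<sigma> \<circ> (block_cycle \<pi> \<circ> \<sigma>)"
    using \<sigma> permutes_inverses[OF \<sigma>(1)] by (auto simp: fun_eq_iff simp flip: \<sigma>(2))
  then have "perm_mat m \<xi> = perm_mat m (inv \<sigma>) * (perm_mat m (block_cycle \<pi>) * perm_mat m \<sigma>)"
    using perm_mat_comp[OF b \<sigma>(1)] perm_mat_comp[OF i\<sigma> permutes_compose[OF \<sigma>(1) b]] by simp
  also have "\<dots> = perm_mat m (inv \<sigma>) * perm_mat m (block_cycle \<pi>) * perm_mat m \<sigma>"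
    by (rule assoc_mult_mat[symmetric]) auto
  finally have "similar_mat (perm_mat m \<xi>) (perm_mat m (block_cycle \<pi>))"
    unfolding similar_mat_def similar_mat_wit_def Let_def using perm_mat_inverse[OF \<sigma>(1)]
    by (intro exI[of _ "perm_mat m (inv \<sigma>)"] exI[of _ "perm_mat m \<sigma>"]) auto
  then have "char_poly (perm_mat m \<xi>) = char_poly (perm_mat m (block_cycle \<pi>))" by (rule char_poly_similar)
  also have "\<dots> = (\<Prod>k\<leftarrow>\<pi>. monom 1 k - 1)" using char_poly_block_cycle[OF pos] sum by simp
  finally show ?thesis by (simp add: \<pi>_def)
qed

text \<open>The largest part is the largest order of a root of unity among the roots of the product.\<close>

lemma root_of_unity_cis:
  assumes "0 < K"
  shows "cis (2 * pi / real K) ^ k = 1 \<longleftrightarrow> K dvd k"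
proof -
  have "cis (2 * pi / real K) ^ k = cis (real k * (2 * pi / real K))" by (rule DeMoivre)
  also have "\<dots> = 1 \<longleftrightarrow> K dvd k"
  proof
    assume "cis (real k * (2 * pi / real K)) = 1"
    then have "cos (real k * (2 * pi / real K)) = 1" by (simp add: complex_eq_iff)
    then obtain n :: int where "real k * (2 * pi / real K) = real_of_int n * 2 * pi"
      using cos_one_2pi_int by blast
    then have "real k = real_of_int n * real K" using assms by (simp add: field_simps)
    then have "int k = n * int K" by (metis of_int_eq_iff of_int_mult of_int_of_nat_eq)
    then show "K dvd k" by (metis dvd_triv_right int_dvd_int_iff)
  next
    assume "K dvd k"
    then obtain l where "k = K * l" ..
    then have "real k * (2 * pi / real K) = 2 * pi * real l" using assms by (simp add: field_simps)
    then show "cis (real k * (2 * pi / real K)) = 1"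
      by (simp add: cis_multiple_2pi)
  qed
  finally show ?thesis .
qed

lemma poly_prod_monom_root:
  "poly (of_int_poly (\<Prod>k\<leftarrow>\<pi>. monom 1 k - 1)) (x::complex) = (\<Prod>k\<leftarrow>\<pi>. x ^ k - 1)"
  by (induction \<pi>) (simp_all add: of_int_poly_hom.hom_mult of_int_poly_hom.hom_minus poly_monom map_poly_monom)

text \<open>Primitive roots of unity show that the largest parts agree; their common factor is
  cancelled and the argument repeats.\<close>

lemma partition_eq_of_prod:
  assumes "sorted_wrt (\<ge>) \<pi>" "\<forall>k\<in>set \<pi>. 0 < k" "sorted_wrt (\<ge>) \<rho>" "\<forall>k\<in>set \<rho>. 0 < k"
    and "(\<Prod>k\<leftarrow>\<pi>. monom 1 k - 1 :: int poly) = (\<Prod>k\<leftarrow>\<rho>. monom 1 k - 1)"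
  shows "\<pi> = \<rho>"
  using assms
proof (induction \<pi> arbitrary: \<rho>)
  case Nil
  show ?case
  proof (cases \<rho>)
    case (Cons k \<rho>')
    have "poly (of_int_poly (\<Prod>k\<leftarrow>\<rho>. monom 1 k - 1)) (1::complex) = 0"
      unfolding poly_prod_monom_root Cons by simp
    then show ?thesis using Nil.prems(5) by simp
  qed simp
next
  case (Cons k \<pi>)
  \<comment> \<open>A primitive \<open>K\<close>-th root of unity is a zero of the product
    containing the part \<open>K\<close>, hence of a factor on the other side, so \<open>K\<close>
    divides one of the parts there.\<close>
  have root: "\<exists>l\<in>set \<sigma>. K \<le> l"
    if "K \<in> set \<tau>" "\<forall>k\<in>set \<tau>. 0 < k" "\<forall>k\<in>set \<sigma>. 0 < k"
      "(\<Prod>k\<leftarrow>\<tau>. monom 1 k - 1 :: int poly) = (\<Prod>k\<leftarrow>\<sigma>. monom 1 k - 1)" for K \<sigma> \<tau>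
  proof -
    let ?z = "cis (2 * pi / real K)"
    have "(\<Prod>k\<leftarrow>\<tau>. ?z ^ k - 1) = (\<Prod>k\<leftarrow>\<sigma>. ?z ^ k - 1)"
      unfolding poly_prod_monom_root[symmetric] that(4) ..
    moreover have "(\<Prod>k\<leftarrow>\<tau>. ?z ^ k - 1) = 0"
      using that(1,2) root_of_unity_cis[of K K] by (auto simp: prod_list_zero_iff)
    ultimately obtain l where "l \<in> set \<sigma>" "?z ^ l = 1" by (auto simp: prod_list_zero_iff)
    then show ?thesis using that root_of_unity_cis[of K l] by (auto intro: dvd_imp_le)
  qed
  obtain l \<rho>' where \<rho>: "\<rho> = l # \<rho>'"
    using root[of k "k # \<pi>" \<rho>] Cons.prems by (cases \<rho>) auto
  have "k \<le> l" using root[of k "k # \<pi>" \<rho>] Cons.prems unfolding \<rho> by auto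
  moreover have "l \<le> k" using root[of l \<rho> "k # \<pi>"] Cons.prems unfolding \<rho> by auto
  ultimately have kl: "k = l" by simp
  have "monom 1 k - 1 \<noteq> (0 :: int poly)"
  proof
    assume "monom 1 k - 1 = (0 :: int poly)"
    then have "coeff (monom 1 k - 1 :: int poly) k = 0" by simp
    then show False using Cons.prems by simp
  qed
  then have "(\<Prod>k\<leftarrow>\<pi>. monom 1 k - 1 :: int poly) = (\<Prod>k\<leftarrow>\<rho>'. monom 1 k - 1)"
    using Cons.prems(5) by (simp add: \<rho> kl)
  then have "\<pi> = \<rho>'" using Cons.IH[of \<rho>'] Cons.prems \<rho> by simp
  then show ?case by (simp add: \<rho> kl)
qed

section \<open>The Coxeter polynomial\<close>

lemma const_poly_sum: "[:sum f A:] = (\<Sum>x\<in>A. [:f x:])"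
proof (induction A rule: infinite_finite_induct)
  case (insert x A)
  show ?case unfolding sum.insert[OF insert(1,2)] insert(3)[symmetric] by simp
qed auto

lemma mat_const_poly_mult:
  fixes A B :: "'a::comm_ring_1 mat"
  assumes "A \<in> carrier_mat r k" "B \<in> carrier_mat k c"
  shows "map_mat (\<lambda>a. [:a:]) (A * B) = map_mat (\<lambda>a. [:a:]) A * map_mat (\<lambda>a. [:a:]) B"
  using assms by (intro eq_matI) (auto simp: scalar_prod_def const_poly_sum mult.commute)

text \<open>One block matrix \<open>M\<close> is made block triangular in two ways, by
  \<open>L\<close> from the left and by \<open>R\<close> from the right. The powers of \<mu> come
  from \<open>det R\<close> and from a corner of \<open>M R\<close>; no division by \<mu> occurs,
  which matters since \<mu> will be a polynomial.\<close>

lemma det_smult_one_add_mult_comm: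
  fixes A B :: "'a::idom mat"
  assumes A: "A \<in> carrier_mat n m" and B: "B \<in> carrier_mat m n"
  shows "det (\<mu> \<cdot>\<^sub>m 1\<^sub>m n + A * B) * \<mu> ^ m = det (\<mu> \<cdot>\<^sub>m 1\<^sub>m m + B * A) * \<mu> ^ n"
proof -
  define M where "M = four_block_mat (\<mu> \<cdot>\<^sub>m 1\<^sub>m n) (- A) B (1\<^sub>m m)"
  have M: "M \<in> carrier_mat (n + m) (n + m)" unfolding M_def by (intro four_block_carrier_mat) simp_all
  define L where "L = four_block_mat (1\<^sub>m n) A (0\<^sub>m m n) (1\<^sub>m m)"
  define R where "R = four_block_mat (1\<^sub>m n) A (0\<^sub>m m n) (\<mu> \<cdot>\<^sub>m 1\<^sub>m m)"
  have L: "L \<in> carrier_mat (n + m) (n + m)" and R: "R \<in> carrier_mat (n + m) (n + m)"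
    unfolding L_def R_def by (intro four_block_carrier_mat; simp)+
  have "L * M = four_block_mat (\<mu> \<cdot>\<^sub>m 1\<^sub>m n + A * B) (0\<^sub>m n m) B (1\<^sub>m m)"
  proof -
    have "L * M = four_block_mat (1\<^sub>m n * (\<mu> \<cdot>\<^sub>m 1\<^sub>m n) + A * B) (1\<^sub>m n * (- A) + A * 1\<^sub>m m)
        (0\<^sub>m m n * (\<mu> \<cdot>\<^sub>m 1\<^sub>m n) + 1\<^sub>m m * B) (0\<^sub>m m n * (- A) + 1\<^sub>m m * 1\<^sub>m m)"
      unfolding L_def M_def
      by (rule mult_four_block_mat[where ?nr1.0 = n and ?n1.0 = n and ?n2.0 = m and ?nr2.0 = m and ?nc1.0 = n and ?nc2.0 = m])
        (use A B in auto)
    moreover have "1\<^sub>m n * (- A) + A * 1\<^sub>m m = 0\<^sub>m n m" using A by (intro eq_matI) simp_all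
    moreover have "0\<^sub>m m n * (\<mu> \<cdot>\<^sub>m 1\<^sub>m n) + 1\<^sub>m m * B = B" using B by (intro eq_matI) simp_all
    moreover have "0\<^sub>m m n * (- A) + 1\<^sub>m m * 1\<^sub>m m = 1\<^sub>m m" using A by (intro eq_matI) simp_all
    ultimately show ?thesis by simp
  qed
  then have "det (L * M) = det (\<mu> \<cdot>\<^sub>m 1\<^sub>m n + A * B)"
    using det_four_block_mat_upper_right_zero[of "\<mu> \<cdot>\<^sub>m 1\<^sub>m n + A * B" n "0\<^sub>m n m" m B "1\<^sub>m m"] A B by simp
  moreover have "det L = 1"
    unfolding L_def using det_four_block_mat_lower_left_zero[of "1\<^sub>m n" n A m "0\<^sub>m m n" "1\<^sub>m m"] A by simp
  ultimately have 1: "det M = det (\<mu> \<cdot>\<^sub>m 1\<^sub>m n + A * B)" using det_mult[OF L M] by simp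
  have "M * R = four_block_mat (\<mu> \<cdot>\<^sub>m 1\<^sub>m n) (0\<^sub>m n m) B (\<mu> \<cdot>\<^sub>m 1\<^sub>m m + B * A)"
  proof -
    have "M * R = four_block_mat (\<mu> \<cdot>\<^sub>m 1\<^sub>m n * 1\<^sub>m n + (- A) * 0\<^sub>m m n) (\<mu> \<cdot>\<^sub>m 1\<^sub>m n * A + (- A) * (\<mu> \<cdot>\<^sub>m 1\<^sub>m m))
        (B * 1\<^sub>m n + 1\<^sub>m m * 0\<^sub>m m n) (B * A + 1\<^sub>m m * (\<mu> \<cdot>\<^sub>m 1\<^sub>m m))"
      unfolding R_def M_def
      by (rule mult_four_block_mat[where ?nr1.0 = n and ?n1.0 = n and ?n2.0 = m and ?nr2.0 = m and ?nc1.0 = n and ?nc2.0 = m])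
        (use A B in auto)
    moreover have "\<mu> \<cdot>\<^sub>m 1\<^sub>m n * 1\<^sub>m n + (- A) * 0\<^sub>m m n = \<mu> \<cdot>\<^sub>m 1\<^sub>m n" using A by (intro eq_matI) simp_all
    moreover have "\<mu> \<cdot>\<^sub>m 1\<^sub>m n * A = \<mu> \<cdot>\<^sub>m A"
      using A by (simp add: mult_smult_assoc_mat[of _ n n _ m])
    moreover have "(- A) * (\<mu> \<cdot>\<^sub>m 1\<^sub>m m) = \<mu> \<cdot>\<^sub>m (- A)"
      using A by (simp add: mult_smult_distrib[of _ n m _ m])
    moreover have "\<mu> \<cdot>\<^sub>m A + \<mu> \<cdot>\<^sub>m (- A) = 0\<^sub>m n m" using A by (intro eq_matI) simp_all
    moreover have "B * 1\<^sub>m n + 1\<^sub>m m * 0\<^sub>m m n = B" using B by (intro eq_matI) simp_all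
    moreover have "B * A + 1\<^sub>m m * (\<mu> \<cdot>\<^sub>m 1\<^sub>m m) = \<mu> \<cdot>\<^sub>m 1\<^sub>m m + B * A"
      using A B by (simp add: comm_add_mat[of _ m m])
    ultimately show ?thesis by simp
  qed
  then have "det (M * R) = \<mu> ^ n * det (\<mu> \<cdot>\<^sub>m 1\<^sub>m m + B * A)"
    using det_four_block_mat_upper_right_zero[of "\<mu> \<cdot>\<^sub>m 1\<^sub>m n" n "0\<^sub>m n m" m B "\<mu> \<cdot>\<^sub>m 1\<^sub>m m + B * A"] A B
    by (simp add: det_smult)
  moreover have "det R = \<mu> ^ m"
    unfolding R_def using det_four_block_mat_lower_left_zero[of "1\<^sub>m n" n A m "0\<^sub>m m n" "\<mu> \<cdot>\<^sub>m 1\<^sub>m m"] A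
    by (simp add: det_smult)
  ultimately have "det M * \<mu> ^ m = \<mu> ^ n * det (\<mu> \<cdot>\<^sub>m 1\<^sub>m m + B * A)" using det_mult[OF M R] by simp
  then show ?thesis by (simp add: 1 mult.commute)
qed

text \<open>The shift \<open>a\<close> allows to treat both \<open>1 - A B\<close> and \<open>A B\<close>.\<close>

lemma char_poly_mult_comm:
  fixes A B :: "'a::idom mat"
  assumes A: "A \<in> carrier_mat n m" and B: "B \<in> carrier_mat m n"
  shows "char_poly (a \<cdot>\<^sub>m 1\<^sub>m n - A * B) * [:- a, 1:] ^ m = char_poly (a \<cdot>\<^sub>m 1\<^sub>m m - B * A) * [:- a, 1:] ^ n"
proof -
  let ?h = "map_mat (\<lambda>a. [:a:])"
  have eq: "char_poly_matrix (a \<cdot>\<^sub>m 1\<^sub>m r - X * Y) = [:- a, 1:] \<cdot>\<^sub>m 1\<^sub>m r + ?h X * ?h Y"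
    if X: "X \<in> carrier_mat r k" and Y: "Y \<in> carrier_mat k r" for X Y :: "'a mat" and r k
    unfolding mat_const_poly_mult[OF X Y, symmetric]
    using X Y by (intro eq_matI) (auto simp: char_poly_matrix_def)
  show ?thesis
    unfolding char_poly_def eq[OF A B] eq[OF B A]
    using det_smult_one_add_mult_comm[of "?h A" n m "?h B" "[:- a, 1:]"] A B by simp
qed

lemma transpose_mult_self_zero:
  fixes X :: "int mat"
  assumes "X \<in> carrier_mat r c" "transpose_mat X * X = 0\<^sub>m c c"
  shows "X = 0\<^sub>m r c"
proof (rule eq_matI)
  fix i j assume "i < dim_row (0\<^sub>m r c :: int mat)" "j < dim_col (0\<^sub>m r c :: int mat)"
  then have ij: "i < r" "j < c" by auto
  have "(\<Sum>k<r. X $$ (k, j) * X $$ (k, j)) = (transpose_mat X * X) $$ (j, j)"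
    using assms(1) ij by (simp add: scalar_prod_def atLeast0LessThan)
  also have "\<dots> = 0" using ij by (simp add: assms(2))
  finally have "\<forall>k\<in>{..<r}. X $$ (k, j) * X $$ (k, j) = 0"
    by (subst (asm) sum_nonneg_eq_0_iff) auto
  then show "X $$ (i, j) = 0\<^sub>m r c $$ (i, j)" using ij by simp
qed (use assms in auto)

lemma ring_emb_uminus: "ring_emb (- A) = - ring_emb A"
  by transfer (auto simp: mat_act_def fun_eq_iff sum_negf)

text \<open>A permutation matrix is normal, so it is unipotent only if it is the identity.\<close>

lemma unipotent_perm_mat:
  assumes \<eta>: "\<eta> permutes {..<m}" and X: "X \<in> carrier_mat m c"
    and N: "(perm_mat m \<eta> - 1\<^sub>m m) * ((perm_mat m \<eta> - 1\<^sub>m m) * X) = 0\<^sub>m m c"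
  shows "(perm_mat m \<eta> - 1\<^sub>m m) * X = 0\<^sub>m m c"
proof (rule transpose_mult_self_zero)
  note [simp] = carrier_matD[OF X]
  let ?P = "perm_mat m \<eta>"
  let ?N = "?P - 1\<^sub>m m"
  show "?N * X \<in> carrier_mat m c" by (rule carrier_matI) simp_all
  have e: "transpose_mat ?P * ?P = 1\<^sub>m m"
    using perm_mat_inverse(2)[OF \<eta>] by (simp add: perm_mat_transpose[OF \<eta>])
  have e': "swap_biendo (ring_emb ?P) * (ring_emb ?P * x) = ring_emb (1\<^sub>m m) * x" for x
    using arg_cong[OF e, of ring_emb] by (simp add: ring_emb_simps flip: mult.assoc)
  \<comment> \<open>For an orthogonal matrix \<open>P\<close> one has
    \<open>(P - 1)^T = - P^T (P - 1)\<close>.\<close>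
  have "transpose_mat (?N * X) * (?N * X) = - (transpose_mat X * (transpose_mat ?P * (?N * (?N * X))))"
    by (rule ring_emb_inj) (simp_all add: ring_emb_simps ring_emb_uminus ring_emb_unit swap.star_simps algebra_simps e')
  also have "\<dots> = 0\<^sub>m c c" unfolding N by (intro eq_matI) simp_all
  finally show "transpose_mat (?N * X) * (?N * X) = 0\<^sub>m c c" .
qed

context coxeter_datum
begin

abbreviation "\<pi> \<equiv> orbit_partition m \<xi>"

definition \<Phi> :: "int mat" where "\<Phi> = - (transpose_mat G * K)"

lemma \<Phi>_dim [simp]: "dim_row \<Phi> = n" "dim_col \<Phi> = n"
  by (simp_all add: \<Phi>_def)

lemma \<Phi>_carrier: "\<Phi> \<in> carrier_mat n n"
  by (rule carrier_matI) simp_all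

lemma \<Phi>_eq: "\<Phi> = 1\<^sub>m n - transpose_mat I * (I * K)"
proof -
  have "transpose_mat I * (I * K) = (transpose_mat I * I) * K"
    by (rule ring_emb_inj) (simp_all add: ring_emb_simps mult.assoc)
  also have "\<dots> = 1\<^sub>m n - \<Phi>"
    unfolding sym[symmetric] \<Phi>_def GK(1)[symmetric]
    by (rule ring_emb_inj) (simp_all add: ring_emb_simps ring_emb_uminus algebra_simps)
  finally have e: "transpose_mat I * (I * K) = 1\<^sub>m n - \<Phi>" .
  show ?thesis unfolding e by (rule eq_matI) simp_all
qed

lemma \<Phi>_transpose_I: "\<Phi> * transpose_mat I = transpose_mat I * perm_mat m \<xi>"
proof -
  have "\<Phi> * transpose_mat I = transpose_mat I * (1\<^sub>m m - I * K * transpose_mat I)"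
    unfolding \<Phi>_eq by (rule ring_emb_inj) (simp_all add: ring_emb_simps ring_emb_unit algebra_simps)
  then show ?thesis by (simp add: laplacian)
qed

text \<open>Sylvester's identity for \<open>I^T\<close> and \<open>I K\<close> relates \<Phi> to the
  permutation matrix. The equation stays cross-multiplied because \<open>n < m\<close> can
  occur.\<close>

theorem coxeter_poly: "char_poly \<Phi> * [:-1, 1:] ^ m = (\<Prod>k\<leftarrow>\<pi>. monom 1 k - 1) * [:-1, 1:] ^ n"
proof -
  have one: "1 \<cdot>\<^sub>m 1\<^sub>m r = (1\<^sub>m r :: int mat)" for r by (rule eq_matI) auto
  have "I * K * transpose_mat I \<in> carrier_mat m m" by (rule carrier_matI) simp_all
  have c: "transpose_mat I \<in> carrier_mat n m" "I * K \<in> carrier_mat m n" using I K by auto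
  have "char_poly (1\<^sub>m m - I * K * transpose_mat I) = (\<Prod>k\<leftarrow>\<pi>. monom 1 k - 1)"
    unfolding laplacian by (rule char_poly_perm_mat[OF perm])
  then show ?thesis
    using char_poly_mult_comm[OF c, of 1] unfolding one by (simp add: \<Phi>_eq)
qed

section \<open>Coxeter numbers\<close>

lemma perm_pow: "\<xi> ^^ t permutes {..<m}"
proof (induction t)
  case 0
  show ?case by (simp only: funpow.simps permutes_id)
next
  case (Suc t)
  show ?case unfolding funpow.simps by (rule permutes_compose[OF Suc perm])
qed

lemma perm_pow_Suc: "perm_mat m (\<xi> ^^ t) * perm_mat m \<xi> = perm_mat m (\<xi> ^^ Suc t)"
  using perm_mat_comp[OF perm_pow perm] by (simp add: funpow_Suc_right del: funpow.simps)

text \<open>The geometric sum of the powers of the Coxeter-Laplacian; it measures the deviation of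
  the powers of \<Phi> from the identity.\<close>

definition R :: "nat \<Rightarrow> int mat" where
  "R t = mat m m (\<lambda>(u, v). \<Sum>i<t. if u = (\<xi> ^^ i) v then 1 else 0)"

lemma R_dim [simp]: "dim_row (R t) = m" "dim_col (R t) = m"
  by (simp_all add: R_def)

lemma R_Suc: "R (Suc t) = R t + perm_mat m (\<xi> ^^ t)"
  by (rule eq_matI) (auto simp: R_def perm_mat_index[OF perm_pow])

lemma \<Phi>_pow_transpose_I: "\<Phi> ^\<^sub>m t * transpose_mat I = transpose_mat I * perm_mat m (\<xi> ^^ t)"
proof (induction t)
  case 0
  show ?case unfolding funpow.simps perm_mat_id pow_mat.simps using I by simp
next
  case (Suc t)
  have "\<Phi> ^\<^sub>m Suc t * transpose_mat I = \<Phi> ^\<^sub>m t * (\<Phi> * transpose_mat I)"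
    by (rule ring_emb_inj) (simp_all add: ring_emb_simps mult.assoc)
  also have "\<dots> = (\<Phi> ^\<^sub>m t * transpose_mat I) * perm_mat m \<xi>"
    unfolding \<Phi>_transpose_I by (rule ring_emb_inj) (simp_all add: ring_emb_simps mult.assoc)
  also have "\<dots> = transpose_mat I * (perm_mat m (\<xi> ^^ t) * perm_mat m \<xi>)"
    unfolding Suc by (rule ring_emb_inj) (simp_all add: ring_emb_simps mult.assoc)
  finally show ?case unfolding perm_pow_Suc .
qed

lemma \<Phi>_pow: "\<Phi> ^\<^sub>m t = 1\<^sub>m n - transpose_mat I * (R t * (I * K))"
proof (induction t)
  case 0
  have "R 0 = 0\<^sub>m m m" by (rule eq_matI) (auto simp: R_def)
  then show ?case by (intro eq_matI) (simp_all add: I K left_mult_zero_mat[of _ m n] right_mult_zero_mat[of _ n m])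
next
  case (Suc t)
  have "\<Phi> ^\<^sub>m Suc t = \<Phi> ^\<^sub>m t - \<Phi> ^\<^sub>m t * transpose_mat I * (I * K)"
    unfolding pow_mat.simps(2) by (subst \<Phi>_eq, rule ring_emb_inj)
      (simp_all add: ring_emb_simps ring_emb_unit algebra_simps)
  also have "\<dots> = \<Phi> ^\<^sub>m t - transpose_mat I * (perm_mat m (\<xi> ^^ t) * (I * K))"
    unfolding \<Phi>_pow_transpose_I by (rule ring_emb_inj) (simp_all add: ring_emb_simps algebra_simps)
  also have "\<dots> = 1\<^sub>m n - transpose_mat I * (R (Suc t) * (I * K))"
    unfolding Suc R_Suc by (rule ring_emb_inj) (simp_all add: ring_emb_simps algebra_simps)
  finally show ?case .
qed

text \<open>The columns of \<open>I S\<close> are the differences between the basis vectors and that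
  of the root, so a function orthogonal to all arrows is constant: this is where connectedness
  enters.\<close>

lemma transpose_I_kernel:
  assumes F: "F \<in> carrier_mat m k" and z0: "transpose_mat I * F = 0\<^sub>m n k" and ij: "i < m" "j < k"
  shows "F $$ (i, j) = F $$ (z, j)"
proof -
  note [simp] = carrier_matD[OF F]
  have "transpose_mat (I * S) * F = transpose_mat S * (transpose_mat I * F)"
    by (rule ring_emb_inj) (simp_all add: ring_emb_simps swap.star_simps mult.assoc)
  then have "(transpose_mat (I * S) * F) $$ (i, j) = 0" using ij S by (simp add: z0)
  moreover have "(transpose_mat (I * S) * F) $$ (i, j) =
      (\<Sum>l<m. ((if l = i then 1 else 0) - (if l = z then 1 else 0)) * F $$ (l, j))"
    unfolding IS using ij by (simp add: scalar_prod_def atLeast0LessThan)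
  moreover have "\<dots> = (\<Sum>l<m. (if l = i then F $$ (l, j) else 0) - (if l = z then F $$ (l, j) else 0))"
    by (intro sum.cong) auto
  ultimately show ?thesis using ij z by (simp add: sum_subtractf)
qed

lemma transpose_I_one: "transpose_mat I * mat m k (\<lambda>(i, j). f j) = 0\<^sub>m n k"
  by (rule eq_matI) (auto simp: scalar_prod_def atLeast0LessThan col_sum simp flip: sum_distrib_right)

lemma const_perm_mat: "\<eta> permutes {..<m} \<Longrightarrow> (perm_mat m \<eta> - 1\<^sub>m m) * mat m k (\<lambda>(i, j). f j) = 0\<^sub>m m k"
  using permutes_in_image[OF permutes_inv, of \<eta> "{..<m}"]
  by (subst minus_mult_distrib_mat[of _ m m _ _ k], simp_all, intro eq_matI)
    (auto simp: perm_mat_mult_index[where k = k] simp del: index_mult_mat(1))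

lemma perm_pow_id_iff: "perm_mat m (\<xi> ^^ t) = 1\<^sub>m m \<longleftrightarrow> Lcm (set \<pi>) dvd t"
proof -
  have "perm_mat m (\<xi> ^^ t) = 1\<^sub>m m \<longleftrightarrow> (\<forall>v<m. (\<xi> ^^ t) v = v)"
  proof
    assume e: "perm_mat m (\<xi> ^^ t) = 1\<^sub>m m"
    have "\<xi> ^^ t = id"
      by (rule perm_mat_inj[OF perm_pow permutes_id]) (simp add: e perm_mat_id)
    then show "\<forall>v<m. (\<xi> ^^ t) v = v" by simp
  next
    assume "\<forall>v<m. (\<xi> ^^ t) v = v"
    then show "perm_mat m (\<xi> ^^ t) = 1\<^sub>m m"
      by (intro eq_matI) (auto simp: perm_mat_index[OF perm_pow])
  qed
  then show ?thesis by (simp add: funpow_eq_id_iff[OF perm])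
qed

text \<open>\<open>I^T\<close> intertwines \<open>\<Phi>^t - 1\<close> with \<open>P - 1\<close> for
  the permutation matrix \<open>P\<close> of \<open>\<xi>^t\<close>. Nilpotency passes to
  \<open>P - 1\<close> up to constant functions, and a unipotent permutation matrix is the identity;
  conversely \<open>P = 1\<close> already gives \<open>(\<Phi>^t - 1)^2 = 0\<close>.\<close>

lemma nilpotent_iff: "nilpotent_mat n (\<Phi> ^\<^sub>m t - 1\<^sub>m n) \<longleftrightarrow> Lcm (set \<pi>) dvd t"
proof
  define N where "N = \<Phi> ^\<^sub>m t - 1\<^sub>m n"
  define L where "L = perm_mat m (\<xi> ^^ t) - 1\<^sub>m m"
  have [simp]: "dim_row N = n" "dim_col N = n" "dim_row L = m" "dim_col L = m"
    by (simp_all add: N_def L_def)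
  have NI: "N * transpose_mat I = transpose_mat I * L"
    unfolding N_def L_def using ring_emb_mult_eq[OF \<Phi>_pow_transpose_I, of t]
    by (intro ring_emb_inj) (simp_all add: ring_emb_simps ring_emb_unit algebra_simps)
  {
    assume "nilpotent_mat n (\<Phi> ^\<^sub>m t - 1\<^sub>m n)"
    then obtain k where k: "N ^\<^sub>m k = 0\<^sub>m n n" by (auto simp: nilpotent_mat_def N_def)
    have pow: "N ^\<^sub>m k * transpose_mat I = transpose_mat I * L ^\<^sub>m k" for k
    proof (induction k)
      case 0
      then show ?case using I by simp
    next
      case (Suc k)
      have "N ^\<^sub>m Suc k * transpose_mat I = N ^\<^sub>m k * (N * transpose_mat I)"
        by (rule ring_emb_inj) (simp_all add: ring_emb_simps mult.assoc)
      also have "\<dots> = (N ^\<^sub>m k * transpose_mat I) * L"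
        unfolding NI by (rule ring_emb_inj) (simp_all add: ring_emb_simps mult.assoc)
      also have "\<dots> = transpose_mat I * (L ^\<^sub>m k * L)"
        unfolding Suc by (rule ring_emb_inj) (simp_all add: ring_emb_simps mult.assoc)
      finally show ?case by simp
    qed
    have Lc: "L ^\<^sub>m k \<in> carrier_mat m m" for k by (rule carrier_matI) simp_all
    have "transpose_mat I * L ^\<^sub>m k = 0\<^sub>m n m" using pow[of k] I by (simp add: k)
    then have "(L ^\<^sub>m k) $$ (i, j) = (L ^\<^sub>m k) $$ (z, j)" if "i < m" "j < m" for i j
      using transpose_I_kernel[OF Lc] that by blast
    \<comment> \<open>Only constants die under \<open>I^T\<close>, so each column of the power is
      constant, and one more factor \<open>L\<close> kills it.\<close>
    then have "L ^\<^sub>m k = mat m m (\<lambda>(i, j). (L ^\<^sub>m k) $$ (z, j))"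
      by (intro eq_matI) auto
    then have "L * L ^\<^sub>m k = 0\<^sub>m m m"
      unfolding L_def using const_perm_mat[OF perm_pow] by metis
    then have "\<exists>k. L * L ^\<^sub>m k = 0\<^sub>m m m" ..
    \<comment> \<open>The exponent is lowered one by one: for a permutation matrix minus the
      identity, \<open>L (L Y) = 0\<close> implies \<open>L Y = 0\<close>.\<close>
    then have "L * L ^\<^sub>m 0 = 0\<^sub>m m m"
    proof (elim exE)
      fix k assume "L * L ^\<^sub>m k = 0\<^sub>m m m"
      then show ?thesis
      proof (induction k)
        case (Suc k)
        have "L ^\<^sub>m Suc k = L * L ^\<^sub>m k"
        proof (induction k)
          case 0
          show ?case by (simp add: carrier_matI left_mult_one_mat[of L m m] right_mult_one_mat[of L m m])
        next
          case (Suc k)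
          have "L ^\<^sub>m Suc (Suc k) = L ^\<^sub>m Suc k * L" by simp
          also have "\<dots> = L * (L ^\<^sub>m k * L)"
            unfolding Suc by (rule ring_emb_inj) (simp_all add: ring_emb_simps mult.assoc)
          finally show ?case by simp
        qed
        then have "L * (L * L ^\<^sub>m k) = 0\<^sub>m m m" using Suc.prems by simp
        then have "L * L ^\<^sub>m k = 0\<^sub>m m m"
          using unipotent_perm_mat[OF perm_pow Lc, of t k] unfolding L_def by simp
        then show ?case by (rule Suc.IH)
      qed simp
    qed
    then have "L = 0\<^sub>m m m" by (simp add: right_mult_one_mat[OF carrier_matI[of L m m]])
    have "perm_mat m (\<xi> ^^ t) = 1\<^sub>m m"
    proof (rule eq_matI)
      fix i j assume "i < dim_row (1\<^sub>m m :: int mat)" "j < dim_col (1\<^sub>m m :: int mat)"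
      then show "perm_mat m (\<xi> ^^ t) $$ (i, j) = 1\<^sub>m m $$ (i, j)"
        using arg_cong[OF \<open>L = 0\<^sub>m m m\<close>, of "\<lambda>X. X $$ (i, j)"] by (simp add: L_def)
    qed simp_all
    then show "Lcm (set \<pi>) dvd t" by (simp add: perm_pow_id_iff)
  }
  assume "Lcm (set \<pi>) dvd t"
  then have "L = 0\<^sub>m m m" unfolding L_def perm_pow_id_iff[symmetric] by (simp add: minus_r_inv_mat[of _ m m])
  then have NI0: "N * transpose_mat I = 0\<^sub>m n m" using I NI by simp
  \<comment> \<open>One factor is expanded as \<open>- I^T R(t) I K\<close>, and the other one
    annihilates \<open>I^T\<close>.\<close>
  have "N * N = - ((N * transpose_mat I) * (R t * (I * K)))"
    by (subst (2) N_def, unfold \<Phi>_pow, rule ring_emb_inj)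
      (simp_all add: ring_emb_simps ring_emb_uminus ring_emb_unit algebra_simps)
  also have "\<dots> = 0\<^sub>m n n" unfolding NI0 by (intro eq_matI) (simp_all add: carrier_matI)
  finally have "N ^\<^sub>m 2 = 0\<^sub>m n n"
    by (simp add: numeral_2_eq_2 left_mult_one_mat[OF carrier_matI[of N n n]])
  then show "nilpotent_mat n (\<Phi> ^\<^sub>m t - 1\<^sub>m n)" unfolding nilpotent_mat_def N_def ..
qed

text \<open>Every column of \<open>R t\<close> has sum \<open>t\<close>, so \<open>R t\<close>
  preserves vanishing column sums.\<close>

lemma R_I_col_sum: "j < n \<Longrightarrow> (\<Sum>u<m. (R t * I) $$ (u, j)) = 0"
proof -
  assume j: "j < n"
  have colR: "(\<Sum>u<m. R t $$ (u, v)) = int t" if v: "v < m" for v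
  proof -
    have "(\<Sum>u<m. R t $$ (u, v)) = (\<Sum>u<m. \<Sum>i<t. if u = (\<xi> ^^ i) v then 1 else 0)"
      using v by (intro sum.cong) (auto simp: R_def)
    also have "\<dots> = (\<Sum>i<t. \<Sum>u<m. if u = (\<xi> ^^ i) v then 1 else 0)"
      by (rule sum.swap)
    also have "\<dots> = (\<Sum>i<t. 1)"
      using permutes_in_image[OF perm_pow, of _ v] v by (intro sum.cong) auto
    finally show ?thesis by simp
  qed
  have "(\<Sum>u<m. (R t * I) $$ (u, j)) = (\<Sum>u<m. \<Sum>v<m. R t $$ (u, v) * I $$ (v, j))"
    using j by (simp add: scalar_prod_def atLeast0LessThan)
  also have "\<dots> = (\<Sum>v<m. (\<Sum>u<m. R t $$ (u, v)) * I $$ (v, j))"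
    by (subst sum.swap) (simp add: sum_distrib_right)
  also have "\<dots> = (\<Sum>v<m. int t * I $$ (v, j))" by (intro sum.cong) (auto simp: colR)
  also have "\<dots> = 0" using col_sum[OF j] by (simp flip: sum_distrib_left)
  finally show ?thesis .
qed

text \<open>A single orbit visits every vertex exactly once in \<open>m\<close> steps, so
  \<open>R m\<close> is the all-ones matrix, which kills the columns of \<open>I\<close>.\<close>

lemma coxeter_pow_single_orbit:
  assumes l: "length \<pi> = 1"
  shows "\<Phi> ^\<^sub>m m = 1\<^sub>m n"
proof -
  have single: "orbit \<xi> v = {..<m}" if v: "v < m" for v
  proof -
    note p = permutes_permutation[OF perm]
    have "card (orbit \<xi> ` {..<m}) = 1" using l by (simp add: length_orbit_partition)
    then obtain A where A: "orbit \<xi> ` {..<m} = {A}" by (auto simp: card_1_singleton_iff)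
    have "u \<in> orbit \<xi> v" if "u < m" for u
    proof -
      have "orbit \<xi> u \<in> {A}" "orbit \<xi> v \<in> {A}" unfolding A[symmetric] using that v by simp_all
      then show ?thesis using permutation_self_in_orbit[OF p, of u] by simp
    qed
    then show ?thesis using orbit_permutes_subset[OF perm v] by auto
  qed
  have "R m = mat m m (\<lambda>(i, j). 1)"
  proof (rule eq_matI)
    fix u v assume "u < dim_row (mat m m (\<lambda>(i, j). 1 :: int))" "v < dim_col (mat m m (\<lambda>(i, j). 1 :: int))"
    then have uv: "u < m" "v < m" by auto
    note p = permutes_permutation[OF perm]
    have inj: "inj_on (\<lambda>i. (\<xi> ^^ i) v) {..<m}"
      using funpow_eq_iff_mod_card_orbit[OF p, of _ v] single[OF uv(2)] by (auto intro!: inj_onI)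
    have "(\<lambda>i. (\<xi> ^^ i) v) ` {..<m} \<subseteq> {..<m}" using permutes_in_image[OF perm_pow, of _ v] uv by auto
    then have img: "(\<lambda>i. (\<xi> ^^ i) v) ` {..<m} = {..<m}" using inj by (intro endo_inj_surj) auto
    have "R m $$ (u, v) = (\<Sum>i<m. if u = (\<xi> ^^ i) v then 1 else 0)" using uv by (simp add: R_def)
    also have "\<dots> = (\<Sum>w\<in>(\<lambda>i. (\<xi> ^^ i) v) ` {..<m}. if u = w then 1 else 0)"
      by (subst sum.reindex[OF inj]) simp
    also have "\<dots> = 1" unfolding img using uv by simp
    finally show "R m $$ (u, v) = mat m m (\<lambda>(i, j). 1) $$ (u, v)" using uv by simp
  qed simp_all
  then have "R m * I = 0\<^sub>m m n"
    by (intro eq_matI) (auto simp: scalar_prod_def atLeast0LessThan col_sum)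
  then have RI: "ring_emb (R m) * ring_emb I = 0" using ring_emb_mult[of "R m" I] by (simp add: ring_emb_zero)
  show ?thesis unfolding \<Phi>_pow
    by (rule ring_emb_inj) (simp_all add: ring_emb_simps mult_eq_assoc[OF RI])
qed

text \<open>\<open>\<Phi>^t = 1\<close> gives \<open>I^T R(t) I = 0\<close>. The columns of
  \<open>R(t) I\<close> are then constant with sum 0, so they vanish, and row \<open>z\<close> of
  \<open>R(t)\<close> is constant. As step 0 already counts at the root, this row has no zero entry:
  every vertex reaches the root.\<close>

lemma coxeter_pow_imp_single_orbit:
  assumes t: "0 < t" and e: "\<Phi> ^\<^sub>m t = 1\<^sub>m n"
  shows "length \<pi> = 1"
proof -
  have "transpose_mat I * (R t * I) = (1\<^sub>m n - \<Phi> ^\<^sub>m t) * G"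
  proof -
    have KG: "ring_emb K * ring_emb G = ring_emb (1\<^sub>m n)" using GK(2) by (simp flip: ring_emb_mult)
    show ?thesis unfolding \<Phi>_pow
      by (rule ring_emb_inj) (simp_all add: ring_emb_simps ring_emb_unit KG algebra_simps)
  qed
  also have "\<dots> = 0\<^sub>m n n" unfolding e by (simp add: minus_r_inv_mat[of _ n n] left_mult_zero_mat[OF G])
  finally have z0: "transpose_mat I * (R t * I) = 0\<^sub>m n n" .
  have RIc: "R t * I \<in> carrier_mat m n" by (rule carrier_matI) simp_all
  have "(R t * I) $$ (u, j) = 0" if "u < m" "j < n" for u j
  proof -
    have c: "(R t * I) $$ (i, j) = (R t * I) $$ (z, j)" if "i < m" for i
      using transpose_I_kernel[OF RIc z0] that \<open>j < n\<close> by blast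
    then have "(\<Sum>i<m. (R t * I) $$ (i, j)) = int m * (R t * I) $$ (z, j)"
      by (simp del: index_mult_mat(1))
    then have "(R t * I) $$ (z, j) = 0" using R_I_col_sum[OF that(2), of t] z by simp
    then show ?thesis using c that by simp
  qed
  then have RI: "R t * I = 0\<^sub>m m n" by (intro eq_matI) auto
  have "R t * (I * S) = (R t * I) * S"
    by (rule ring_emb_inj) (simp_all add: ring_emb_simps mult.assoc)
  then have RIS: "R t * (I * S) = 0\<^sub>m m m" unfolding RI using S by simp
  have same: "R t $$ (z, v) = R t $$ (z, z)" if v: "v < m" for v
  proof -
    have "0 = (R t * (I * S)) $$ (z, v)" using RIS z v by simp
    also have "\<dots> = (\<Sum>l<m. R t $$ (z, l) * ((if l = v then 1 else 0) - (if l = z then 1 else 0)))"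
      unfolding IS using z v by (simp add: scalar_prod_def atLeast0LessThan)
    also have "\<dots> = (\<Sum>l<m. (if l = v then R t $$ (z, l) else 0) - (if l = z then R t $$ (z, l) else 0))"
      by (intro sum.cong) auto
    also have "\<dots> = R t $$ (z, v) - R t $$ (z, z)" using z v by (simp add: sum_subtractf)
    finally show ?thesis by simp
  qed
  have "R t $$ (z, z) \<noteq> 0"
  proof
    assume "R t $$ (z, z) = 0"
    then have "(\<Sum>i<t. if z = (\<xi> ^^ i) z then 1 else 0 :: int) = 0" using z by (simp add: R_def)
    then have "\<forall>i\<in>{..<t}. (if z = (\<xi> ^^ i) z then 1 else 0 :: int) = 0"
      by (subst (asm) sum_nonneg_eq_0_iff) auto
    then show False using t by (auto dest: bspec[of _ _ 0])
  qed
  then have nz: "R t $$ (z, v) \<noteq> 0" if "v < m" for v using same[OF that] by simp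
  note p = permutes_permutation[OF perm]
  have sm: "orbit \<xi> v = orbit \<xi> z" if v: "v < m" for v
  proof -
    have "\<exists>i. z = (\<xi> ^^ i) v"
    proof (rule ccontr)
      assume "\<not> ?thesis"
      then have "R t $$ (z, v) = 0" using z v by (simp add: R_def)
      with nz[OF v] show False by simp
    qed
    then have "z \<in> orbit \<xi> v"
      using funpow_in_orbit[OF permutation_self_in_orbit[OF p, of v]] by auto
    then show ?thesis using orbit_same[OF p] by metis
  qed
  have "orbit \<xi> ` {..<m} = (\<lambda>_. orbit \<xi> z) ` {..<m}"
    by (rule image_cong[OF refl], rule sm, simp)
  also have "\<dots> = {orbit \<xi> z}" using z by auto
  finally have "orbit \<xi> ` {..<m} = {orbit \<xi> z}" .
  then show ?thesis by (simp add: length_orbit_partition)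
qed

lemma Lcm_pos: "0 < Lcm (set \<pi>)"
proof -
  have "0 \<notin> set \<pi>" using orbit_partition_Part[OF perm] by (auto simp: Part_def)
  show ?thesis
  proof (rule gr0I)
    assume "Lcm (set \<pi>) = 0"
    then have "0 \<in> set \<pi>" by (subst (asm) Lcm_0_iff) auto
    with \<open>0 \<notin> set \<pi>\<close> show False ..
  qed
qed

lemma coxeter_pow_dvd: "\<Phi> ^\<^sub>m t = 1\<^sub>m n \<Longrightarrow> Lcm (set \<pi>) dvd t"
proof -
  assume "\<Phi> ^\<^sub>m t = 1\<^sub>m n"
  then have "(\<Phi> ^\<^sub>m t - 1\<^sub>m n) ^\<^sub>m 1 = 0\<^sub>m n n"
    by (simp add: minus_r_inv_mat[of _ n n])
  then show ?thesis unfolding nilpotent_iff[symmetric] nilpotent_mat_def ..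
qed

theorem coxeter_number_eq:
  "(INF t \<in> {t. 0 < t \<and> \<Phi> ^\<^sub>m t = 1\<^sub>m n}. enat t) = (if length \<pi> = 1 then enat (\<pi> ! 0) else \<infinity>)"
proof (cases "length \<pi> = 1")
  case True
  then obtain k where k: "\<pi> = [k]" by (auto simp: length_Suc_conv)
  have km: "k = m" using orbit_partition_Part[OF perm] unfolding k by (simp add: Part_def)
  have "(INF t \<in> {t. 0 < t \<and> \<Phi> ^\<^sub>m t = 1\<^sub>m n}. enat t) = enat m"
  proof (rule antisym)
    show "(INF t \<in> {t. 0 < t \<and> \<Phi> ^\<^sub>m t = 1\<^sub>m n}. enat t) \<le> enat m"
      by (rule INF_lower) (use z coxeter_pow_single_orbit[OF True] in auto)
    show "enat m \<le> (INF t \<in> {t. 0 < t \<and> \<Phi> ^\<^sub>m t = 1\<^sub>m n}. enat t)"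
    proof (rule INF_greatest)
      fix t assume "t \<in> {t. 0 < t \<and> \<Phi> ^\<^sub>m t = 1\<^sub>m n}"
      then show "enat m \<le> enat t" using coxeter_pow_dvd[of t] by (simp add: k km dvd_imp_le)
    qed
  qed
  then show ?thesis by (simp add: k km)
next
  case False
  then have e: "{t. 0 < t \<and> \<Phi> ^\<^sub>m t = 1\<^sub>m n} = {}" using coxeter_pow_imp_single_orbit by blast
  show ?thesis unfolding e using False by (simp add: top_enat_def)
qed

theorem reduced_coxeter_number_eq:
  "(INF t \<in> {t. 0 < t \<and> nilpotent_mat n (\<Phi> ^\<^sub>m t - 1\<^sub>m n)}. enat t) = enat (Lcm (set \<pi>))"
  unfolding nilpotent_iff
proof (rule antisym)
  show "(INF t \<in> {t. 0 < t \<and> Lcm (set \<pi>) dvd t}. enat t) \<le> enat (Lcm (set \<pi>))"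
    by (rule INF_lower) (use Lcm_pos in auto)
  show "enat (Lcm (set \<pi>)) \<le> (INF t \<in> {t. 0 < t \<and> Lcm (set \<pi>) dvd t}. enat t)"
    by (rule INF_greatest) (auto intro: dvd_imp_le)
qed

end

section \<open>Multiplicities of the eigenvalue 1\<close>

text \<open>The cofactor of the linear factor is a geometric sum, with value \<open>k\<close> at
  1.\<close>

lemma order_monom_minus_one:
  assumes "0 < k"
  shows "Polynomial.order 1 (monom 1 k - 1 :: complex poly) = 1"
proof -
  have "monom 1 k - 1 = [:0, 1:] ^ k - (1 :: complex poly)" by (simp add: monom_altdef)
  also have "\<dots> = ([:0, 1:] - 1) * (\<Sum>i<k. [:0, 1:] ^ i)" by (rule power_diff_1_eq)
  also have "[:0, 1:] - 1 = [:-1, 1 :: complex:]" by (simp add: one_pCons)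
  finally have e: "monom 1 k - 1 = [:-1, 1 :: complex:] * (\<Sum>i<k. [:0, 1:] ^ i)" .
  define q where "q = (\<Sum>i<k. [:0, 1 :: complex:] ^ i)"
  have p1: "poly q 1 = of_nat k" by (simp add: q_def poly_sum)
  then have nz: "q \<noteq> 0" using assms by auto
  have "Polynomial.order 1 q = 0"
    using p1 assms by (intro order_0I) simp
  moreover have "Polynomial.order 1 [:-1, 1 :: complex:] = 1"
    using order_power_n_n[of "1 :: complex" 1] by simp
  moreover have "Polynomial.order 1 ([:-1, 1:] * q) = Polynomial.order 1 [:-1, 1 :: complex:] + Polynomial.order 1 q"
    by (rule order_mult) (use nz in \<open>simp only: mult_eq_0_iff, simp\<close>)
  ultimately show ?thesis unfolding e q_def[symmetric] by simp
qed

lemma order_prod_monom_minus_one: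
  assumes "\<forall>k\<in>set \<pi>. 0 < k"
  shows "(\<Prod>k\<leftarrow>\<pi>. monom 1 k - 1 :: complex poly) \<noteq> 0 \<and>
    Polynomial.order 1 (\<Prod>k\<leftarrow>\<pi>. monom 1 k - 1 :: complex poly) = length \<pi>"
  using assms
proof (induction \<pi>)
  case (Cons k \<pi>)
  have "monom 1 k - 1 \<noteq> (0 :: complex poly)"
    using order_monom_minus_one[of k] Cons.prems by (auto dest: arg_cong[of _ _ "\<lambda>p. coeff p k"])
  with Cons show ?case by (simp add: order_mult order_monom_minus_one)
qed simp

lemma of_int_poly_prod_monom:
  "(of_int_poly (\<Prod>k\<leftarrow>\<pi>. monom 1 k - 1) :: complex poly) = (\<Prod>k\<leftarrow>\<pi>. monom 1 k - 1)"
  by (induction \<pi>) (simp_all add: of_int_poly_hom.hom_mult of_int_poly_hom.hom_minus map_poly_monom)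

lemma of_int_poly_linear_power:
  "(of_int_poly ([:- a, 1:] ^ k) :: complex poly) = [:- of_int a, 1:] ^ k"
  by (simp add: of_int_poly_hom.hom_power)

text \<open>All positive powers of an idempotent have the same kernel, so the kernel is the
  generalized eigenspace for 0, whose dimension is the algebraic multiplicity.\<close>

lemma kernel_dim_idempotent:
  fixes E :: "complex mat"
  assumes E: "E \<in> carrier_mat n n" and idem: "E * E = E"
  shows "kernel_dim E = Polynomial.order 0 (char_poly E)"
proof -
  obtain as where "char_poly E = (\<Prod>a\<leftarrow>as. [:- a, 1:])"
    using char_poly_factorized[OF E] by blast
  then obtain n_as where jnf: "jordan_nf E n_as" using jordan_nf_exists[OF E] by blast
  have cm: "char_matrix E 0 = E" using E by (intro eq_matI) (auto simp: char_matrix_def)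
  have pow: "E ^\<^sub>m Suc k = E" for k
  proof (induction k)
    case (Suc k)
    then show ?case by (simp add: idem)
  qed (use E in simp)
  let ?ns = "map fst (filter (\<lambda>(n, e). e = 0) n_as)"
  have dim: "kernel_dim E = (\<Sum>n\<leftarrow>?ns. min (Suc k) n)" for k
    using dim_gen_eigenspace[OF jnf, of 0 "Suc k"] unfolding dim_gen_eigenspace_def cm pow .
  \<comment> \<open>The exponent is chosen beyond the size of every Jordan block.\<close>
  have "kernel_dim E = (\<Sum>n\<leftarrow>?ns. min (Suc (sum_list ?ns)) n)" by (rule dim)
  also have "map (min (Suc (sum_list ?ns))) ?ns = ?ns"
  proof (rule map_idI)
    fix x assume "x \<in> set ?ns"
    then have "x \<le> sum_list ?ns" by (rule member_le_sum_list) simp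
    then show "min (Suc (sum_list ?ns)) x = x" by linarith
  qed
  also have "sum_list ?ns = Polynomial.order 0 (char_poly E)"
    unfolding jordan_nf_order[OF jnf] by (simp add: case_prod_unfold)
  finally show ?thesis .
qed

context coxeter_datum
begin

abbreviation "cmat \<equiv> map_mat (of_int :: int \<Rightarrow> complex)"

theorem alg_mult_\<Phi>: "alg_mult \<Phi> 1 + m = length \<pi> + n"
proof -
  have pos: "\<forall>k\<in>set \<pi>. 0 < k" using orbit_partition_Part[OF perm] by (auto simp: Part_def)
  have lin: "of_int_poly ([:-1, 1:] ^ k) = ([:-1, 1:] ^ k :: complex poly)" for k
    using of_int_poly_linear_power[of 1 k] by simp
  have "char_poly (cmat \<Phi>) * [:-1, 1:] ^ m = (\<Prod>k\<leftarrow>\<pi>. monom 1 k - 1) * [:-1, 1:] ^ n"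
    using arg_cong[OF coxeter_poly, of "of_int_poly :: int poly \<Rightarrow> complex poly"]
    unfolding of_int_hom.char_poly_hom[OF \<Phi>_carrier] of_int_poly_hom.hom_mult lin of_int_poly_prod_monom .
  then have "Polynomial.order 1 (char_poly (cmat \<Phi>) * [:-1, 1:] ^ m) =
      Polynomial.order 1 ((\<Prod>k\<leftarrow>\<pi>. monom 1 k - 1) * [:-1, 1 :: complex:] ^ n)" by simp
  moreover have "char_poly (cmat \<Phi>) \<noteq> 0"
    using degree_monic_char_poly[of "cmat \<Phi>" n] \<Phi>_carrier by auto
  ultimately show ?thesis
    using order_prod_monom_minus_one[OF pos] order_power_n_n[of "1::complex"]
    by (simp add: order_mult alg_mult_def)
qed

text \<open>\<open>S I\<close> and \<open>I S\<close> have the same characteristic polynomial up to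
  powers of the variable. With the root at 0 the matrix \<open>I S\<close> is upper triangular with
  diagonal 0, 1, ..., 1.\<close>

lemma order_section:
  assumes z0: "z = 0"
  shows "Polynomial.order 0 (char_poly (cmat (S * I))) + m = n + 1"
proof -
  have SI: "S * I \<in> carrier_mat n n" and ISc: "I * S \<in> carrier_mat m m" using S I by auto
  have ut: "upper_triangular (I * S)" unfolding IS z0 by (auto simp: upper_triangular_def)
  have "diag_mat (I * S) = 0 # replicate (m - 1) 1"
    unfolding IS z0 using z by (intro nth_equalityI) (auto simp: diag_mat_def nth_Cons split: nat.splits)
  then have cIS: "char_poly (I * S) = [:0, 1:] * [:-1, 1:] ^ (m - 1)"
    using char_poly_upper_triangular[OF ISc ut] by simp
  have neg: "0 \<cdot>\<^sub>m 1\<^sub>m n - (- S) * I = S * I" "0 \<cdot>\<^sub>m 1\<^sub>m m - I * (- S) = I * S"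
    using S I by (auto intro!: eq_matI)
  have "char_poly (S * I) * [:0, 1:] ^ m = char_poly (I * S) * [:0, 1:] ^ n"
    using char_poly_mult_comm[of "- S" n m I 0] S I unfolding neg by simp
  then have e: "char_poly (S * I) * [:0, 1:] ^ m = [:-1, 1:] ^ (m - 1) * [:0, 1:] ^ Suc n"
    unfolding cIS by (simp add: mult_ac)
  have lin: "of_int_poly ([:0, 1:] ^ k) = ([:0, 1:] ^ k :: complex poly)"
    "of_int_poly ([:-1, 1:] ^ k) = ([:-1, 1:] ^ k :: complex poly)" for k
    using of_int_poly_linear_power[of 0 k] of_int_poly_linear_power[of 1 k] by simp_all
  have "char_poly (cmat (S * I)) * [:0, 1:] ^ m = [:-1, 1:] ^ (m - 1) * [:0, 1:] ^ Suc n"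
    using arg_cong[OF e, of "of_int_poly :: int poly \<Rightarrow> complex poly"]
    unfolding of_int_hom.char_poly_hom[OF SI] of_int_poly_hom.hom_mult lin .
  then have "Polynomial.order 0 (char_poly (cmat (S * I)) * [:0, 1:] ^ m) =
      Polynomial.order 0 ([:-1, 1 :: complex:] ^ (m - 1) * [:0, 1:] ^ Suc n)" by (simp only:)
  moreover have cp: "char_poly (cmat (S * I)) \<noteq> 0"
    using degree_monic_char_poly[of "cmat (S * I)" n] SI by auto
  have "Polynomial.order 0 (char_poly (cmat (S * I)) * [:0, 1:] ^ m) =
      Polynomial.order 0 (char_poly (cmat (S * I))) + Polynomial.order 0 ([:0, 1 :: complex:] ^ m)"
    by (rule order_mult) (use cp in \<open>simp only: mult_eq_0_iff power_eq_0_iff, simp\<close>)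
  moreover have "Polynomial.order 0 ([:-1, 1 :: complex:] ^ (m - 1) * [:0, 1:] ^ Suc n) =
      Polynomial.order 0 ([:-1, 1 :: complex:] ^ (m - 1)) + Polynomial.order 0 ([:0, 1 :: complex:] ^ Suc n)"
    by (rule order_mult) (simp only: mult_eq_0_iff power_eq_0_iff, simp)
  moreover have "Polynomial.order 0 ([:-1, 1 :: complex:] ^ (m - 1)) = 0"
    by (rule order_0I) simp
  moreover have "Polynomial.order 0 ([:0, 1 :: complex:] ^ m) = m"
    "Polynomial.order 0 ([:0, 1 :: complex:] ^ Suc n) = Suc n"
    using order_power_n_n[of "0::complex" m] order_power_n_n[of "0::complex" "Suc n"] by simp_all
  ultimately show ?thesis by linarith
qed

text \<open>Conjugation by \<open>G\<close> relates \<Phi> to \<open>1 - J I\<close>, so the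
  eigenspace becomes the kernel of \<open>J I\<close>. It equals the kernel of the idempotent
  \<open>S I\<close>, whose dimension can be read off a characteristic polynomial.\<close>

theorem geom_mult_\<Phi>:
  assumes z0: "z = 0"
  shows "geom_mult \<Phi> 1 + m = n + 1"
proof -
  define J where "J = K * transpose_mat I"
  have J: "J \<in> carrier_mat n m" using K I by (simp add: J_def)
  note [simp] = carrier_matD[OF J]
  have SI: "S * I \<in> carrier_mat n n" and JI: "J * I \<in> carrier_mat n n" using S I J by auto
  have hom: "cmat (A * B) = cmat A * cmat B" if "A \<in> carrier_mat r k" "B \<in> carrier_mat k c" for A B r k c
    using of_int_hom.mat_hom_mult[OF that] .
  define \<Psi> where "\<Psi> = 1\<^sub>m n - J * I"
  have \<Psi>: "\<Psi> \<in> carrier_mat n n" by (rule carrier_matI) (simp_all add: \<Psi>_def)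
  have "\<Phi> = G * \<Psi> * K"
  proof -
    have GKe: "ring_emb G * ring_emb K = ring_emb (1\<^sub>m n)" "ring_emb G * (ring_emb K * x) = ring_emb (1\<^sub>m n) * x" for x
      using ring_emb_mult_eq[OF GK(1)] mult_eq_assoc[OF ring_emb_mult_eq[OF GK(1)]] by simp_all
    show ?thesis unfolding \<Phi>_eq \<Psi>_def J_def
      by (rule ring_emb_inj) (simp_all add: ring_emb_simps ring_emb_unit GKe algebra_simps)
  qed
  then have conj: "cmat \<Phi> = cmat G * cmat \<Psi> * cmat K"
    using G K \<Psi> by (simp add: hom[of _ n n _ n])
  have inv: "cmat G * cmat K = 1\<^sub>m n" "cmat K * cmat G = 1\<^sub>m n"
    using GK hom[OF G K] hom[OF K G] by (simp_all add: of_int_hom.mat_hom_one)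
  have "similar_mat_wit (cmat \<Phi>) (cmat \<Psi>) (cmat G) (cmat K)"
    by (rule similar_mat_witI[OF inv conj]) (use G K \<Psi> \<Phi>_carrier in simp_all)
  then have sim: "similar_mat (cmat \<Phi>) (cmat \<Psi>)" unfolding similar_mat_def by blast
  have gd: "kernel_dim (char_matrix A ev) = dim_gen_eigenspace A ev 1"
    if "A \<in> carrier_mat n n" for A :: "complex mat" and ev
    using that by (simp add: dim_gen_eigenspace_def left_mult_one_mat[OF char_matrix_closed])
  have "geom_mult \<Phi> 1 = kernel_dim (char_matrix (cmat \<Psi>) 1)"
    using gd[of "cmat \<Phi>" 1] gd[of "cmat \<Psi>" 1] \<Phi>_carrier \<Psi>
    by (simp add: geom_mult_def dim_gen_eigenspace_similar[OF sim])
  also have "char_matrix (cmat \<Psi>) 1 = - cmat (J * I)"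
    using JI by (intro eq_matI) (auto simp: char_matrix_def \<Psi>_def)
  also have "kernel_dim (- cmat (J * I)) = kernel_dim (cmat (S * I))"
  proof -
    have "mat_kernel (- cmat (J * I)) = mat_kernel (cmat (S * I))"
    proof (intro equalityI subsetI)
      fix x assume "x \<in> mat_kernel (cmat (S * I))"
      then have x: "x \<in> carrier_vec n" and e: "cmat (S * I) *\<^sub>v x = 0\<^sub>v n"
        using SI by (auto simp: mat_kernel_def)
      have "J * I = J * (I * S * I)" unfolding section_I ..
      also have "\<dots> = (J * I) * (S * I)"
        by (rule ring_emb_inj) (simp_all add: ring_emb_simps mult.assoc)
      finally have "cmat (J * I) = cmat (J * I) * cmat (S * I)" using hom[OF JI SI] by simp
      then have "cmat (J * I) *\<^sub>v x = (cmat (J * I) * cmat (S * I)) *\<^sub>v x" by simp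
      also have "\<dots> = cmat (J * I) *\<^sub>v (cmat (S * I) *\<^sub>v x)"
        using JI SI x by (intro assoc_mult_mat_vec) auto
      also have "\<dots> = 0\<^sub>v n" unfolding e using JI by auto
      finally have "cmat (J * I) *\<^sub>v x = 0\<^sub>v n" .
      then show "x \<in> mat_kernel (- cmat (J * I))"
        using x JI by (auto simp: mat_kernel_def)
    next
      fix x assume "x \<in> mat_kernel (- cmat (J * I))"
      then have x: "x \<in> carrier_vec n" and neg: "- cmat (J * I) *\<^sub>v x = 0\<^sub>v n"
        using JI by (auto simp: mat_kernel_def)
      have e: "cmat (J * I) *\<^sub>v x = 0\<^sub>v n"
      proof (rule eq_vecI)
        fix i assume "i < dim_vec (0\<^sub>v n :: complex vec)"
        then have i: "i < n" by simp
        have "(- cmat (J * I) *\<^sub>v x) $ i = - ((cmat (J * I) *\<^sub>v x) $ i)"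
          using i x by (simp add: scalar_prod_def sum_negf)
        then show "(cmat (J * I) *\<^sub>v x) $ i = 0\<^sub>v n $ i" unfolding neg using i by simp
      qed simp
      define w where "w = cmat I *\<^sub>v x"
      have w: "w \<in> carrier_vec m" using I x by (auto simp: w_def)
      have wi: "w $ i = (\<Sum>j<n. of_int (I $$ (i, j)) * x $ j)" if "i < m" for i
        using that x by (simp add: w_def scalar_prod_def atLeast0LessThan)
      \<comment> \<open>Multiplication by \<open>S^T G\<close> turns \<open>J I x = 0\<close> into
        the statement that \<open>w = I x\<close> is constant; its entries sum to 0, so it
        vanishes.\<close>
      define W where "W = transpose_mat S * (G * (J * I))"
      have Wc: "W \<in> carrier_mat m n" "transpose_mat S * G \<in> carrier_mat m n" using S G JI by (auto simp: W_def)
      have "cmat W *\<^sub>v x = (cmat (transpose_mat S * G) * cmat (J * I)) *\<^sub>v x"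
        unfolding W_def using hom[OF Wc(2) JI] S G JI by (simp add: assoc_mult_mat[of _ m n _ n _ n])
      also have "\<dots> = cmat (transpose_mat S * G) *\<^sub>v (cmat (J * I) *\<^sub>v x)"
        using Wc JI x by (intro assoc_mult_mat_vec) auto
      also have "\<dots> = 0\<^sub>v m" unfolding e by (intro eq_vecI) (simp_all add: scalar_prod_def)
      finally have W0: "cmat W *\<^sub>v x = 0\<^sub>v m" .
      have GKe: "ring_emb G * (ring_emb K * x) = ring_emb (1\<^sub>m n) * x" for x
        by (rule mult_eq_assoc[OF ring_emb_mult_eq[OF GK(1)]]) simp
      have W_eq: "W = transpose_mat (I * S) * I"
        unfolding W_def J_def
        by (rule ring_emb_inj) (simp_all add: ring_emb_simps ring_emb_unit swap.star_simps mult.assoc GKe)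
      have Wij: "W $$ (i, j) = I $$ (i, j) - I $$ (z, j)" if "i < m" "j < n" for i j
      proof -
        have "W $$ (i, j) = (\<Sum>l<m. ((if l = i then 1 else 0) - (if l = z then 1 else 0)) * I $$ (l, j))"
          unfolding W_eq IS using that by (simp add: scalar_prod_def atLeast0LessThan)
        also have "\<dots> = (\<Sum>l<m. (if l = i then I $$ (l, j) else 0) - (if l = z then I $$ (l, j) else 0))"
          by (intro sum.cong) auto
        finally show ?thesis using that z by (simp add: sum_subtractf)
      qed
      have wz: "w $ i = w $ z" if i: "i < m" for i
      proof -
        have "0 = (cmat W *\<^sub>v x) $ i" using i by (simp add: W0)
        also have "\<dots> = (\<Sum>j<n. of_int (W $$ (i, j)) * x $ j)"
          using i x Wc by (simp add: scalar_prod_def atLeast0LessThan)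
        also have "\<dots> = w $ i - w $ z"
          using i z by (simp add: wi Wij left_diff_distrib sum_subtractf)
        finally show ?thesis by simp
      qed
      have "(\<Sum>i<m. w $ i) = (\<Sum>j<n. of_int (\<Sum>i<m. I $$ (i, j)) * x $ j)"
        by (simp add: wi sum_distrib_right) (rule sum.swap)
      also have "\<dots> = 0" by (simp add: col_sum)
      finally have "of_nat m * w $ z = 0" using wz by simp
      then have "w $ z = 0" using z by simp
      then have w0: "w = 0\<^sub>v m" using w wz by (intro eq_vecI) auto
      have Sw: "cmat (S * I) *\<^sub>v x = cmat S *\<^sub>v w"
        unfolding hom[OF S I] w_def using S I x by (intro assoc_mult_mat_vec) auto
      have "cmat (S * I) *\<^sub>v x = 0\<^sub>v n"
        unfolding Sw w0 by (intro eq_vecI) (simp_all add: scalar_prod_def)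
      then show "x \<in> mat_kernel (cmat (S * I))" using x SI by (auto simp: mat_kernel_def)
    qed
    then show ?thesis using SI JI by (simp add: kernel_dim_def)
  qed
  also have "\<dots> = Polynomial.order 0 (char_poly (cmat (S * I)))"
  proof (rule kernel_dim_idempotent)
    show "cmat (S * I) \<in> carrier_mat n n" using SI by simp
    have "(S * I) * (S * I) = S * (I * S * I)"
      by (rule ring_emb_inj) (simp_all add: ring_emb_simps mult.assoc)
    then show "cmat (S * I) * cmat (S * I) = cmat (S * I)"
      using hom[OF SI SI] by (simp add: section_I)
  qed
  finally show ?thesis using order_section[OF z0] by simp
qed

end

section \<open>Ranks of subgroups\<close>

lemma lin_indep_iff:
  assumes fin: "finite A" and A: "A \<subseteq> carrier_vec n"
  shows "\<not> module.lin_dep class_ring (module_vec TYPE(int) n) A \<longleftrightarrow>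
    (\<forall>a. (\<forall>i<n. (\<Sum>x\<in>A. a x * x $ i) = 0) \<longrightarrow> (\<forall>x\<in>A. a x = 0))"
proof -
  interpret vm: vec_module "TYPE(int)" n .
  have idx: "vm.lincomb a B $ i = (\<Sum>x\<in>B. a x * x $ i)" if "i < n" "B \<subseteq> A" for a B i
  proof -
    have B: "B \<subseteq> carrier_vec n" using that A by auto
    have "vm.lincomb a B $ i = (\<Sum>x\<in>B. (a x \<cdot>\<^sub>v x) $ i)"
      unfolding vm.lincomb_def by (rule vm.finsum_index) (use that B in auto)
    also have "\<dots> = (\<Sum>x\<in>B. a x * x $ i)"
      using that B by (intro sum.cong) auto
    finally show ?thesis .
  qed
  have carr: "vm.lincomb a B \<in> carrier_vec n" if "B \<subseteq> A" for a B
    using that A by (intro vm.lincomb_closed) auto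
  have zero: "vm.lincomb a B = 0\<^sub>v n \<longleftrightarrow> (\<forall>i<n. (\<Sum>x\<in>B. a x * x $ i) = 0)" if "B \<subseteq> A" for a B
  proof
    assume "vm.lincomb a B = 0\<^sub>v n"
    then show "\<forall>i<n. (\<Sum>x\<in>B. a x * x $ i) = 0" using idx[OF _ that] by (metis index_zero_vec(1))
  next
    assume "\<forall>i<n. (\<Sum>x\<in>B. a x * x $ i) = 0"
    then show "vm.lincomb a B = 0\<^sub>v n" using carr[OF that, of a] idx[OF _ that] by (intro eq_vecI) auto
  qed
  show ?thesis
  proof
    assume ind: "\<not> vm.lin_dep A"
    show "\<forall>a. (\<forall>i<n. (\<Sum>x\<in>A. a x * x $ i) = 0) \<longrightarrow> (\<forall>x\<in>A. a x = 0)"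
    proof (intro allI impI ballI)
      fix a x assume "\<forall>i<n. (\<Sum>x\<in>A. a x * x $ i) = 0" and x: "x \<in> A"
      then have "vm.lincomb a A = 0\<^sub>v n" using zero by simp
      with ind x fin show "a x = 0" unfolding vm.lin_dep_def by blast
    qed
  next
    assume h: "\<forall>a. (\<forall>i<n. (\<Sum>x\<in>A. a x * x $ i) = 0) \<longrightarrow> (\<forall>x\<in>A. a x = 0)"
    show "\<not> vm.lin_dep A"
    proof
      assume "vm.lin_dep A"
      then obtain B a v where B: "finite B" "B \<subseteq> A" "vm.lincomb a B = 0\<^sub>v n" "v \<in> B" "a v \<noteq> 0"
        unfolding vm.lin_dep_def by blast
      define b where "b x = (if x \<in> B then a x else 0)" for x
      have "(\<Sum>x\<in>A. b x * x $ i) = 0" if "i < n" for i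
      proof -
        have "(\<Sum>x\<in>A. b x * x $ i) = (\<Sum>x\<in>B. a x * x $ i)"
          using B(2) fin by (intro sum.mono_neutral_cong_right) (auto simp: b_def)
        then show ?thesis using zero[OF B(2)] B(3) that by simp
      qed
      with h have "\<forall>x\<in>A. b x = 0" by blast
      then have "b v = 0" using B by blast
      then show False using B by (simp add: b_def)
    qed
  qed
qed

text \<open>With more than \<open>k\<close> vectors, the coefficient vectors padded by zero rows
  form a singular square matrix, and over an integral domain such a matrix has a nonzero kernel
  vector with entries in the domain.\<close>

lemma lin_indep_card_le:
  assumes fin: "finite A" and ind: "\<not> module.lin_dep class_ring (module_vec TYPE(int) n) A"
    and B: "B \<in> carrier_mat n k" and sub: "A \<subseteq> {B *\<^sub>v y | y. y \<in> carrier_vec k}"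
  shows "card A \<le> k"
proof (rule ccontr)
  assume "\<not> card A \<le> k"
  define p where "p = card A"
  then have kp: "k < p" using \<open>\<not> card A \<le> k\<close> by simp
  have Ac: "A \<subseteq> carrier_vec n" using sub B by auto
  obtain s where s: "bij_betw s {..<p} A"
    using ex_bij_betw_nat_finite[OF fin] by (auto simp: p_def atLeast0LessThan)
  have "\<forall>j. \<exists>y. j < p \<longrightarrow> y \<in> carrier_vec k \<and> s j = B *\<^sub>v y"
    using sub s by (fastforce simp: bij_betw_def)
  then obtain y where y: "\<And>j. j < p \<Longrightarrow> y j \<in> carrier_vec k" "\<And>j. j < p \<Longrightarrow> s j = B *\<^sub>v y j" by metis
  define Z where "Z = mat p p (\<lambda>(i, j). if i < k then y j $ i else 0)"
  have Z: "Z \<in> carrier_mat p p" by (simp add: Z_def)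
  have "transpose_mat Z *\<^sub>v unit_vec p (p - 1) = 0\<^sub>v p"
    using kp by (subst mult_mat_unit_vec[of _ p]) (auto simp: Z_def intro!: eq_vecI)
  moreover have "unit_vec p (p - 1) \<noteq> (0\<^sub>v p :: int vec)"
    using kp by (auto dest: arg_cong[of _ _ "\<lambda>v. v $ (p - 1)"])
  ultimately have "det (transpose_mat Z) = 0"
    using det_0_iff_vec_prod_zero[of "transpose_mat Z" p] Z by (metis transpose_carrier_mat unit_vec_carrier)
  then have "det Z = 0" using det_transpose[OF Z] by simp
  then obtain v where v: "v \<in> carrier_vec p" "v \<noteq> 0\<^sub>v p" "Z *\<^sub>v v = 0\<^sub>v p"
    using det_0_iff_vec_prod_zero[OF Z] by blast
  have rel: "(\<Sum>j<p. v $ j * y j $ i) = 0" if "i < k" for i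
  proof -
    have "(Z *\<^sub>v v) $ i = (\<Sum>j<p. y j $ i * v $ j)"
      using that kp v(1) by (simp add: Z_def scalar_prod_def atLeast0LessThan)
    then show ?thesis using v(3) that kp by (simp add: mult.commute)
  qed
  define a where "a x = v $ (the_inv_into {..<p} s x)" for x
  have as: "a (s j) = v $ j" if "j < p" for j
    using that s by (simp add: a_def bij_betw_def the_inv_into_f_f)
  have "(\<Sum>x\<in>A. a x * x $ i) = 0" if i: "i < n" for i
  proof -
    have "(\<Sum>x\<in>A. a x * x $ i) = (\<Sum>j<p. a (s j) * s j $ i)"
      using sum.reindex_bij_betw[OF s, of "\<lambda>x. a x * x $ i"] by simp
    also have "\<dots> = (\<Sum>j<p. v $ j * (\<Sum>l<k. B $$ (i, l) * y j $ l))"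
    proof (intro sum.cong refl)
      fix j assume "j \<in> {..<p}"
      then have j: "j < p" by simp
      have "dim_vec (y j) = k" using y(1)[OF j] by simp
      then have "(B *\<^sub>v y j) $ i = (\<Sum>l<k. B $$ (i, l) * y j $ l)"
        using i B by (simp add: scalar_prod_def atLeast0LessThan)
      then show "a (s j) * s j $ i = v $ j * (\<Sum>l<k. B $$ (i, l) * y j $ l)"
        using y(2)[OF j] as[OF j] by simp
    qed
    also have "\<dots> = (\<Sum>l<k. \<Sum>j<p. B $$ (i, l) * (v $ j * y j $ l))"
      by (subst sum.swap) (simp add: sum_distrib_left mult_ac)
    also have "\<dots> = 0"
      unfolding sum_distrib_left[symmetric] by (simp add: rel)
    finally show ?thesis .
  qed
  then have a0: "\<forall>x\<in>A. a x = 0" using ind unfolding lin_indep_iff[OF fin Ac] by blast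
  have "v = 0\<^sub>v p"
  proof (rule eq_vecI)
    fix j assume "j < dim_vec (0\<^sub>v p :: int vec)"
    then have "j < p" by simp
    moreover from this have "s j \<in> A" using s by (auto simp: bij_betw_def)
    ultimately show "v $ j = 0\<^sub>v p $ j" using a0 as by force
  qed (use v in simp)
  with v(2) show False ..
qed

text \<open>The left inverse \<open>C\<close> makes the columns of \<open>B\<close> independent, and
  no larger independent family fits into the image of \<open>B\<close>.\<close>

lemma int_rank_eqI:
  assumes B: "B \<in> carrier_mat n k" and C: "C \<in> carrier_mat k n" and CB: "C * B = 1\<^sub>m k"
    and L: "L = {B *\<^sub>v y | y. y \<in> carrier_vec k}"
  shows "int_rank n L = k"
  unfolding int_rank_def
proof (rule Max_eqI)
  let ?X = "{card A |A. finite A \<and> A \<subseteq> L \<and> \<not> module.lin_dep class_ring (module_vec TYPE(int) n) A}"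
  show le: "c \<le> k" if "c \<in> ?X" for c
    using that lin_indep_card_le[OF _ _ B] L by auto
  then show "finite ?X" using finite_subset[of ?X "{..k}"] by blast
  have colC: "C *\<^sub>v col B j = unit_vec k j" if "j < k" for j
  proof -
    have "C *\<^sub>v col B j = col (C * B) j" using B C that by (intro eq_vecI) auto
    then show ?thesis using that by (simp add: CB)
  qed
  have inj: "inj_on (col B) {..<k}"
  proof (rule inj_onI)
    fix i j assume "i \<in> {..<k}" "j \<in> {..<k}" "col B i = col B j"
    then have "unit_vec k i = (unit_vec k j :: int vec)" using colC by (metis lessThan_iff)
    then show "i = j" using \<open>i \<in> _\<close> by (auto dest!: arg_cong[of _ _ "\<lambda>v. v $ i"] split: if_splits)
  qed
  let ?A = "col B ` {..<k}"
  have Ac: "?A \<subseteq> carrier_vec n" using B by auto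
  have "\<not> module.lin_dep class_ring (module_vec TYPE(int) n) ?A"
    unfolding lin_indep_iff[OF finite_imageI[OF finite_lessThan] Ac]
  proof (intro allI impI ballI)
    fix a x assume h: "\<forall>i<n. (\<Sum>x\<in>?A. a x * x $ i) = 0" and "x \<in> ?A"
    then obtain j where j: "j < k" "x = col B j" by auto
    have h': "(\<Sum>l<k. B $$ (i, l) * a (col B l)) = 0" if "i < n" for i
      using h that B by (simp add: sum.reindex[OF inj] mult.commute)
    have "B *\<^sub>v vec k (\<lambda>l. a (col B l)) = 0\<^sub>v n"
      using B h' by (intro eq_vecI) (auto simp: scalar_prod_def atLeast0LessThan)
    then have "C *\<^sub>v (B *\<^sub>v vec k (\<lambda>l. a (col B l))) = 0\<^sub>v k"
      using C by (intro eq_vecI) (simp_all add: scalar_prod_def)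
    moreover have "C *\<^sub>v (B *\<^sub>v vec k (\<lambda>l. a (col B l))) = (C * B) *\<^sub>v vec k (\<lambda>l. a (col B l))"
      using B C by (intro assoc_mult_mat_vec[symmetric]) auto
    ultimately have "vec k (\<lambda>l. a (col B l)) = 0\<^sub>v k" unfolding CB by simp
    then show "a x = 0" using j by (metis index_vec index_zero_vec(1))
  qed
  moreover have "?A \<subseteq> L"
  proof
    fix x assume "x \<in> ?A"
    then obtain j where "j < k" "x = B *\<^sub>v unit_vec k j" using mult_mat_unit_vec[OF B] by auto
    then show "x \<in> L" unfolding L by (intro CollectI exI conjI) auto
  qed
  moreover have "k = card ?A" using card_image[OF inj] by simp
  ultimately show "k \<in> ?X" by (intro CollectI exI[of _ ?A] conjI finite_imageI finite_lessThan)
qed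

lemma int_rank_mono:
  assumes "L \<subseteq> L'" "L' \<subseteq> carrier_vec n"
  shows "int_rank n L \<le> int_rank n L'"
  unfolding int_rank_def
proof (rule Max_mono)
  let ?X = "\<lambda>L. {card A |A. finite A \<and> A \<subseteq> L \<and> \<not> module.lin_dep class_ring (module_vec TYPE(int) n) A}"
  show "?X L \<subseteq> ?X L'" using assms(1) by blast
  have "\<not> module.lin_dep class_ring (module_vec TYPE(int) n) {}"
    using lin_indep_iff[of "{}" n] by simp
  then show "?X L \<noteq> {}" by blast
  have "c \<le> n" if "c \<in> ?X L'" for c
  proof -
    from that obtain A where A: "c = card A" "finite A" "A \<subseteq> L'" "\<not> module.lin_dep class_ring (module_vec TYPE(int) n) A"
      by blast
    have "A \<subseteq> {1\<^sub>m n *\<^sub>v y | y. y \<in> carrier_vec n}"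
    proof
      fix x assume "x \<in> A"
      then have "x \<in> carrier_vec n" "x = 1\<^sub>m n *\<^sub>v x" using A assms by auto
      then show "x \<in> {1\<^sub>m n *\<^sub>v y | y. y \<in> carrier_vec n}" by (intro CollectI exI conjI)
    qed
    then show ?thesis using lin_indep_card_le[OF A(2,4), of "1\<^sub>m n"] A(1) by simp
  qed
  then show "finite (?X L')" using finite_subset[of "?X L'" "{..n}"] by blast
qed

context coxeter_datum
begin

lemma section_transpose_index:
  assumes A: "A \<in> carrier_mat m k" and ij: "i < m" "j < k"
  shows "(transpose_mat (I * S) * A) $$ (i, j) = A $$ (i, j) - A $$ (z, j)"
proof -
  have "(transpose_mat (I * S) * A) $$ (i, j) =
      (\<Sum>l<m. ((if l = i then 1 else 0) - (if l = z then 1 else 0)) * A $$ (l, j))"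
    unfolding IS using ij A by (simp add: scalar_prod_def atLeast0LessThan)
  also have "\<dots> = (\<Sum>l<m. (if l = i then A $$ (l, j) else 0) - (if l = z then A $$ (l, j) else 0))"
    by (intro sum.cong) auto
  finally show ?thesis using ij z by (simp add: sum_subtractf)
qed

lemma invariant_orbit:
  assumes f: "\<And>u. u < m \<Longrightarrow> f (inv \<xi> u) = f u" and u: "u < m" and w: "w \<in> orbit \<xi> u"
  shows "f w = f u"
proof -
  have f': "f (\<xi> u) = f u" if "u < m" for u
    using f[of "\<xi> u"] permutes_in_image[OF perm, of u] that by (simp add: permutes_inverses[OF perm])
  have "f ((\<xi> ^^ k) u) = f u \<and> (\<xi> ^^ k) u < m" for k
    using u permutes_in_image[OF perm] by (induction k) (auto simp: f')
  then show ?thesis using orbit_funpow[OF w] by blast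
qed

text \<open>
  The reduced radical consists of the images under \<open>G\<^sup>-\<^sup>1 I\<^sup>t\<^sup>r\<close> of the functions that are
  constant on the orbits of \<open>\<xi>\<close>, and only the constant functions are mapped to 0.
\<close>

theorem int_rank_reduced:
  "int_rank n {x \<in> carrier_vec n. I *\<^sub>v x = 0\<^sub>v m \<and>
     (\<forall>y\<in>carrier_vec n. I *\<^sub>v y = 0\<^sub>v m \<longrightarrow> y \<bullet> (G *\<^sub>v x) = 0)} = length \<pi> - 1"
    (is "int_rank n ?L = _")
proof -
  define k where "k = length \<pi> - 1"
  note p = permutes_permutation[OF perm]
  \<comment> \<open>The orbit of the root is left out because the indicators of all orbits add up to
    a constant, which \<open>J\<close> kills; this accounts for the -1 in the rank.\<close>
  define Os where "Os = orbit \<xi> ` {..<m} - {orbit \<xi> z}"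
  have "card Os = k"
    unfolding Os_def k_def length_orbit_partition using z by (subst card_Diff_singleton) auto
  then obtain o' where o': "bij_betw o' {..<k} Os"
    using ex_bij_betw_nat_finite[of Os] by (auto simp: Os_def atLeast0LessThan)
  have "\<forall>j. \<exists>v. j < k \<longrightarrow> v < m \<and> o' j = orbit \<xi> v"
  proof
    fix j
    show "\<exists>v. j < k \<longrightarrow> v < m \<and> o' j = orbit \<xi> v"
    proof (cases "j < k")
      case True
      then have "o' j \<in> Os" using o' by (auto simp: bij_betw_def)
      then show ?thesis by (auto simp: Os_def)
    qed simp
  qed
  then obtain v where v: "\<And>j. j < k \<Longrightarrow> v j < m" "\<And>j. j < k \<Longrightarrow> o' j = orbit \<xi> (v j)" by metis
  have zo: "z \<notin> o' j" if j: "j < k" for j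
  proof
    assume "z \<in> o' j"
    then have "orbit \<xi> z = o' j" using orbit_same[OF p, of z "v j"] v(2)[OF j] by simp
    moreover have "o' j \<in> Os" using o' j by (auto simp: bij_betw_def)
    ultimately show False by (simp add: Os_def)
  qed
  have vo: "v i \<in> o' j \<longleftrightarrow> i = j" if ij: "i < k" "j < k" for i j
  proof
    assume "v i \<in> o' j"
    then have "o' i = o' j" using orbit_same[OF p, of "v i" "v j"] v(2) ij by simp
    then show "i = j" using o' ij by (auto simp: bij_betw_def dest: inj_onD)
  next
    assume "i = j"
    then show "v i \<in> o' j" using v(2)[OF ij(2)] permutation_self_in_orbit[OF p, of "v i"] by simp
  qed
  define F where "F = mat m k (\<lambda>(u, j). if u \<in> o' j then 1 else 0 :: int)"
  define J where "J = K * transpose_mat I"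
  define B where "B = J * F"
  define E where "E = mat k m (\<lambda>(j, u). if u = v j then 1 else 0 :: int)"
  \<comment> \<open>\<open>S^T G\<close> undoes \<open>J\<close> up to constants, normalised to
    vanish at the root, and \<open>E\<close> evaluates at one representative per orbit; together
    they are a left inverse of \<open>B\<close>.\<close>
  define C where "C = E * (transpose_mat S * G)"
  have [simp]: "dim_row F = m" "dim_col F = k" "dim_row J = n" "dim_col J = m" "dim_row B = n" "dim_col B = k"
    "dim_row E = k" "dim_col E = m" "dim_row C = k" "dim_col C = n"
    by (simp_all add: F_def J_def B_def E_def C_def)
  have car: "F \<in> carrier_mat m k" "J \<in> carrier_mat n m" "B \<in> carrier_mat n k" "E \<in> carrier_mat k m" "C \<in> carrier_mat k n"
    by (auto intro: carrier_matI)
  have GJ: "G * J = transpose_mat I"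
  proof -
    have "G * J = (G * K) * transpose_mat I"
      unfolding J_def by (rule ring_emb_inj) (simp_all add: ring_emb_simps mult.assoc)
    then show ?thesis unfolding GK(1) using I by simp
  qed
  have IJ: "I * J = 1\<^sub>m m - perm_mat m \<xi>" unfolding J_def by (rule laplacian')
  have EF: "E * F = 1\<^sub>m k"
  proof (rule eq_matI)
    fix i j assume "i < dim_row (1\<^sub>m k :: int mat)" "j < dim_col (1\<^sub>m k :: int mat)"
    then have ij: "i < k" "j < k" by auto
    have "(E * F) $$ (i, j) = (\<Sum>u<m. E $$ (i, u) * F $$ (u, j))"
      using ij by (simp add: scalar_prod_def atLeast0LessThan)
    also have "\<dots> = (\<Sum>u<m. if u = v i then F $$ (u, j) else 0)"
      using ij by (intro sum.cong) (auto simp: E_def)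
    also have "\<dots> = 1\<^sub>m k $$ (i, j)" using v(1)[OF ij(1)] ij vo[OF ij] by (simp add: F_def)
    finally show "(E * F) $$ (i, j) = 1\<^sub>m k $$ (i, j)" .
  qed simp_all
  have SF: "transpose_mat (I * S) * F = F"
  proof (rule eq_matI)
    fix i j assume "i < dim_row F" "j < dim_col F"
    then have ij: "i < m" "j < k" by auto
    show "(transpose_mat (I * S) * F) $$ (i, j) = F $$ (i, j)"
      unfolding section_transpose_index[OF car(1) ij] using zo[OF ij(2)] ij z by (simp add: F_def)
  qed simp_all
  have CB: "C * B = 1\<^sub>m k"
  proof -
    have "C * B = E * (transpose_mat S * (G * J) * F)"
      unfolding C_def B_def by (rule ring_emb_inj) (simp_all add: ring_emb_simps mult.assoc)
    also have "\<dots> = E * (transpose_mat (I * S) * F)"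
      unfolding GJ by (rule ring_emb_inj) (simp_all add: ring_emb_simps swap.star_simps mult.assoc)
    finally show ?thesis unfolding SF EF .
  qed
  have \<rho>m: "inv \<xi> u < m" if "u < m" for u
    using permutes_in_image[OF permutes_inv[OF perm], of u] that by simp
  have DF: "(I * J) * F = 0\<^sub>m m k"
  proof (rule eq_matI)
    fix u j assume "u < dim_row (0\<^sub>m m k :: int mat)" "j < dim_col (0\<^sub>m m k :: int mat)"
    then have uj: "u < m" "j < k" by auto
    have "orbit \<xi> (inv \<xi> u) = orbit \<xi> u"
      using permutation_orbit_step[OF p, of "inv \<xi> u"] by (simp add: permutes_inverses[OF perm])
    then have "inv \<xi> u \<in> o' j \<longleftrightarrow> u \<in> o' j"
      using v(2)[OF uj(2)] orbit_same[OF p, of u "v j"] orbit_same[OF p, of "inv \<xi> u" "v j"]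
        permutation_self_in_orbit[OF p, of u] permutation_self_in_orbit[OF p, of "inv \<xi> u"] by blast
    then show "((I * J) * F) $$ (u, j) = 0\<^sub>m m k $$ (u, j)"
      unfolding IJ one_minus_perm_index[OF car(1) uj] using uj \<rho>m by (simp add: F_def)
  qed simp_all
  have "?L = {B *\<^sub>v y | y. y \<in> carrier_vec k}"
  proof (intro equalityI subsetI)
    fix x assume "x \<in> {B *\<^sub>v y | y. y \<in> carrier_vec k}"
    then obtain y where y: "y \<in> carrier_vec k" and x: "x = B *\<^sub>v y" by blast
    have "I *\<^sub>v x = (I * B) *\<^sub>v y"
      unfolding x by (rule assoc_mult_mat_vec[symmetric, OF I car(3) y])
    also have "I * B = (I * J) * F"
      unfolding B_def by (rule ring_emb_inj) (simp_all add: ring_emb_simps mult.assoc)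
    finally have Ix: "I *\<^sub>v x = 0\<^sub>v m" unfolding DF using y by (intro eq_vecI) (simp_all add: scalar_prod_def)
    have "y' \<bullet> (G *\<^sub>v x) = 0" if y': "y' \<in> carrier_vec n" "I *\<^sub>v y' = 0\<^sub>v m" for y'
    proof -
      have Fy: "F *\<^sub>v y \<in> carrier_vec m" using car(1) y by simp
      have "G *\<^sub>v x = (G * B) *\<^sub>v y"
        unfolding x by (rule assoc_mult_mat_vec[symmetric, OF G car(3) y])
      also have "G * B = (G * J) * F"
        unfolding B_def by (rule ring_emb_inj) (simp_all add: ring_emb_simps mult.assoc)
      also have "(G * J) * F *\<^sub>v y = transpose_mat I *\<^sub>v (F *\<^sub>v y)"
        unfolding GJ by (rule assoc_mult_mat_vec[OF _ car(1) y]) (use I in simp)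
      finally have "y' \<bullet> (G *\<^sub>v x) = (transpose_mat I *\<^sub>v (F *\<^sub>v y)) \<bullet> y'"
        using y'(1) I Fy by (simp add: comm_scalar_prod[of _ n])
      also have "\<dots> = (F *\<^sub>v y) \<bullet> (I *\<^sub>v y')"
        by (rule transpose_vec_mult_scalar[OF I y'(1) Fy])
      also have "\<dots> = 0" unfolding y'(2) using Fy by simp
      finally show ?thesis .
    qed
    moreover have "x \<in> carrier_vec n" using car(3) y x by simp
    ultimately show "x \<in> ?L" using Ix by simp
  next
    fix x assume x: "x \<in> ?L"
    then have xc: "x \<in> carrier_vec n" and Ix: "I *\<^sub>v x = 0\<^sub>v m"
      and orth: "\<And>y. y \<in> carrier_vec n \<Longrightarrow> I *\<^sub>v y = 0\<^sub>v m \<Longrightarrow> y \<bullet> (G *\<^sub>v x) = 0" by auto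
    define X where "X = mat n 1 (\<lambda>(i, _). x $ i)"
    have [simp]: "dim_row X = n" "dim_col X = 1" by (simp_all add: X_def)
    have colX: "col X 0 = x" using xc by (intro eq_vecI) (auto simp: X_def)
    have mv: "(A * X) $$ (i, 0) = (A *\<^sub>v x) $ i" if "A \<in> carrier_mat r n" "i < r" for A r i
      using that by (simp add: colX)
    have IX: "I * X = 0\<^sub>m m 1" using mv[OF I] Ix by (intro eq_matI) auto
    define N where "N = 1\<^sub>m n - S * I"
    have [simp]: "dim_row N = n" "dim_col N = n" by (simp_all add: N_def)
    have IN: "I * N = 0\<^sub>m m n"
    proof -
      have "I * N = I - I * S * I"
        unfolding N_def by (rule ring_emb_inj) (simp_all add: ring_emb_simps algebra_simps ring_emb_unit)
      then show ?thesis unfolding section_I by (simp add: minus_r_inv_mat[OF I])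
    qed
    have "transpose_mat N * (G * X) = 0\<^sub>m n 1"
    proof (rule eq_matI)
      fix i j assume "i < dim_row (0\<^sub>m n 1 :: int mat)" "j < dim_col (0\<^sub>m n 1 :: int mat)"
      then have i: "i < n" "j = 0" by auto
      have "I *\<^sub>v col N i = col (I * N) i" using i by (intro eq_vecI) simp_all
      then have "I *\<^sub>v col N i = 0\<^sub>v m" unfolding IN using i by simp
      then have "col N i \<bullet> (G *\<^sub>v x) = 0" using i by (intro orth) (auto intro: carrier_vecI)
      moreover have "col (G * X) 0 = G *\<^sub>v x" using colX by (intro eq_vecI) simp_all
      ultimately show "(transpose_mat N * (G * X)) $$ (i, j) = 0\<^sub>m n 1 $$ (i, j)"
        using i by simp
    qed simp_all
    then have NGX: "ring_emb (transpose_mat N * (G * X)) = 0" by (simp only: ring_emb_zero)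
    define f where "f = transpose_mat S * (G * X)"
    have [simp]: "dim_row f = m" "dim_col f = 1" by (simp_all add: f_def)
    have fc: "f \<in> carrier_mat m 1" by (rule carrier_matI) simp_all
    \<comment> \<open>A functional that vanishes on the radical factors through \<open>I\<close>:
      \<open>N\<close> projects onto the radical, and \<open>f\<close> is the pullback along the
      section.\<close>
    have "G * X = transpose_mat I * f"
      using NGX unfolding f_def N_def
      by (intro ring_emb_inj) (simp_all add: ring_emb_simps swap.star_simps algebra_simps ring_emb_unit)
    then have GX: "ring_emb G * ring_emb X = swap_biendo (ring_emb I) * ring_emb f"
      using ring_emb_mult_eq[of G X "transpose_mat I * f"] by (simp add: ring_emb_simps)
    have KG: "ring_emb K * (ring_emb G * y) = ring_emb (1\<^sub>m n) * y" for y
      by (rule mult_eq_assoc[OF ring_emb_mult_eq[OF GK(2)]]) simp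
    have "ring_emb K * (ring_emb G * ring_emb X) = ring_emb X" unfolding KG by (simp add: ring_emb_unit)
    then have XJf: "X = J * f"
      unfolding GX J_def by (intro ring_emb_inj) (simp_all add: ring_emb_simps mult.assoc)
    have "(I * J) * f = I * X"
      unfolding XJf by (rule ring_emb_inj) (simp_all add: ring_emb_simps mult.assoc)
    then have Df: "(I * J) * f = 0\<^sub>m m 1" unfolding IX .
    have finv: "f $$ (inv \<xi> u, 0) = f $$ (u, 0)" if u: "u < m" for u
    proof -
      have "((I * J) * f) $$ (u, 0) = f $$ (u, 0) - f $$ (inv \<xi> u, 0)"
        unfolding IJ by (rule one_minus_perm_index[OF fc u]) simp
      then show ?thesis unfolding Df using u by simp
    qed
    \<comment> \<open>Passing to differences with the value at the root removes the constant part
      \<open>W\<close>, which \<open>J\<close> cannot see.\<close>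
    define y where "y = vec k (\<lambda>j. f $$ (v j, 0) - f $$ (z, 0))"
    define Y where "Y = mat k 1 (\<lambda>(j, _). y $ j)"
    have [simp]: "dim_row Y = k" "dim_col Y = 1" by (simp_all add: Y_def)
    have yc: "y \<in> carrier_vec k" by (simp add: y_def)
    have colY: "col Y 0 = y" by (intro eq_vecI) (auto simp: Y_def y_def)
    define W where "W = mat m 1 (\<lambda>(i, j). f $$ (z, 0))"
    have [simp]: "dim_row W = m" "dim_col W = 1" by (simp_all add: W_def)
    have W: "W $$ (u, 0) = f $$ (z, 0)" if "u < m" for u using that by (simp add: W_def)
    have "f = F * Y + W"
    proof (rule eq_matI)
      fix u l assume "u < dim_row (F * Y + W)" "l < dim_col (F * Y + W)"
      then have u: "u < m" "l = 0" by auto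
      have FY: "(F * Y) $$ (u, 0) = (\<Sum>j<k. if u \<in> o' j then y $ j else 0)"
      proof -
        have "(F * Y) $$ (u, 0) = (\<Sum>j<k. F $$ (u, j) * Y $$ (j, 0))"
          using u by (simp add: scalar_prod_def atLeast0LessThan)
        also have "\<dots> = (\<Sum>j<k. if u \<in> o' j then y $ j else 0)"
          using u by (intro sum.cong) (auto simp: F_def Y_def)
        finally show ?thesis .
      qed
      show "f $$ (u, l) = (F * Y + W) $$ (u, l)"
      proof (cases "orbit \<xi> u = orbit \<xi> z")
        case True
        then have "u \<notin> o' j" if "j < k" for j
          using v(2)[OF that] zo[OF that] orbit_same[OF p, of u "v j"] permutation_self_in_orbit[OF p, of z] by auto
        then have "(F * Y) $$ (u, 0) = 0" unfolding FY by simp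
        moreover have "f $$ (u, 0) = f $$ (z, 0)"
          using invariant_orbit[of "\<lambda>u. f $$ (u, 0)" z u] finv z True permutation_self_in_orbit[OF p, of u] by auto
        ultimately show ?thesis using u by (simp add: W del: index_mult_mat(1))
      next
        case False
        then have "orbit \<xi> u \<in> Os" using u by (simp add: Os_def)
        then obtain i where i: "i < k" "orbit \<xi> u = o' i" using o' by (auto simp: bij_betw_def)
        have "u \<in> o' j \<longleftrightarrow> j = i" if "j < k" for j
        proof -
          have "o' j = o' i \<longleftrightarrow> j = i"
            using o' i that inj_on_eq_iff[of o' "{..<k}" j i] by (auto simp: bij_betw_def)
          then show ?thesis
            using v(2)[OF that] i(2) orbit_same[OF p, of u "v j"] permutation_self_in_orbit[OF p, of u] by auto
        qed
        then have "(F * Y) $$ (u, 0) = (\<Sum>j<k. if j = i then y $ j else 0)" unfolding FY by (intro sum.cong) auto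
        also have "\<dots> = f $$ (v i, 0) - f $$ (z, 0)" using i by (simp add: y_def)
        finally have FYu: "(F * Y) $$ (u, 0) = f $$ (v i, 0) - f $$ (z, 0)" .
        have "f $$ (u, 0) = f $$ (v i, 0)"
          using invariant_orbit[of "\<lambda>u. f $$ (u, 0)" "v i" u] finv v[OF i(1)] i permutation_self_in_orbit[OF p, of u] by auto
        then show ?thesis using u FYu by (simp add: W del: index_mult_mat(1))
      qed
    qed simp_all
    then have "ring_emb f = ring_emb (F * Y + W)" by (rule arg_cong)
    then have fe: "ring_emb f = ring_emb F * ring_emb Y + ring_emb (W)"
      by (subst (asm) ring_emb_add) (simp_all add: ring_emb_mult)
    have const: "ring_emb K * (swap_biendo (ring_emb I) * ring_emb (W)) = 0"
      using ring_emb_mult_eq[OF transpose_I_one[of 1 "\<lambda>_. f $$ (z, 0)"]]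
      unfolding W_def[symmetric] by (simp add: ring_emb_simps)
    have "X = B * Y"
      unfolding XJf B_def J_def
      by (rule ring_emb_inj) (simp_all add: ring_emb_simps mult.assoc fe distrib_left const)
    then have "col X 0 = col (B * Y) 0" by simp
    also have "\<dots> = B *\<^sub>v y" using colY by (intro eq_vecI) simp_all
    finally have "x = B *\<^sub>v y" unfolding colX .
    then show "x \<in> {B *\<^sub>v y | y. y \<in> carrier_vec k}" using yc by (intro CollectI exI conjI)
  qed
  then show ?thesis unfolding k_def[symmetric] by (rule int_rank_eqI[OF car(3,5) CB])
qed

text \<open>Permuting the rows of \<open>I\<close> leaves \<open>I^T I\<close> unchanged, so
  \<open>G\<close> and \<open>K\<close> remain valid, while the Coxeter-Laplacian is conjugated by
  \<sigma>.\<close>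

lemma relabel:
  assumes \<sigma>: "\<sigma> permutes {..<m}"
  shows "coxeter_datum m n (\<sigma> z) (perm_mat m \<sigma> * I) G K (S * perm_mat m (inv \<sigma>)) (\<sigma> \<circ> \<xi> \<circ> inv \<sigma>)"
proof
  let ?P = "perm_mat m \<sigma>" and ?P' = "perm_mat m (inv \<sigma>)"
  note i\<sigma> = permutes_inv[OF \<sigma>]
  show "?P * I \<in> carrier_mat m n" using mult_carrier_mat[OF perm_mat_carrier I] .
  show "G \<in> carrier_mat n n" "K \<in> carrier_mat n n" "G * K = 1\<^sub>m n" "K * G = 1\<^sub>m n" by (fact G K GK)+
  show "S * ?P' \<in> carrier_mat n m" using mult_carrier_mat[OF S perm_mat_carrier] .
  show "\<sigma> z < m" using permutes_in_image[OF \<sigma>, of z] z by simp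
  have t: "swap_biendo (ring_emb ?P) = ring_emb ?P'"
    by (simp add: perm_mat_transpose[OF \<sigma>, symmetric] ring_emb_transpose)
  have P'P: "ring_emb ?P' * (ring_emb ?P * x) = ring_emb (1\<^sub>m m) * x" for x
    by (rule mult_eq_assoc[OF ring_emb_mult_eq[OF perm_mat_inverse(2)[OF \<sigma>]]]) simp
  have PP': "ring_emb ?P * ring_emb ?P' = ring_emb (1\<^sub>m m)"
    by (rule ring_emb_mult_eq[OF perm_mat_inverse(1)[OF \<sigma>]]) simp
  show "G + transpose_mat G = transpose_mat (?P * I) * (?P * I)"
    unfolding sym by (rule ring_emb_inj) (simp_all add: ring_emb_simps swap.star_simps t mult.assoc P'P ring_emb_unit)
  show "\<sigma> \<circ> \<xi> \<circ> inv \<sigma> permutes {..<m}"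
    by (intro permutes_compose i\<sigma> perm \<sigma>)
  show "(\<Sum>i<m. (?P * I) $$ (i, j)) = 0" if j: "j < n" for j
  proof -
    have "(\<Sum>i<m. (?P * I) $$ (i, j)) = (\<Sum>i<m. I $$ (inv \<sigma> i, j))"
      using j by (intro sum.cong refl) (simp add: perm_mat_mult_index[OF \<sigma> I] del: index_mult_mat)
    also have "\<dots> = (\<Sum>i<m. I $$ (i, j))"
      using sum.permute[OF i\<sigma>, of "\<lambda>i. I $$ (i, j)"] by (simp add: comp_def)
    finally show ?thesis using col_sum[OF j] by simp
  qed
  have "(?P * I) * (S * ?P') = ?P * ((I * S) * ?P')"
    by (rule ring_emb_inj) (simp_all add: ring_emb_simps mult.assoc)
  also have "\<dots> = mat m m (\<lambda>(i, j). (if i = j then 1 else 0) - (if i = \<sigma> z then 1 else 0))"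
  proof (rule eq_matI)
    fix i j assume "i < dim_row (mat m m (\<lambda>(i, j). (if i = j then 1 else 0) - (if i = \<sigma> z then 1 else 0 :: int)))"
      "j < dim_col (mat m m (\<lambda>(i, j). (if i = j then 1 else 0) - (if i = \<sigma> z then 1 else 0 :: int)))"
    then have ij: "i < m" "j < m" by auto
    have ISP: "(I * S) * ?P' \<in> carrier_mat m m" "I * S \<in> carrier_mat m m" by (auto intro: carrier_matI)
    have im: "inv \<sigma> i < m" "inv \<sigma> j < m" using permutes_in_image[OF i\<sigma>] ij by auto
    have "(?P * ((I * S) * ?P')) $$ (i, j) = (I * S) $$ (inv \<sigma> i, inv \<sigma> j)"
      using perm_mat_mult_index[OF \<sigma> ISP(1) ij] mult_perm_mat_index[OF i\<sigma> ISP(2) im(1) ij(2)] by simp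
    also have "\<dots> = (if inv \<sigma> i = inv \<sigma> j then 1 else 0) - (if inv \<sigma> i = z then 1 else 0)"
      unfolding IS using im by simp
    also have "inv \<sigma> i = inv \<sigma> j \<longleftrightarrow> i = j" by (metis permutes_inverses(1)[OF \<sigma>])
    also have "inv \<sigma> i = z \<longleftrightarrow> i = \<sigma> z" by (metis permutes_inverses[OF \<sigma>])
    finally show "(?P * ((I * S) * ?P')) $$ (i, j) =
        mat m m (\<lambda>(i, j). (if i = j then 1 else 0) - (if i = \<sigma> z then 1 else 0)) $$ (i, j)" using ij by simp
  qed simp_all
  finally show "(?P * I) * (S * ?P') = mat m m (\<lambda>(i, j). (if i = j then 1 else 0) - (if i = \<sigma> z then 1 else 0))" .
  have "1\<^sub>m m - ?P * I * K * transpose_mat (?P * I) = ?P * ((1\<^sub>m m - I * K * transpose_mat I) * ?P')"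
    by (rule ring_emb_inj) (simp_all add: ring_emb_simps swap.star_simps t algebra_simps PP' ring_emb_unit)
  also have "\<dots> = perm_mat m (\<sigma> \<circ> \<xi> \<circ> inv \<sigma>)"
    unfolding laplacian perm_mat_comp[OF perm i\<sigma>] perm_mat_comp[OF \<sigma> permutes_compose[OF i\<sigma> perm]]
    by (simp add: comp_assoc)
  finally show "1\<^sub>m m - ?P * I * K * transpose_mat (?P * I) = perm_mat m (\<sigma> \<circ> \<xi> \<circ> inv \<sigma>)" .
qed

end

section \<open>Quivers on a path\<close>

text \<open>
  The vertices \<open>0, \<dots>, m - 1\<close> form a path with possibly multiple edges; the \<open>j\<close>-th arrow joins the
  vertices \<open>ps ! j\<close> and \<open>ps ! j + 1\<close>.
\<close>

locale path_quiver =
  fixes m n :: nat and ps :: "nat list"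
  assumes len: "length ps = n" and m2: "2 \<le> m"
    and range: "p \<in> set ps \<Longrightarrow> Suc p < m"
    and cover: "Suc p < m \<Longrightarrow> p \<in> set ps"
    and step: "successively (\<lambda>x y. y = x \<or> y = Suc x) ps"
begin

definition Q :: "(nat, nat) pre_digraph" where
  "Q = \<lparr>verts = {..<m}, arcs = {..<n}, tail = (\<lambda>j. ps ! j), head = (\<lambda>j. Suc (ps ! j))\<rparr>"

lemma ps_range: "j < n \<Longrightarrow> Suc (ps ! j) < m"
  using range len by simp

sublocale arrows m n "\<lambda>j. ps ! j" "\<lambda>j. Suc (ps ! j)"
  by unfold_locales (use ps_range in \<open>auto dest: Suc_lessD\<close>)

lemma Q_tail_head: "tail Q = (\<lambda>j. ps ! j)" "head Q = (\<lambda>j. Suc (ps ! j))"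
  by (simp_all add: Q_def)

lemma Q_quiver: "quiver m n Q"
  using ps_range by (auto simp: quiver_def Q_def wf_digraph_def dest: Suc_lessD)

lemma Q_loopfree: "loopfree_digraph Q"
  using Q_quiver by (auto simp: loopfree_digraph_def loopfree_digraph_axioms_def quiver_def Q_def)

abbreviation "rel \<equiv> arrow_rel n (\<lambda>j. ps ! j) (\<lambda>j. Suc (ps ! j))"

lemma Q_connected: "Digraph_Component.connected Q"
proof -
  have edge: "(p, Suc p) \<in> rel" "(Suc p, p) \<in> rel" if p: "Suc p < m" for p
  proof -
    obtain j where "j < n" "ps ! j = p" using cover[OF p] len by (auto simp: in_set_conv_nth)
    then show "(p, Suc p) \<in> rel" "(Suc p, p) \<in> rel" by (auto simp: arrow_rel_def)
  qed
  have "(0, v) \<in> rel\<^sup>* \<and> (v, 0) \<in> rel\<^sup>*" if "v < m" for v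
    using that
  proof (induction v)
    case (Suc v)
    then show ?case using edge[of v]
      by (auto intro: rtrancl_into_rtrancl converse_rtrancl_into_rtrancl)
  qed simp
  then show ?thesis
    unfolding connected_iff_arrow_rel[OF Q_quiver] Q_tail_head
    using m2 by (auto intro: rtrancl_trans[of _ 0])
qed

abbreviation "q \<equiv> quiver_form m n Q"

lemma q_eq: "x \<in> carrier_vec n \<Longrightarrow> q x = x \<bullet> (Tri *\<^sub>v x)"
  by (rule quiver_form_eq(1)[OF Q_tail_head])

lemma Inc_norm: "x \<in> carrier_vec n \<Longrightarrow> (Inc *\<^sub>v x) \<bullet> (Inc *\<^sub>v x) = 2 * q x"
  using quiver_form_eq[OF Q_tail_head] by simp

lemma q_unit_form: "unit_form n q"
  unfolding unit_form_def integral_quadratic_form_def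
proof (intro conjI bexI[of _ Tri] ballI allI impI)
  show "q \<in> extensional (carrier_vec n)" by (simp add: quiver_form_def)
  show "q (unit_vec n i) = 1" if "i < n" for i
    using that by (simp add: q_eq unit_vec_form[OF Tri_carrier(1)]) (simp add: Tri_def)
qed (simp_all add: q_eq)

lemma q_nonneg: "nonneg_form n q"
  unfolding nonneg_form_def
proof
  fix x :: "int vec" assume x: "x \<in> carrier_vec n"
  have "0 \<le> (Inc *\<^sub>v x) \<bullet> (Inc *\<^sub>v x)" unfolding scalar_prod_def by (intro sum_nonneg) auto
  then show "0 \<le> q x" using Inc_norm[OF x] by simp
qed

lemma gram_q: "gram n q = transpose_mat Inc * Inc"
  by (rule tri_gram_quiver_form(2)[OF Q_tail_head])

lemma gram_q_index:
  assumes "i < n" "j < n"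
  shows "gram n q $$ (i, j) = Inc $$ (ps ! i, j) - Inc $$ (Suc (ps ! i), j)"
  unfolding gram_q Inc_gram_index[OF assms] by (rule sum_Inc_mult[OF assms(1)])

text \<open>Arrows with consecutive indices are parallel or adjacent on the path, with Gram entry 2
  or -1, so consecutive variables are always joined.\<close>

lemma q_connected: "connected_form n q"
  unfolding connected_form_def
proof (intro allI impI)
  let ?R = "{(k, l). k < n \<and> l < n \<and> k \<noteq> l \<and> gram n q $$ (k, l) \<noteq> 0}"
  have st: "ps ! Suc i = ps ! i \<or> ps ! Suc i = Suc (ps ! i)" if "Suc i < n" for i
    using step that len by (auto simp: successively_conv_nth)
  have edge: "(i, Suc i) \<in> ?R" "(Suc i, i) \<in> ?R" if i: "Suc i < n" for i
    using st[OF i] i ps_range[of i] ps_range[of "Suc i"] by (auto simp: gram_q_index Inc_def)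
  have up: "(0, j) \<in> ?R\<^sup>* \<and> (j, 0) \<in> ?R\<^sup>*" if "j < n" for j
    using that
  proof (induction j)
    case (Suc j)
    then have "(0, j) \<in> ?R\<^sup>*" "(j, 0) \<in> ?R\<^sup>*" by auto
    with edge[OF Suc.prems] show ?case
      by (meson rtrancl_into_rtrancl converse_rtrancl_into_rtrancl)
  qed simp
  fix i j assume "i < n" "j < n"
  then show "(i, j) \<in> ?R\<^sup>*" using up[of i] up[of j] by (meson rtrancl_trans)
qed

text \<open>Adds up the coordinates of parallel arrows. The incidence matrix factors through
  \<open>W\<close> and the simple roots of the path, so \<open>W\<close> is a concrete model of the
  quotient by the radical.\<close>

definition W :: "int mat" where
  "W = mat (m - 1) n (\<lambda>(p, j). if ps ! j = p then 1 else 0)"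

lemma W_carrier: "W \<in> carrier_mat (m - 1) n" by (simp add: W_def)

lemma W_dim [simp]: "dim_row W = m - 1" "dim_col W = n" by (simp_all add: W_def)

lemma W_index: "x \<in> carrier_vec n \<Longrightarrow> p < m - 1 \<Longrightarrow> (W *\<^sub>v x) $ p = (\<Sum>j<n. if ps ! j = p then x $ j else 0)"
proof -
  assume x: "x \<in> carrier_vec n" and p: "p < m - 1"
  have "(W *\<^sub>v x) $ p = (\<Sum>j<n. W $$ (p, j) * x $ j)"
    using x p by (simp add: scalar_prod_def atLeast0LessThan)
  also have "\<dots> = (\<Sum>j<n. if ps ! j = p then x $ j else 0)"
    using p by (intro sum.cong) (auto simp: W_def)
  finally show ?thesis .
qed

lemma Inc_W:
  assumes x: "x \<in> carrier_vec n"
  shows "Inc *\<^sub>v x = vec m (path_coord (m - 1) (\<lambda>p. (W *\<^sub>v x) $ p))"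
proof (rule eq_vecI)
  fix i assume "i < dim_vec (vec m (path_coord (m - 1) (\<lambda>p. (W *\<^sub>v x) $ p)))"
  then have i: "i < m" by simp
  have "(Inc *\<^sub>v x) $ i = (\<Sum>j<n. Inc $$ (i, j) * x $ j)"
    using i x by (simp add: scalar_prod_def atLeast0LessThan)
  also have "\<dots> = (\<Sum>j<n. (if ps ! j = i then x $ j else 0) - (if Suc (ps ! j) = i then x $ j else 0))"
    using i by (intro sum.cong) (auto simp: Inc_def)
  also have "\<dots> = (\<Sum>j<n. if ps ! j = i then x $ j else 0) - (\<Sum>j<n. if Suc (ps ! j) = i then x $ j else 0)"
    by (rule sum_subtractf)
  also have "(\<Sum>j<n. if ps ! j = i then x $ j else 0) = (if i < m - 1 then (W *\<^sub>v x) $ i else 0)"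
  proof (cases "i < m - 1")
    case False
    then have "ps ! j \<noteq> i" if "j < n" for j using ps_range[OF that] by auto
    then show ?thesis using False by simp
  next
    case True
    then show ?thesis by (simp only: if_True W_index[OF x True])
  qed
  also have "(\<Sum>j<n. if Suc (ps ! j) = i then x $ j else 0) = (if 0 < i then (W *\<^sub>v x) $ (i - 1) else 0)"
  proof (cases i)
    case (Suc p)
    then have "p < m - 1" using i by simp
    from W_index[OF x this] show ?thesis by (simp only: Suc zero_less_Suc if_True diff_Suc_1 nat.inject)
  qed simp
  finally show "(Inc *\<^sub>v x) $ i = vec m (path_coord (m - 1) (\<lambda>p. (W *\<^sub>v x) $ p)) $ i"
    using i by (simp add: path_coord_def)
qed simp

lemma Inc_zero_iff:
  assumes x: "x \<in> carrier_vec n"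
  shows "Inc *\<^sub>v x = 0\<^sub>v m \<longleftrightarrow> W *\<^sub>v x = 0\<^sub>v (m - 1)"
proof
  assume e: "Inc *\<^sub>v x = 0\<^sub>v m"
  have pc: "path_coord (m - 1) (\<lambda>p. (W *\<^sub>v x) $ p) i = 0" if "i < m" for i
    using arg_cong[OF e, of "\<lambda>v. v $ i"] that unfolding Inc_W[OF x] by simp
  have "(W *\<^sub>v x) $ p = 0" if "p < m - 1" for p
    using that
  proof (induction p)
    case 0
    then show ?case using pc[of 0] by (simp add: path_coord_def)
  next
    case (Suc p)
    then show ?case using pc[of "Suc p"] by (simp add: path_coord_def)
  qed
  then show "W *\<^sub>v x = 0\<^sub>v (m - 1)" by (intro eq_vecI) auto
next
  assume e: "W *\<^sub>v x = 0\<^sub>v (m - 1)"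
  show "Inc *\<^sub>v x = 0\<^sub>v m"
    unfolding Inc_W[OF x] e by (intro eq_vecI) (auto simp: path_coord_def)
qed

lemma rad_q: "rad n q = {x \<in> carrier_vec n. W *\<^sub>v x = 0\<^sub>v (m - 1)}"
proof -
  have "gram n q *\<^sub>v x = 0\<^sub>v n \<longleftrightarrow> Inc *\<^sub>v x = 0\<^sub>v m" if x: "x \<in> carrier_vec n" for x
  proof
    assume e: "gram n q *\<^sub>v x = 0\<^sub>v n"
    define w where "w = Inc *\<^sub>v x"
    have w: "w \<in> carrier_vec m" unfolding w_def by (rule mult_mat_vec_carrier[OF Inc_carrier(1) x])
    have "w \<bullet> w = x \<bullet> (gram n q *\<^sub>v x)"
      unfolding gram_q w_def
      using x transpose_vec_mult_scalar[of Inc m n x "Inc *\<^sub>v x"] comm_scalar_prod[of x n "transpose_mat Inc *\<^sub>v (Inc *\<^sub>v x)"]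
        mult_mat_vec_carrier[of Inc m n x] mult_mat_vec_carrier[of "transpose_mat Inc" n m "Inc *\<^sub>v x"]
      by (simp add: assoc_mult_mat_vec[of _ n m _ n])
    also have "\<dots> = 0" unfolding e using x by simp
    finally have "(\<Sum>i<m. w $ i * w $ i) = 0" using w by (simp add: scalar_prod_def atLeast0LessThan)
    then have "\<forall>i\<in>{..<m}. w $ i * w $ i = 0" by (subst (asm) sum_nonneg_eq_0_iff) auto
    then have "w = 0\<^sub>v m" using w by (intro eq_vecI) auto
    then show "Inc *\<^sub>v x = 0\<^sub>v m" by (simp add: w_def)
  next
    assume e: "Inc *\<^sub>v x = 0\<^sub>v m"
    have "gram n q *\<^sub>v x = transpose_mat Inc *\<^sub>v (Inc *\<^sub>v x)"
      unfolding gram_q using x by (intro assoc_mult_mat_vec[of _ n m _ n]) simp_all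
    then show "gram n q *\<^sub>v x = 0\<^sub>v n" unfolding e by (auto simp: scalar_prod_def)
  qed
  then show ?thesis using Inc_zero_iff unfolding rad_def by blast
qed

text \<open>The arrows \<open>first p\<close> form a spanning tree.\<close>

definition first :: "nat \<Rightarrow> nat" where
  "first p = (SOME j. j < n \<and> ps ! j = p)"

lemma first:
  assumes "p < m - 1" shows "first p < n" "ps ! first p = p"
proof -
  have "\<exists>j. j < n \<and> ps ! j = p" using cover[of p] assms len by (auto simp: in_set_conv_nth)
  then have "first p < n \<and> ps ! first p = p" unfolding first_def by (rule someI_ex)
  then show "first p < n" "ps ! first p = p" by auto
qed

lemma first_inj: "inj_on first {..<m - 1}"
  by (rule inj_onI) (metis first(2) lessThan_iff)

text \<open>A basis of the radical is given by the arrows outside the spanning tree, each minus the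
  tree arrow parallel to it. Reading the coordinates outside the tree is a left inverse.\<close>

lemma corank_q: "corank n q + m = n + 1"
proof -
  define T where "T = first ` {..<m - 1}"
  have T: "T \<subseteq> {..<n}" using first by (auto simp: T_def)
  have cT: "card T = m - 1" unfolding T_def using card_image[OF first_inj] by simp
  define k where "k = n - (m - 1)"
  have "card ({..<n} - T) = k" using card_Diff_subset[of T "{..<n}"] T cT by (simp add: k_def finite_subset)
  moreover have mn: "m - 1 \<le> n" using card_mono[of "{..<n}" T] T cT by simp
  ultimately obtain \<nu> where \<nu>: "bij_betw \<nu> {..<k} ({..<n} - T)"
    using ex_bij_betw_nat_finite[of "{..<n} - T"] by (auto simp: atLeast0LessThan)
  have \<nu>n: "\<nu> j < n" "\<nu> j \<notin> T" if "j < k" for j using \<nu> that by (auto simp: bij_betw_def)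
  have \<nu>inj: "\<nu> i = \<nu> j \<longleftrightarrow> i = j" if "i < k" "j < k" for i j
    using \<nu> that inj_on_eq_iff[of \<nu> "{..<k}" i j] by (auto simp: bij_betw_def)
  define \<phi> where "\<phi> j = first (ps ! \<nu> j)" for j
  have psm: "ps ! \<nu> j < m - 1" if "j < k" for j using ps_range[OF \<nu>n(1)[OF that]] by simp
  have \<phi>: "\<phi> j \<in> T" "\<phi> j < n" "ps ! \<phi> j = ps ! \<nu> j" if "j < k" for j
    using first[OF psm[OF that]] psm[OF that] by (auto simp: \<phi>_def T_def)
  define B where "B = mat n k (\<lambda>(i, j). (if i = \<nu> j then 1 else 0) - (if i = \<phi> j then 1 else 0 :: int))"
  define C where "C = mat k n (\<lambda>(j, i). if i = \<nu> j then 1 else 0 :: int)"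
  have B: "B \<in> carrier_mat n k" and C: "C \<in> carrier_mat k n" by (simp_all add: B_def C_def)
  have CB: "C * B = 1\<^sub>m k"
  proof (rule eq_matI)
    fix i j assume "i < dim_row (1\<^sub>m k :: int mat)" "j < dim_col (1\<^sub>m k :: int mat)"
    then have ij: "i < k" "j < k" by auto
    have "(C * B) $$ (i, j) = (\<Sum>l<n. C $$ (i, l) * B $$ (l, j))"
      using ij B C by (simp add: scalar_prod_def atLeast0LessThan)
    also have "\<dots> = (\<Sum>l<n. if l = \<nu> i then B $$ (l, j) else 0)"
      using ij by (intro sum.cong) (auto simp: C_def)
    also have "\<dots> = B $$ (\<nu> i, j)" using \<nu>n(1)[OF ij(1)] by simp
    also have "\<dots> = 1\<^sub>m k $$ (i, j)"
      using \<nu>n[OF ij(1)] \<phi>(1)[OF ij(2)] \<nu>inj[OF ij] ij by (auto simp: B_def)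
    finally show "(C * B) $$ (i, j) = 1\<^sub>m k $$ (i, j)" .
  qed (use B C in simp_all)
  have Bi: "(B *\<^sub>v y) $ i = (\<Sum>j<k. ((if i = \<nu> j then 1 else 0) - (if i = \<phi> j then 1 else 0)) * y $ j)"
    if "i < n" "y \<in> carrier_vec k" for i y
    using that by (simp add: B_def scalar_prod_def atLeast0LessThan)
  have "rad n q = {B *\<^sub>v y | y. y \<in> carrier_vec k}"
  proof (intro equalityI subsetI)
    fix x assume "x \<in> {B *\<^sub>v y | y. y \<in> carrier_vec k}"
    then obtain y where y: "y \<in> carrier_vec k" and x: "x = B *\<^sub>v y" by blast
    have "W * B = 0\<^sub>m (m - 1) k"
    proof (rule eq_matI)
      fix p j assume "p < dim_row (0\<^sub>m (m - 1) k :: int mat)" "j < dim_col (0\<^sub>m (m - 1) k :: int mat)"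
      then have pj: "p < m - 1" "j < k" by auto
      have "(W * B) $$ (p, j) = (\<Sum>l<n. W $$ (p, l) * B $$ (l, j))"
        using pj B by (simp add: scalar_prod_def atLeast0LessThan)
      also have "\<dots> = (\<Sum>l<n. (if l = \<nu> j then W $$ (p, l) else 0) - (if l = \<phi> j then W $$ (p, l) else 0))"
        using pj by (intro sum.cong) (auto simp: B_def)
      also have "\<dots> = W $$ (p, \<nu> j) - W $$ (p, \<phi> j)"
        using \<nu>n[OF pj(2)] \<phi>[OF pj(2)] by (simp add: sum_subtractf)
      also have "\<dots> = 0" using pj \<nu>n[OF pj(2)] \<phi>[OF pj(2)] by (simp add: W_def)
      finally show "(W * B) $$ (p, j) = 0\<^sub>m (m - 1) k $$ (p, j)" using pj by simp
    qed (use B in simp_all)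
    moreover have "W *\<^sub>v x = (W * B) *\<^sub>v y"
      unfolding x by (rule assoc_mult_mat_vec[OF W_carrier B y, symmetric])
    ultimately have "W *\<^sub>v x = 0\<^sub>v (m - 1)" using y by (auto simp: scalar_prod_def)
    then show "x \<in> rad n q" unfolding rad_q using x B y by simp
  next
    fix x assume "x \<in> rad n q"
    then have x: "x \<in> carrier_vec n" and Wx: "W *\<^sub>v x = 0\<^sub>v (m - 1)" unfolding rad_q by auto
    define y where "y = vec k (\<lambda>j. x $ \<nu> j)"
    have y: "y \<in> carrier_vec k" by (simp add: y_def)
    have "x = B *\<^sub>v y"
    proof (rule eq_vecI)
      fix i assume "i < dim_vec (B *\<^sub>v y)"
      then have i: "i < n" using B by simp
      have split: "(B *\<^sub>v y) $ i = (\<Sum>j<k. if i = \<nu> j then x $ \<nu> j else 0) - (\<Sum>j<k. if i = \<phi> j then x $ \<nu> j else 0)"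
        unfolding Bi[OF i y] sum_subtractf[symmetric] by (intro sum.cong) (auto simp: y_def)
      show "x $ i = (B *\<^sub>v y) $ i"
      proof (cases "i \<in> T")
        case False
        then have "i \<in> \<nu> ` {..<k}" using \<nu> i by (simp add: bij_betw_def)
        then obtain l where l: "l < k" "i = \<nu> l" by blast
        have "(\<Sum>j<k. if i = \<nu> j then x $ \<nu> j else 0) = (\<Sum>j<k. if j = l then x $ \<nu> j else 0)"
          using \<nu>inj l by (intro sum.cong) auto
        moreover have "(\<Sum>j<k. if i = \<phi> j then x $ \<nu> j else 0) = 0"
          using False \<phi>(1) by (intro sum.neutral) auto
        ultimately show ?thesis unfolding split using l by simp
      next
        case True
        then obtain p where p: "p < m - 1" "i = first p" by (auto simp: T_def)
        have phi_p: "i = \<phi> j \<longleftrightarrow> ps ! \<nu> j = p" if "j < k" for j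
        proof
          assume "i = \<phi> j"
          then have "ps ! \<nu> j = ps ! first p" using \<phi>(3)[OF that] p(2) by simp
          then show "ps ! \<nu> j = p" using first(2)[OF p(1)] by simp
        next
          assume "ps ! \<nu> j = p"
          then show "i = \<phi> j" by (simp add: \<phi>_def p(2))
        qed
        have "0 = (\<Sum>j<n. if ps ! j = p then x $ j else 0)"
          using W_index[OF x p(1)] Wx p(1) by simp
        also have "\<dots> = (\<Sum>j\<in>T. if ps ! j = p then x $ j else 0) + (\<Sum>j\<in>{..<n} - T. if ps ! j = p then x $ j else 0)"
          using sum.subset_diff[OF T, of "\<lambda>j. if ps ! j = p then x $ j else 0"] by simp
        also have "(\<Sum>j\<in>T. if ps ! j = p then x $ j else 0) = (\<Sum>r<m - 1. if r = p then x $ first r else 0)"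
          unfolding T_def sum.reindex[OF first_inj] by (intro sum.cong refl) (simp add: first(2))
        also have "\<dots> = x $ i" using p by simp
        also have "(\<Sum>j\<in>{..<n} - T. if ps ! j = p then x $ j else 0) = (\<Sum>j<k. if ps ! \<nu> j = p then x $ \<nu> j else 0)"
          using sum.reindex_bij_betw[OF \<nu>, of "\<lambda>j. if ps ! j = p then x $ j else 0"] by simp
        also have "\<dots> = (\<Sum>j<k. if i = \<phi> j then x $ \<nu> j else 0)"
          by (intro sum.cong) (auto simp: phi_p)
        finally have "x $ i = - (\<Sum>j<k. if i = \<phi> j then x $ \<nu> j else 0)" by simp
        moreover have "(\<Sum>j<k. if i = \<nu> j then x $ \<nu> j else 0) = 0"
          using True \<nu>n(2) by (intro sum.neutral) auto
        ultimately show ?thesis unfolding split by simp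
      qed
    qed (use x B in simp)
    then show "x \<in> {B *\<^sub>v y | y. y \<in> carrier_vec k}" using y by (intro CollectI exI conjI)
  qed
  then have "int_rank n (rad n q) = k" by (rule int_rank_eqI[OF B C CB])
  then show ?thesis using mn m2 by (simp add: corank_def k_def)
qed

text \<open>\<open>W\<close> is surjective with the radical as its kernel, so the homomorphism
  theorem supplies the isomorphism; it respects the forms because \<open>W\<close> gives the
  coordinates in the simple roots.\<close>

lemma q_dynkin: "has_dynkin_type n q (m - 1) dynkin_A"
proof -
  let ?V = "monoid_vec TYPE(int) n" and ?U = "monoid_vec TYPE(int) (m - 1)"
  interpret V: comm_group ?V by (rule comm_group_vec)
  interpret U: comm_group ?U by (rule comm_group_vec)
  have W_add: "W *\<^sub>v (x + y) = W *\<^sub>v x + W *\<^sub>v y" if "x \<in> carrier_vec n" "y \<in> carrier_vec n" for x y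
    using that by (intro mult_add_distrib_mat_vec[OF W_carrier])
  have hom: "group_hom ?V ?U (\<lambda>x. W *\<^sub>v x)"
    by unfold_locales (auto simp: hom_def monoid_vec_simps W_add intro!: mult_mat_vec_carrier[OF W_carrier, unfolded One_nat_def])
  have surj: "(\<lambda>x. W *\<^sub>v x) ` carrier ?V = carrier ?U"
  proof (intro equalityI subsetI)
    fix y assume "y \<in> carrier ?U"
    then have y: "y \<in> carrier_vec (m - 1)" by (simp add: monoid_vec_simps)
    \<comment> \<open>The preimage is supported on the spanning tree.\<close>
    define x where "x = vec n (\<lambda>j. if j = first (ps ! j) then y $ (ps ! j) else 0)"
    have x: "x \<in> carrier_vec n" by (simp add: x_def)
    have "W *\<^sub>v x = y"
    proof (rule eq_vecI)
      fix p assume "p < dim_vec y"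
      then have p: "p < m - 1" using y by simp
      have "(W *\<^sub>v x) $ p = (\<Sum>j<n. if j = first p then y $ p else 0)"
        unfolding W_index[OF x p] using first[OF p] by (intro sum.cong) (auto simp: x_def)
      then show "(W *\<^sub>v x) $ p = y $ p" using first(1)[OF p] by simp
    qed (use y in simp)
    then show "y \<in> (\<lambda>x. W *\<^sub>v x) ` carrier ?V" using x by (force simp: monoid_vec_simps)
  qed (auto simp: monoid_vec_simps intro: mult_mat_vec_carrier[OF W_carrier, unfolded One_nat_def])
  have ker: "Coset.kernel ?V ?U (\<lambda>x. W *\<^sub>v x) = rad n q"
    unfolding rad_q by (simp add: Coset.kernel_def monoid_vec_simps)
  define h where "h X = the_elem ((\<lambda>x. W *\<^sub>v x) ` X)" for X
  have iso: "h \<in> iso (?V Mod rad n q) ?U"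
    using group_hom.FactGroup_iso_set[OF hom surj] unfolding ker h_def .
  have hx: "h (rad n q #>\<^bsub>?V\<^esub> x) = W *\<^sub>v x" if x: "x \<in> carrier_vec n" for x
  proof -
    have W0: "W *\<^sub>v 0\<^sub>v n = 0\<^sub>v (m - 1)"
      using W_carrier by (intro eq_vecI) (simp_all add: scalar_prod_def)
    have zero: "0\<^sub>v n \<in> rad n q" unfolding rad_q using W0 by simp
    have cosets: "W *\<^sub>v (r + x) = W *\<^sub>v x" if "r \<in> rad n q" for r
    proof -
      have r: "r \<in> carrier_vec n" "W *\<^sub>v r = 0\<^sub>v (m - 1)" using that unfolding rad_q by simp_all
      show ?thesis
        unfolding W_add[OF r(1) x] r(2) using mult_mat_vec_carrier[OF W_carrier x] by simp
    qed
    have "(\<lambda>x. W *\<^sub>v x) ` (rad n q #>\<^bsub>?V\<^esub> x) = (\<lambda>r. W *\<^sub>v (r + x)) ` rad n q"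
      by (auto simp: r_coset_def monoid_vec_simps image_UN)
    also have "\<dots> = (\<lambda>r. W *\<^sub>v x) ` rad n q" by (intro image_cong refl cosets)
    also have "\<dots> = {W *\<^sub>v x}" using zero by (rule image_constant)
    finally show ?thesis by (simp add: h_def)
  qed
  have "graph_form (m - 1) dynkin_A (W *\<^sub>v x) = q x" if x: "x \<in> carrier_vec n" for x
  proof -
    have sm: "Suc (m - 1) = m" using m2 by simp
    have "2 * graph_form (m - 1) dynkin_A (W *\<^sub>v x) = (\<Sum>i<m. (path_coord (m - 1) (\<lambda>p. (W *\<^sub>v x) $ p) i)\<^sup>2)"
      using sum_path_coord_square[OF mult_mat_vec_carrier[OF W_carrier x]] unfolding sm by simp
    also have "\<dots> = (Inc *\<^sub>v x) \<bullet> (Inc *\<^sub>v x)"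
      unfolding Inc_W[OF x] by (simp add: scalar_prod_def atLeast0LessThan power2_eq_square)
    finally show ?thesis using Inc_norm[OF x] by simp
  qed
  then show ?thesis unfolding has_dynkin_type_def using iso hx by (intro bexI[of _ h]) auto
qed

lemma q_Quad_A: "c + m = n + 1 \<Longrightarrow> q \<in> Quad_A c n"
proof -
  assume c: "c + m = n + 1"
  then have "n - c = m - 1" "corank n q = c" using corank_q by auto
  then show ?thesis
    using q_unit_form q_nonneg q_connected q_dynkin by (simp add: Quad_A_def)
qed

end

section \<open>A quiver for each partition\<close>

definition path_perm :: "nat list \<Rightarrow> nat \<Rightarrow> nat" where
  "path_perm ps = foldr (\<lambda>p f. Transposition.transpose p (Suc p) \<circ> f) ps id"

lemma path_perm_append: "path_perm (ps @ ps') = path_perm ps \<circ> path_perm ps'"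
  by (induction ps) (simp_all add: path_perm_def comp_assoc)

lemma path_perm_twice: "path_perm [p, p] = id"
  by (simp add: path_perm_def fun_eq_iff)

lemma path_perm_replicate: "path_perm (replicate (2 * g) p) = id"
proof (induction g)
  case (Suc g)
  have "replicate (2 * Suc g) p = [p, p] @ replicate (2 * g) p" by simp
  then show ?case using path_perm_append[of "[p, p]" "replicate (2 * g) p"] Suc path_perm_twice by simp
qed (simp add: path_perm_def)

lemma path_perm_upt:
  "a \<le> b \<Longrightarrow> path_perm [a..<b] v = (if v < a \<or> b < v then v else if v < b then Suc v else a)"
proof (induction a rule: inc_induct)
  case base
  then show ?case by (simp add: path_perm_def)
next
  case (step a)
  have "path_perm [a..<b] v = Transposition.transpose a (Suc a) (path_perm [Suc a..<b] v)"
    using step.hyps by (simp add: path_perm_def upt_conv_Cons)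
  then show ?case unfolding step.IH using step.hyps by (auto simp: Transposition.transpose_def)
qed

lemma arrow_perm_path:
  "arrow_perm (\<lambda>j. ps ! j) (\<lambda>j. Suc (ps ! j)) [0..<length ps] = path_perm ps"
proof -
  have "path_perm ps = foldr (\<lambda>p f. Transposition.transpose p (Suc p) \<circ> f) (map (\<lambda>j. ps ! j) [0..<length ps]) id"
    by (simp add: path_perm_def map_nth)
  also have "\<dots> = arrow_perm (\<lambda>j. ps ! j) (\<lambda>j. Suc (ps ! j)) [0..<length ps]"
    unfolding foldr_map arrow_perm_def by (simp add: comp_def)
  finally show ?thesis ..
qed

text \<open>
  Consecutive blocks are joined by a double arrow: the two transpositions cancel, so each
  block contributes its own cycle.
\<close>

fun block_path :: "nat \<Rightarrow> nat list \<Rightarrow> nat list" where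
  "block_path a [] = []"
| "block_path a [k] = [a..<a + k - 1]"
| "block_path a (k # l # \<pi>) = [a..<a + k - 1] @ [a + k - 1, a + k - 1] @ block_path (a + k) (l # \<pi>)"

text \<open>A block of size \<open>k\<close> has \<open>k - 1\<close> arrows, and each of the
  junctions, one fewer than the blocks, has two.\<close>

lemma length_block_path:
  "\<pi> \<noteq> [] \<Longrightarrow> \<forall>k\<in>set \<pi>. 0 < k \<Longrightarrow> length (block_path a \<pi>) + 2 = sum_list \<pi> + length \<pi>"
  by (induction a \<pi> rule: block_path.induct) auto

lemma set_block_path:
  "\<forall>k\<in>set \<pi>. 0 < k \<Longrightarrow> set (block_path a \<pi>) = {p. a \<le> p \<and> Suc p < a + sum_list \<pi>}"
proof (induction a \<pi> rule: block_path.induct)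
  case (3 a k l \<pi>)
  have "set (block_path a (k # l # \<pi>)) = {a..<a + k - 1} \<union> {a + k - 1} \<union> {p. a + k \<le> p \<and> Suc p < a + k + sum_list (l # \<pi>)}"
    using 3 by auto
  also have "\<dots> = {p. a \<le> p \<and> Suc p < a + sum_list (k # l # \<pi>)}"
    using 3 by (auto simp: not_less)
  finally show ?case .
qed auto

lemma path_perm_block_path:
  "\<forall>k\<in>set \<pi>. 0 < k \<Longrightarrow>
    path_perm (block_path a \<pi>) v = (if v < a then v else a + block_cycle \<pi> (v - a))"
proof (induction a \<pi> arbitrary: v rule: block_path.induct)
  case (1 a)
  then show ?case by (simp add: path_perm_def)
next
  case (2 a k)
  then show ?case by (auto simp: path_perm_upt)
next
  case (3 a k l \<pi>)
  have k: "0 < k" using 3 by simp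
  have "path_perm (block_path a (k # l # \<pi>)) v =
      path_perm [a..<a + k - 1] (path_perm (block_path (a + k) (l # \<pi>)) v)"
    unfolding block_path.simps path_perm_append path_perm_twice by simp
  also have "path_perm (block_path (a + k) (l # \<pi>)) v =
      (if v < a + k then v else a + k + block_cycle (l # \<pi>) (v - (a + k)))"
    using 3 by simp
  finally have e: "path_perm (block_path a (k # l # \<pi>)) v = path_perm [a..<a + k - 1]
      (if v < a + k then v else a + k + block_cycle (l # \<pi>) (v - (a + k)))" .
  show ?case
  proof (cases "v < a + k")
    case True
    then show ?thesis unfolding e using k by (auto simp: path_perm_upt)
  next
    case False
    define w where "w = block_cycle (l # \<pi>) (v - (a + k))"
    have "\<not> v - a < k" using False by linarith
    then have "block_cycle (k # l # \<pi>) (v - a) = k + w"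
      by (subst block_cycle.simps(2)) (simp add: w_def diff_diff_left del: block_cycle.simps(2))
    then show ?thesis unfolding e w_def[symmetric] using k False
      by (simp add: path_perm_upt del: block_cycle.simps(2))
  qed
qed

lemma hd_block_path: "\<forall>k\<in>set \<pi>. 0 < k \<Longrightarrow> block_path a \<pi> \<noteq> [] \<Longrightarrow> hd (block_path a \<pi>) = a"
  by (induction a \<pi> rule: block_path.induct) (auto simp: hd_append)

lemma successively_upt: "successively (\<lambda>x y. y = x \<or> y = Suc x) [a..<b]"
  by (simp add: successively_conv_nth)

lemma successively_block_path:
  "\<forall>k\<in>set \<pi>. 0 < k \<Longrightarrow> successively (\<lambda>x y. y = x \<or> y = Suc x) (block_path a \<pi>)"
proof (induction a \<pi> rule: block_path.induct)
  case (3 a k l \<pi>)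
  have "hd (block_path (a + k) (l # \<pi>)) = a + k" if "block_path (a + k) (l # \<pi>) \<noteq> []"
    using hd_block_path[of "l # \<pi>"] that 3 by simp
  moreover have "last [a..<a + k - 1] = a + k - 2" if "[a..<a + k - 1] \<noteq> []"
    using that by (auto simp: last_upt)
  ultimately show ?case
    using 3 successively_upt[of a "a + k - 1"]
    by (auto simp: successively_append_iff successively_Cons)
qed (simp_all add: successively_upt)

lemma partition_path_quiver:
  assumes \<pi>: "\<pi> \<in> Part1 c m" and n: "c + m = n + 1" and m: "2 \<le> m"
  obtains ps where "path_quiver m n ps" "path_perm ps = block_cycle \<pi>"
proof -
  have P: "\<pi> \<in> Part m" and len: "int (length \<pi>) - 1 \<le> int c" and ev: "(int c - (int (length \<pi>) - 1)) mod 2 = 0"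
    using \<pi> by (auto simp: Part1_def)
  have pos: "\<forall>k\<in>set \<pi>. 0 < k" and sum: "sum_list \<pi> = m" using P by (auto simp: Part_def)
  have ne: "\<pi> \<noteq> []" using sum m by auto
  from ev have "2 dvd int c - (int (length \<pi>) - 1)" by (simp only: dvd_eq_mod_eq_0)
  then obtain i where i: "int c - (int (length \<pi>) - 1) = 2 * i" by (rule dvdE)
  define g where "g = nat i"
  have g: "c + 1 = length \<pi> + 2 * g" using i len by (simp add: g_def)
  \<comment> \<open>The even surplus \<open>c - (length \<pi> - 1)\<close> is spent on pairs of
    parallel arrows at the first edge: each pair raises the corank by 2, and its transpositions
    cancel.\<close>
  define ps where "ps = replicate (2 * g) 0 @ block_path 0 \<pi>"
  have set: "set (block_path 0 \<pi>) = {p. Suc p < m}" using set_block_path[OF pos, of 0] sum by simp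
  have "path_quiver m n ps"
  proof
    show "length ps = n"
      using length_block_path[OF ne pos, of 0] g n sum m by (simp add: ps_def)
    show "Suc p < m" if "p \<in> set ps" for p
      using that set m by (auto simp: ps_def split: if_splits)
    show "p \<in> set ps" if "Suc p < m" for p using that set by (simp add: ps_def)
    have "successively (\<lambda>x y. y = x \<or> y = Suc x) (replicate (2 * g) 0)"
      by (simp add: successively_conv_nth)
    then show "successively (\<lambda>x y. y = x \<or> y = Suc x) ps"
      using successively_block_path[OF pos, of 0] hd_block_path[OF pos, of 0]
      by (auto simp: ps_def successively_append_iff)
  qed (rule m)
  moreover have "path_perm ps = block_cycle \<pi>"
    unfolding ps_def path_perm_append path_perm_replicate
    using path_perm_block_path[OF pos, of 0] by (auto simp: fun_eq_iff)
  ultimately show ?thesis by (rule that)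
qed

section \<open>The classification\<close>

lemma orbit_partition_eq_of_similar:
  assumes A: "coxeter_datum m n z I G K S \<xi>" and B: "coxeter_datum m n z' I' G' K' S' \<xi>'"
    and cp: "char_poly (coxeter_datum.\<Phi> G K) = char_poly (coxeter_datum.\<Phi> G' K')"
  shows "orbit_partition m \<xi> = orbit_partition m \<xi>'"
proof -
  interpret A: coxeter_datum m n z I G K S \<xi> by (rule A)
  interpret B: coxeter_datum m n z' I' G' K' S' \<xi>' by (rule B)
  have "(\<Prod>k\<leftarrow>A.\<pi>. monom 1 k - 1) * [:-1, 1:] ^ n = (\<Prod>k\<leftarrow>B.\<pi>. monom 1 k - 1) * [:-1, 1 :: int:] ^ n"
    using A.coxeter_poly B.coxeter_poly cp by simp
  moreover have "[:-1, 1 :: int:] ^ n \<noteq> 0" by simp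
  ultimately have "(\<Prod>k\<leftarrow>A.\<pi>. monom 1 k - 1 :: int poly) = (\<Prod>k\<leftarrow>B.\<pi>. monom 1 k - 1)"
    using mult_right_cancel by blast
  then show ?thesis
    using orbit_partition_Part[OF A.perm] orbit_partition_Part[OF B.perm]
    by (intro partition_eq_of_prod) (auto simp: Part_def)
qed

lemma invertible_mat_iff_inverse:
  assumes "B \<in> carrier_mat n n"
  shows "invertible_mat B \<longleftrightarrow> (\<exists>C\<in>carrier_mat n n. B * C = 1\<^sub>m n \<and> C * B = 1\<^sub>m n)"
proof
  assume "invertible_mat B"
  then obtain C where C: "B * C = 1\<^sub>m (dim_row B)" "C * B = 1\<^sub>m (dim_row C)"
    by (auto simp: invertible_mat_def inverts_mat_def)
  have "dim_row C = n" using arg_cong[OF C(2), of dim_col] assms by simp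
  moreover have "dim_col C = n" using arg_cong[OF C(1), of dim_col] assms by simp
  ultimately show "\<exists>C\<in>carrier_mat n n. B * C = 1\<^sub>m n \<and> C * B = 1\<^sub>m n"
    using C assms by (intro bexI[of _ C]) auto
next
  assume "\<exists>C\<in>carrier_mat n n. B * C = 1\<^sub>m n \<and> C * B = 1\<^sub>m n"
  then show "invertible_mat B"
    using assms by (auto simp: invertible_mat_def inverts_mat_def)
qed

text \<open>Congruence of \<open>G\<close> by \<open>B\<close> conjugates \<Phi> by the transpose of
  \<open>B\<close>.\<close>

lemma char_poly_coxeter_congruent:
  assumes A: "coxeter_datum m n z I G K S \<xi>" and A': "coxeter_datum m n z' I' G' K' S' \<xi>'"
    and B: "B \<in> carrier_mat n n" "invertible_mat B" and GG: "G' = transpose_mat B * G * B"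
  shows "char_poly (coxeter_datum.\<Phi> G K) = char_poly (coxeter_datum.\<Phi> G' K')"
proof -
  interpret A: coxeter_datum m n z I G K S \<xi> by (rule A)
  interpret B: coxeter_datum m n z' I' G' K' S' \<xi>' by (rule A')
  obtain C where C: "C \<in> carrier_mat n n" "B * C = 1\<^sub>m n" "C * B = 1\<^sub>m n"
    using B(2) unfolding invertible_mat_iff_inverse[OF B(1)] by blast
  note [simp] = carrier_matD[OF B(1)] carrier_matD[OF C(1)]
  let ?e = ring_emb and ?s = swap_biendo
  have BC: "?e B * ?e C = ?e (1\<^sub>m n)" "?e C * ?e B = ?e (1\<^sub>m n)"
    using ring_emb_mult_eq[OF C(2)] ring_emb_mult_eq[OF C(3)] by simp_all
  have BCs: "?s (?e C) * ?s (?e B) = ?e (1\<^sub>m n)" "?s (?e B) * ?s (?e C) = ?e (1\<^sub>m n)"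
    using BC[THEN arg_cong[of _ _ ?s]] by (simp_all add: swap.star_simps ring_emb_unit)
  have GK: "?e G * ?e K = ?e (1\<^sub>m n)"
    using ring_emb_mult_eq[OF A.GK(1)] by simp
  have "K' = C * (K * transpose_mat C)"
  proof -
    have "G' * (C * (K * transpose_mat C)) = 1\<^sub>m n"
      unfolding GG by (rule ring_emb_inj) (simp_all add: ring_emb_simps mult.assoc ring_emb_unit BCs
          mult_eq_assoc[OF BC(1)] mult_eq_assoc[OF GK])
    then have "K' * (G' * (C * (K * transpose_mat C))) = K'" using B.K by simp
    moreover have "K' * (G' * (C * (K * transpose_mat C))) = (K' * G') * (C * (K * transpose_mat C))"
      by (rule ring_emb_inj) (simp_all add: ring_emb_simps mult.assoc)
    ultimately have "K' = 1\<^sub>m n * (C * (K * transpose_mat C))" unfolding B.GK by simp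
    also have "\<dots> = C * (K * transpose_mat C)"
      by (rule left_mult_one_mat[of _ n n]) (auto intro: carrier_matI)
    finally show ?thesis .
  qed
  then have "B.\<Phi> = transpose_mat B * A.\<Phi> * transpose_mat C"
    unfolding A.\<Phi>_def B.\<Phi>_def unfolding GG
    by (intro ring_emb_inj) (simp_all add: ring_emb_simps ring_emb_uminus swap.star_simps mult.assoc
        mult_eq_assoc[OF BC(1)] ring_emb_unit)
  then have "similar_mat_wit B.\<Phi> A.\<Phi> (transpose_mat B) (transpose_mat C)"
    using C B(1) A.\<Phi>_carrier B.\<Phi>_carrier
    by (intro similar_mat_witI[of _ _ n]) (simp_all flip: transpose_mult[of _ n n _ n])
  then have "similar_mat B.\<Phi> A.\<Phi>" unfolding similar_mat_def by blast
  then show ?thesis using char_poly_similar by metis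
qed

text \<open>The determinant of \<open>X\<close> squares to 1, so the adjugate times the determinant
  is an integral inverse.\<close>

lemma unimodular_congruence_invertible:
  fixes X :: "int mat"
  assumes X: "X \<in> carrier_mat n n" and G: "G \<in> carrier_mat n n"
    and e: "transpose_mat X * G * X = G'" and d: "det G = 1" "det G' = 1"
  shows "invertible_mat X"
proof -
  have "det (transpose_mat X * G * X) = det (transpose_mat X) * det G * det X"
    using X G by (simp add: det_mult[of _ n])
  then have "det X * det X = 1" using e d det_transpose[OF X] by simp
  then have s: "det X \<cdot>\<^sub>m (det X \<cdot>\<^sub>m 1\<^sub>m n) = 1\<^sub>m n"
    by (intro eq_matI) (auto simp: mult.assoc[symmetric])
  define Y where "Y = det X \<cdot>\<^sub>m adj_mat X"
  note adj = adj_mat[OF X]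
  have Y: "Y \<in> carrier_mat n n" using adj(1) by (simp add: Y_def)
  moreover have "X * Y = 1\<^sub>m n"
    unfolding Y_def mult_smult_distrib[OF X adj(1)] adj(2) by (rule s)
  moreover have "Y * X = 1\<^sub>m n"
    unfolding Y_def mult_smult_assoc_mat[OF adj(1) X] adj(3) by (rule s)
  ultimately show ?thesis unfolding invertible_mat_iff_inverse[OF X] by blast
qed

text \<open>Two quivers with the same form have the same \<Phi>, hence the same Coxeter polynomial
  and the same partition; the definite description is therefore well defined.\<close>

lemma cycle_type_quiver_form:
  assumes Q: "quiver m n Q" "loopfree_digraph Q" "Digraph_Component.connected Q"
  shows "cycle_type m n (quiver_form m n Q) = quiver_cycle_type m n Q"
  unfolding cycle_type_def
proof (rule the_equality)
  fix \<pi> assume "\<exists>Q'. quiver m n Q' \<and> loopfree_digraph Q' \<and> Digraph_Component.connected Q' \<and>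
    quiver_form m n Q = quiver_form m n Q' \<and> \<pi> = quiver_cycle_type m n Q'"
  then obtain Q' where Q': "quiver m n Q'" "loopfree_digraph Q'" "Digraph_Component.connected Q'"
    and q: "quiver_form m n Q = quiver_form m n Q'" and \<pi>: "\<pi> = quiver_cycle_type m n Q'" by blast
  obtain K S \<xi> where A: "coxeter_datum m n 0 (incidence_mat m n Q) (tri_gram n (quiver_form m n Q)) K S \<xi>"
    and ct: "quiver_cycle_type m n Q = orbit_partition m \<xi>"
    and cox: "coxeter_mat n (quiver_form m n Q) = - (transpose_mat (tri_gram n (quiver_form m n Q)) * K)"
    by (rule quiver_coxeter_datum[OF Q])
  obtain K' S' \<xi>' where A': "coxeter_datum m n 0 (incidence_mat m n Q') (tri_gram n (quiver_form m n Q')) K' S' \<xi>'"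
    and ct': "quiver_cycle_type m n Q' = orbit_partition m \<xi>'"
    and cox': "coxeter_mat n (quiver_form m n Q') = - (transpose_mat (tri_gram n (quiver_form m n Q')) * K')"
    by (rule quiver_coxeter_datum[OF Q'])
  have "coxeter_datum.\<Phi> (tri_gram n (quiver_form m n Q)) K = coxeter_mat n (quiver_form m n Q)"
    unfolding coxeter_datum.\<Phi>_def[OF A] cox ..
  moreover have "coxeter_datum.\<Phi> (tri_gram n (quiver_form m n Q')) K' = coxeter_mat n (quiver_form m n Q')"
    unfolding coxeter_datum.\<Phi>_def[OF A'] cox' ..
  ultimately have "orbit_partition m \<xi> = orbit_partition m \<xi>'"
    using q by (intro orbit_partition_eq_of_similar[OF A A']) simp
  then show "\<pi> = quiver_cycle_type m n Q" by (simp add: \<pi> ct ct')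
qed (use Q in blast)

lemma Quad_A_datum:
  assumes q: "q \<in> Quad_A c n" and m: "m = n - c + 1"
  obtains I K S \<xi> where "coxeter_datum m n 0 I (tri_gram n q) K S \<xi>"
    "cycle_type m n q = orbit_partition m \<xi>"
    "coxeter_mat n q = - (transpose_mat (tri_gram n q) * K)"
    "gram n q = transpose_mat I * I" "det (tri_gram n q) = 1"
proof -
  obtain Q where Q: "quiver m n Q" "loopfree_digraph Q" "Digraph_Component.connected Q" "q = quiver_form m n Q"
    using Quad_A_quiver[OF q m] by blast
  show ?thesis
    by (rule quiver_coxeter_datum[OF Q(1-3)], rule that[unfolded Q(4)])
      (simp_all add: cycle_type_quiver_form[OF Q(1-3)])
qed

lemma (in coxeter_datum) gram_kernel:
  assumes x: "x \<in> carrier_vec n"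
  shows "(transpose_mat I * I) *\<^sub>v x = 0\<^sub>v n \<longleftrightarrow> I *\<^sub>v x = 0\<^sub>v m"
proof
  assume e: "(transpose_mat I * I) *\<^sub>v x = 0\<^sub>v n"
  define w where "w = I *\<^sub>v x"
  have w: "w \<in> carrier_vec m" unfolding w_def by (rule mult_mat_vec_carrier[OF I x])
  have a: "(transpose_mat I * I) *\<^sub>v x = transpose_mat I *\<^sub>v w"
    unfolding w_def using x I by (intro assoc_mult_mat_vec[of _ n m _ n]) simp_all
  have "w \<bullet> w = (transpose_mat I *\<^sub>v w) \<bullet> x"
    using transpose_vec_mult_scalar[OF I x w] by (simp add: w_def)
  also have "\<dots> = 0" unfolding a[symmetric] e using x by simp
  finally have "(\<Sum>i<m. w $ i * w $ i) = 0" using w by (simp add: scalar_prod_def atLeast0LessThan)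
  then have "\<forall>i\<in>{..<m}. w $ i * w $ i = 0" by (subst (asm) sum_nonneg_eq_0_iff) auto
  then have "w = 0\<^sub>v m" using w by (intro eq_vecI) auto
  then show "I *\<^sub>v x = 0\<^sub>v m" by (simp add: w_def)
next
  assume e: "I *\<^sub>v x = 0\<^sub>v m"
  have "(transpose_mat I * I) *\<^sub>v x = transpose_mat I *\<^sub>v (I *\<^sub>v x)"
    using x I by (intro assoc_mult_mat_vec[of _ n m _ n]) simp_all
  then show "(transpose_mat I * I) *\<^sub>v x = 0\<^sub>v n" unfolding e by (auto simp: scalar_prod_def)
qed

lemma (in coxeter_datum) reduced_corank_eq:
  assumes "gram n q = transpose_mat I * I" "tri_gram n q = G"
  shows "reduced_corank n q = length \<pi> - 1"
proof -
  have rad: "rad n q = {x \<in> carrier_vec n. I *\<^sub>v x = 0\<^sub>v m}"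
    using gram_kernel unfolding rad_def assms(1) by blast
  have "reduced_rad n q = {x \<in> carrier_vec n. I *\<^sub>v x = 0\<^sub>v m \<and>
     (\<forall>y\<in>carrier_vec n. I *\<^sub>v y = 0\<^sub>v m \<longrightarrow> y \<bullet> (G *\<^sub>v x) = 0)}"
    unfolding reduced_rad_def rad assms(2) by blast
  then show ?thesis unfolding reduced_corank_def using int_rank_reduced by simp
qed

text \<open>\<open>\<Phi>\<close> has determinant \<open>(-1)\<^sup>n\<close>; comparing the Coxeter polynomial at 0 gives the parity.\<close>

lemma (in coxeter_datum) length_parity:
  assumes d: "det G = 1"
  shows "even (m + length \<pi> + n)"
proof -
  have "det G * det K = 1" using det_mult[OF G K] GK by simp
  then have dK: "det K = 1" using d by simp
  have poly0: "poly (char_poly \<Phi>) 0 = 1"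
  proof -
    have ev: "comm_ring_hom (\<lambda>p. poly p (0 :: int))" by unfold_locales simp_all
    have "poly (char_poly \<Phi>) 0 = det (map_mat (\<lambda>p. poly p 0) (char_poly_matrix \<Phi>))"
      unfolding char_poly_def by (rule comm_ring_hom.hom_det[OF ev, symmetric])
    also have "map_mat (\<lambda>p. poly p 0) (char_poly_matrix \<Phi>) = transpose_mat G * K"
      by (rule eq_matI) (auto simp: char_poly_matrix_def \<Phi>_def)
    also have "det (transpose_mat G * K) = 1"
      using det_mult[of "transpose_mat G" n K] det_transpose[OF G] G K d dK by simp
    finally show ?thesis .
  qed
  have pos: "\<forall>k\<in>set \<pi>. 0 < k" using orbit_partition_Part[OF perm] by (auto simp: Part_def)
  have "poly (\<Prod>k\<leftarrow>\<rho>. monom 1 k - 1) (0::int) = (-1) ^ length \<rho>" if "\<forall>k\<in>set \<rho>. 0 < k" for \<rho>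
    using that by (induction \<rho>) (simp_all add: poly_monom zero_power)
  then have "(-1) ^ m = (-1 :: int) ^ (length \<pi> + n)"
    using arg_cong[OF coxeter_poly, of "\<lambda>p. poly p 0"] pos by (simp add: poly0 power_add)
  then have "even m \<longleftrightarrow> even (length \<pi> + n)"
    by (metis minus_one_power_iff one_neq_neg_one)
  then show ?thesis by auto
qed

section \<open>Strong Gram congruence as an equivalence relation\<close>

lemma strong_gram_congruent_refl:
  assumes "tri_gram n q \<in> carrier_mat n n"
  shows "strong_gram_congruent n q q"
  unfolding strong_gram_congruent_def
  using assms by (intro bexI[of _ "1\<^sub>m n"]) (auto simp: invertible_mat_iff_inverse[OF one_carrier_mat] intro!: bexI[of _ "1\<^sub>m n"])

lemma strong_gram_congruent_sym:
  assumes G: "tri_gram n q \<in> carrier_mat n n" and "strong_gram_congruent n q q'"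
  shows "strong_gram_congruent n q' q"
proof -
  obtain B where B: "B \<in> carrier_mat n n" "invertible_mat B" "tri_gram n q' = transpose_mat B * tri_gram n q * B"
    using assms by (auto simp: strong_gram_congruent_def)
  obtain C where C: "C \<in> carrier_mat n n" "B * C = 1\<^sub>m n" "C * B = 1\<^sub>m n"
    using B(2) unfolding invertible_mat_iff_inverse[OF B(1)] by blast
  note [simp] = carrier_matD[OF B(1)] carrier_matD[OF C(1)] carrier_matD[OF G]
  have BC: "ring_emb B * ring_emb C = ring_emb (1\<^sub>m n)" by (rule ring_emb_mult_eq[OF C(2)]) simp
  have CB: "swap_biendo (ring_emb C) * swap_biendo (ring_emb B) = ring_emb (1\<^sub>m n)"
    using arg_cong[OF BC, of swap_biendo] by (simp add: swap.star_simps ring_emb_unit)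
  have "tri_gram n q = transpose_mat C * tri_gram n q' * C"
    unfolding B(3) by (rule ring_emb_inj)
      (simp_all add: ring_emb_simps mult.assoc BC mult_eq_assoc[OF CB] ring_emb_unit)
  moreover have "invertible_mat C" unfolding invertible_mat_iff_inverse[OF C(1)] using B C by blast
  ultimately show ?thesis using C(1) by (auto simp: strong_gram_congruent_def)
qed

lemma strong_gram_congruent_trans:
  assumes G: "tri_gram n q \<in> carrier_mat n n"
    and "strong_gram_congruent n q q'" "strong_gram_congruent n q' q''"
  shows "strong_gram_congruent n q q''"
proof -
  obtain B where B: "B \<in> carrier_mat n n" "invertible_mat B" "tri_gram n q' = transpose_mat B * tri_gram n q * B"
    using assms by (auto simp: strong_gram_congruent_def)
  obtain C where C: "C \<in> carrier_mat n n" "invertible_mat C" "tri_gram n q'' = transpose_mat C * tri_gram n q' * C"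
    using assms by (auto simp: strong_gram_congruent_def)
  note [simp] = carrier_matD[OF B(1)] carrier_matD[OF C(1)] carrier_matD[OF G]
  have BC: "B * C \<in> carrier_mat n n" using B C by simp
  have "tri_gram n q'' = transpose_mat (B * C) * tri_gram n q * (B * C)"
    unfolding C(3) B(3) by (rule ring_emb_inj) (simp_all add: ring_emb_simps swap.star_simps mult.assoc)
  moreover have "invertible_mat (B * C)"
  proof -
    obtain B' where B': "B' \<in> carrier_mat n n" "B * B' = 1\<^sub>m n" "B' * B = 1\<^sub>m n"
      using B(2) unfolding invertible_mat_iff_inverse[OF B(1)] by blast
    obtain C' where C': "C' \<in> carrier_mat n n" "C * C' = 1\<^sub>m n" "C' * C = 1\<^sub>m n"
      using C(2) unfolding invertible_mat_iff_inverse[OF C(1)] by blast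
    note [simp] = carrier_matD[OF B'(1)] carrier_matD[OF C'(1)]
    have e: "ring_emb B * ring_emb B' = ring_emb (1\<^sub>m n)" "ring_emb B' * ring_emb B = ring_emb (1\<^sub>m n)"
      "ring_emb C * ring_emb C' = ring_emb (1\<^sub>m n)" "ring_emb C' * ring_emb C = ring_emb (1\<^sub>m n)"
      using B' C' by (auto intro!: ring_emb_mult_eq)
    have "B * C * (C' * B') = 1\<^sub>m n" "C' * B' * (B * C) = 1\<^sub>m n"
      by (rule ring_emb_inj; simp add: ring_emb_simps mult.assoc e e[THEN mult_eq_assoc] ring_emb_unit)+
    then show ?thesis unfolding invertible_mat_iff_inverse[OF BC] using B' C' by (intro bexI[of _ "C' * B'"]) auto
  qed
  ultimately show ?thesis using BC by (auto simp: strong_gram_congruent_def)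
qed

lemma Quad_A_tri_gram_carrier: "q \<in> Quad_A c n \<Longrightarrow> tri_gram n q \<in> carrier_mat n n"
  using Quad_A_datum[OF _ refl, of q c n] coxeter_datum.G by metis

lemma equiv_strong_gram_rel: "equiv (Quad_A c n) (strong_gram_rel c n)"
proof (rule equivI)
  show "strong_gram_rel c n \<subseteq> Quad_A c n \<times> Quad_A c n" by (auto simp: strong_gram_rel_def)
  show "refl_on (Quad_A c n) (strong_gram_rel c n)"
    by (auto simp: refl_on_def strong_gram_rel_def intro: strong_gram_congruent_refl Quad_A_tri_gram_carrier)
  show "sym (strong_gram_rel c n)"
    by (auto simp: sym_def strong_gram_rel_def intro: strong_gram_congruent_sym Quad_A_tri_gram_carrier)
  show "trans (strong_gram_rel c n)"
    unfolding trans_def strong_gram_rel_def using strong_gram_congruent_trans Quad_A_tri_gram_carrier by blast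
qed

lemma cycle_type_invariant:
  assumes "(q, q') \<in> strong_gram_rel c n" and m: "m = n - c + 1"
  shows "cycle_type m n q = cycle_type m n q'"
proof -
  have q: "q \<in> Quad_A c n" and q': "q' \<in> Quad_A c n" and s: "strong_gram_congruent n q q'"
    using assms by (auto simp: strong_gram_rel_def)
  obtain I K S \<xi> where A: "coxeter_datum m n 0 I (tri_gram n q) K S \<xi>" and ct: "cycle_type m n q = orbit_partition m \<xi>"
    by (rule Quad_A_datum[OF q m])
  obtain I' K' S' \<xi>' where A': "coxeter_datum m n 0 I' (tri_gram n q') K' S' \<xi>'" and ct': "cycle_type m n q' = orbit_partition m \<xi>'"
    by (rule Quad_A_datum[OF q' m])
  obtain B where B: "B \<in> carrier_mat n n" "invertible_mat B" "tri_gram n q' = transpose_mat B * tri_gram n q * B"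
    using s by (auto simp: strong_gram_congruent_def)
  show ?thesis
    unfolding ct ct' by (rule orbit_partition_eq_of_similar[OF A A' char_poly_coxeter_congruent[OF A A' B]])
qed

lemma cycle_type_complete:
  assumes q: "q \<in> Quad_A c n" and q': "q' \<in> Quad_A c n" and m: "m = n - c + 1"
    and eq: "cycle_type m n q = cycle_type m n q'"
  shows "(q, q') \<in> strong_gram_rel c n"
proof -
  obtain I K S \<xi> where A: "coxeter_datum m n 0 I (tri_gram n q) K S \<xi>" and ct: "cycle_type m n q = orbit_partition m \<xi>"
    and d: "det (tri_gram n q) = 1"
    by (rule Quad_A_datum[OF q m])
  obtain I' K' S' \<xi>' where A': "coxeter_datum m n 0 I' (tri_gram n q') K' S' \<xi>'" and ct': "cycle_type m n q' = orbit_partition m \<xi>'"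
    and d': "det (tri_gram n q') = 1"
    by (rule Quad_A_datum[OF q' m])
  interpret A: coxeter_datum m n 0 I "tri_gram n q" K S \<xi> by (rule A)
  interpret A': coxeter_datum m n 0 I' "tri_gram n q'" K' S' \<xi>' by (rule A')
  \<comment> \<open>Relabelling the vertices of the first quiver by \<sigma> keeps its form and
    makes the two Laplacians equal.\<close>
  obtain \<sigma> where \<sigma>: "\<sigma> permutes {..<m}" "\<And>v. \<sigma> (\<xi> v) = \<xi>' (\<sigma> v)"
    by (rule conjugate_of_orbit_partition[OF A.perm A'.perm]) (use eq ct ct' in auto)
  have "\<sigma> \<circ> \<xi> \<circ> inv \<sigma> = \<xi>'"
    using \<sigma> by (auto simp: fun_eq_iff permutes_inverses[OF \<sigma>(1)])
  then have R: "coxeter_datum m n (\<sigma> 0) (perm_mat m \<sigma> * I) (tri_gram n q) K (S * perm_mat m (inv \<sigma>)) \<xi>'"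
    using A.relabel[OF \<sigma>(1)] by simp
  obtain X where X: "X \<in> carrier_mat n n" and
    cong: "transpose_mat X * tri_gram n q * X = tri_gram n q' \<or> transpose_mat X * tri_gram n q' * X = tri_gram n q"
    using coxeter_datum_isometry[OF R A'] by blast
  from cong show ?thesis
  proof
    assume e: "transpose_mat X * tri_gram n q * X = tri_gram n q'"
    then have "invertible_mat X" using unimodular_congruence_invertible[OF X A.G e d d'] by simp
    then have "strong_gram_congruent n q q'" using e X by (auto simp: strong_gram_congruent_def intro!: bexI[of _ X])
    then show ?thesis using q q' by (simp add: strong_gram_rel_def)
  next
    assume e: "transpose_mat X * tri_gram n q' * X = tri_gram n q"
    then have "invertible_mat X" using unimodular_congruence_invertible[OF X A'.G e d' d] by simp
    then have "strong_gram_congruent n q' q" using e X by (auto simp: strong_gram_congruent_def intro!: bexI[of _ X])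
    then have "strong_gram_congruent n q q'" by (rule strong_gram_congruent_sym[OF A'.G])
    then show ?thesis using q q' by (simp add: strong_gram_rel_def)
  qed
qed

text \<open>The bound on the length comes from the inclusion of the reduced radical in the radical,
  the parity from the determinant of \<Phi>.\<close>

lemma cycle_type_Part1:
  assumes q: "q \<in> Quad_A c n" and m: "m = n - c + 1" "2 \<le> m"
  shows "cycle_type m n q \<in> Part1 c m"
proof -
  obtain I K S \<xi> where A: "coxeter_datum m n 0 I (tri_gram n q) K S \<xi>" and ct: "cycle_type m n q = orbit_partition m \<xi>"
    and gram: "gram n q = transpose_mat I * I" and d: "det (tri_gram n q) = 1"
    by (rule Quad_A_datum[OF q m(1)])
  interpret A: coxeter_datum m n 0 I "tri_gram n q" K S \<xi> by (rule A)
  have P: "A.\<pi> \<in> Part m" by (rule orbit_partition_Part[OF A.perm])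
  then have l: "0 < length A.\<pi>" using m by (auto simp: Part_def)
  have "reduced_corank n q \<le> corank n q"
    unfolding reduced_corank_def corank_def by (rule int_rank_mono) (auto simp: reduced_rad_def rad_def)
  then have le: "length A.\<pi> - 1 \<le> c"
    using A.reduced_corank_eq[OF gram refl] q by (simp add: Quad_A_def)
  have "int n = int m + int c - 1" using m by simp
  moreover have "even (int m + int (length A.\<pi>) + int n)"
    using A.length_parity[OF d] by (simp flip: of_nat_add)
  ultimately have "even (int c - (int (length A.\<pi>) - 1))" by presburger
  then show ?thesis using P le l by (auto simp: Part1_def ct even_iff_mod_2_eq_zero)
qed

lemma cycle_type_surj:
  assumes \<pi>: "\<pi> \<in> Part1 c m" and m: "m = n - c + 1" "2 \<le> m"
  shows "\<exists>q\<in>Quad_A c n. cycle_type m n q = \<pi>"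
proof -
  have c: "c + m = n + 1" using m by simp
  obtain ps where ps: "path_quiver m n ps" "path_perm ps = block_cycle \<pi>"
    by (rule partition_path_quiver[OF \<pi> c m(2)])
  interpret P: path_quiver m n ps by (rule ps(1))
  obtain K S \<xi> where A: "coxeter_datum m n 0 (incidence_mat m n P.Q) (tri_gram n P.q) K S \<xi>"
    and ct: "quiver_cycle_type m n P.Q = orbit_partition m \<xi>"
    by (rule quiver_coxeter_datum[OF P.Q_quiver P.Q_loopfree P.Q_connected])
  interpret A: coxeter_datum m n 0 "incidence_mat m n P.Q" "tri_gram n P.q" K S \<xi> by (rule A)
  have inc: "incidence_mat m n P.Q = P.Inc" by (rule P.incidence_mat_eq[OF P.Q_tail_head])
  have tri: "tri_gram n P.q = P.Tri" by (rule P.tri_gram_quiver_form(1)[OF P.Q_tail_head])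
  have ap: "arrow_perm (\<lambda>j. ps ! j) (\<lambda>j. Suc (ps ! j)) [0..<n] = block_cycle \<pi>"
    using arrow_perm_path[of ps] ps(2) P.len by simp
  have "perm_mat m \<xi> = perm_mat m (block_cycle \<pi>)"
    using P.Inc_laplacian[OF A.K] A.GK(1) A.laplacian unfolding inc tri ap by simp
  moreover have "block_cycle \<pi> permutes {..<m}"
    using P.arrow_perm_permutes[of "[0..<n]"] unfolding ap by (simp add: atLeast0LessThan)
  ultimately have "\<xi> = block_cycle \<pi>" using perm_mat_inj[OF A.perm] by blast
  then have "cycle_type m n P.q = \<pi>"
    using cycle_type_quiver_form[OF P.Q_quiver P.Q_loopfree P.Q_connected] ct
      orbit_partition_block_cycle[of \<pi> m] \<pi> by (simp add: Part1_def)
  then show ?thesis using P.q_Quad_A[OF c] by blast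
qed

text \<open>For \<open>c = 0\<close> the factor \<open>(\<lambda> - 1)^(c - 1)\<close> has exponent
  -1, so the formula for the Coxeter polynomial is an identity in the field of fractions of the
  polynomial ring. A class is sent to the only element of its image under the cycle type.\<close>

theorem theoremC:
  fixes n c m :: nat
  assumes "1 \<le> n" and "m = n - c + 1" and "2 \<le> m"
  shows "cycle_type m n \<in> Quad_A c n \<rightarrow> Part m \<and>
    cycle_type m n respects strong_gram_rel c n \<and>
    bij_betw (\<lambda>C. the_elem (cycle_type m n ` C)) (Quad_A c n // strong_gram_rel c n) (Part1 c m) \<and>
    (\<forall>q \<in> Quad_A c n. \<forall>\<pi>. \<pi> = cycle_type m n q \<longrightarrow>
       to_fract (coxeter_poly n q) =
         to_fract [:-1, 1:] powi (int c - 1) * (\<Prod>k\<leftarrow>\<pi>. to_fract (monom 1 k - 1)) \<and>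
       coxeter_number n q = (if length \<pi> = 1 then enat (\<pi> ! 0) else \<infinity>) \<and>
       reduced_coxeter_number n q = enat (Lcm (set \<pi>)) \<and>
       geom_mult (coxeter_mat n q) 1 = c \<and>
       int (reduced_corank n q) = int (length \<pi>) - 1 \<and>
       int (alg_mult (coxeter_mat n q) 1) = int c + (int (length \<pi>) - 1))"
proof (intro conjI ballI allI impI)
  note m = assms(2,3)
  have cm: "c + m = n + 1" using m by simp
  let ?r = "strong_gram_rel c n" and ?ct = "cycle_type m n"
  show "?ct \<in> Quad_A c n \<rightarrow> Part m" using cycle_type_Part1[OF _ m] by (auto simp: Part1_def)
  show "?ct respects ?r" unfolding congruent_def using cycle_type_invariant[OF _ m(1)] by blast
  have el: "the_elem (?ct ` (?r `` {q})) = ?ct q" if q: "q \<in> Quad_A c n" for q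
  proof -
    have "?ct ` (?r `` {q}) = {?ct q}"
    proof (intro equalityI subsetI)
      fix \<pi> assume "\<pi> \<in> ?ct ` (?r `` {q})"
      then obtain q' where "(q, q') \<in> ?r" "\<pi> = ?ct q'" by auto
      then show "\<pi> \<in> {?ct q}" using cycle_type_invariant[OF _ m(1)] by simp
    next
      fix \<pi> assume "\<pi> \<in> {?ct q}"
      moreover have "q \<in> ?r `` {q}" by (rule equiv_class_self[OF equiv_strong_gram_rel q])
      ultimately show "\<pi> \<in> ?ct ` (?r `` {q})" by blast
    qed
    then show ?thesis by simp
  qed
  show "bij_betw (\<lambda>C. the_elem (?ct ` C)) (Quad_A c n // ?r) (Part1 c m)"
    unfolding bij_betw_def
  proof
    show "inj_on (\<lambda>C. the_elem (?ct ` C)) (Quad_A c n // ?r)"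
    proof (rule inj_onI)
      fix C D assume "C \<in> Quad_A c n // ?r" "D \<in> Quad_A c n // ?r" and e: "the_elem (?ct ` C) = the_elem (?ct ` D)"
      then obtain q q' where q: "q \<in> Quad_A c n" "C = ?r `` {q}" and q': "q' \<in> Quad_A c n" "D = ?r `` {q'}"
        by (metis quotientE)
      have "?ct q = ?ct q'" using e el q q' by simp
      then have "(q, q') \<in> ?r" using cycle_type_complete[OF q(1) q'(1) m(1)] by blast
      then show "C = D" using equiv_class_eq[OF equiv_strong_gram_rel] q(2) q'(2) by blast
    qed
    show "(\<lambda>C. the_elem (?ct ` C)) ` (Quad_A c n // ?r) = Part1 c m"
    proof (intro equalityI subsetI)
      fix \<pi> assume "\<pi> \<in> (\<lambda>C. the_elem (?ct ` C)) ` (Quad_A c n // ?r)"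
      then obtain q where "q \<in> Quad_A c n" "\<pi> = the_elem (?ct ` (?r `` {q}))" by (auto simp: quotient_def)
      then show "\<pi> \<in> Part1 c m" using el cycle_type_Part1[OF _ m] by simp
    next
      fix \<pi> assume "\<pi> \<in> Part1 c m"
      then obtain q where q: "q \<in> Quad_A c n" "?ct q = \<pi>" using cycle_type_surj[OF _ m] by blast
      then show "\<pi> \<in> (\<lambda>C. the_elem (?ct ` C)) ` (Quad_A c n // ?r)"
        using el[OF q(1)] by (intro image_eqI[of _ _ "?r `` {q}"]) (auto intro: quotientI)
    qed
  qed
  fix q \<pi> assume q: "q \<in> Quad_A c n" and \<pi>: "\<pi> = ?ct q"
  obtain I K S \<xi> where A: "coxeter_datum m n 0 I (tri_gram n q) K S \<xi>" and ct: "?ct q = orbit_partition m \<xi>"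
    and cox: "coxeter_mat n q = - (transpose_mat (tri_gram n q) * K)"
    and gram: "gram n q = transpose_mat I * I"
    by (rule Quad_A_datum[OF q m(1)])
  interpret A: coxeter_datum m n 0 I "tri_gram n q" K S \<xi> by (rule A)
  have \<Phi>: "coxeter_mat n q = A.\<Phi>" by (simp add: cox A.\<Phi>_def)
  have \<pi>\<xi>: "\<pi> = A.\<pi>" using \<pi> ct by simp
  have l: "0 < length A.\<pi>" using orbit_partition_Part[OF A.perm] m(2) by (auto simp: Part_def)
  show "coxeter_number n q = (if length \<pi> = 1 then enat (\<pi> ! 0) else \<infinity>)"
    unfolding coxeter_number_def \<Phi> \<pi>\<xi> by (rule A.coxeter_number_eq)
  show "reduced_coxeter_number n q = enat (Lcm (set \<pi>))"
    unfolding reduced_coxeter_number_def \<Phi> \<pi>\<xi> by (rule A.reduced_coxeter_number_eq)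
  show "geom_mult (coxeter_mat n q) 1 = c"
    unfolding \<Phi> using A.geom_mult_\<Phi>[OF refl] cm by simp
  show "int (reduced_corank n q) = int (length \<pi>) - 1"
    unfolding \<pi>\<xi> A.reduced_corank_eq[OF gram refl] using l by linarith
  show "int (alg_mult (coxeter_mat n q) 1) = int c + (int (length \<pi>) - 1)"
    unfolding \<Phi> \<pi>\<xi> using A.alg_mult_\<Phi> cm l by linarith
  show "to_fract (coxeter_poly n q) =
    to_fract [:-1, 1:] powi (int c - 1) * (\<Prod>k\<leftarrow>\<pi>. to_fract (monom 1 k - 1))"
  proof -
    let ?x = "to_fract [:-1, 1 :: int:]"
    have x0: "?x \<noteq> 0" by simp
    have pow: "to_fract (p ^ k) = to_fract p ^ k" for p :: "int poly" and k
      by (induction k) simp_all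
    have prod: "to_fract (\<Prod>k\<leftarrow>\<rho>. monom 1 k - 1 :: int poly) = (\<Prod>k\<leftarrow>\<rho>. to_fract (monom 1 k - 1))" for \<rho>
      by (induction \<rho>) (simp_all del: to_fract_diff)
    have "to_fract (coxeter_poly n q) * ?x ^ m = (\<Prod>k\<leftarrow>\<pi>. to_fract (monom 1 k - 1)) * ?x ^ n"
      using arg_cong[OF A.coxeter_poly, of to_fract]
      unfolding coxeter_poly_def \<Phi> \<pi>\<xi> by (simp only: to_fract_mult pow prod)
    moreover have "?x ^ n = ?x powi (int c - 1) * ?x ^ m"
    proof -
      have "?x powi (int c - 1) * ?x ^ m = ?x powi (int c - 1) * ?x powi int m"
        by (simp add: power_int_of_nat)
      also have "\<dots> = ?x powi (int c - 1 + int m)" using x0 by (simp add: power_int_add)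
      also have "int c - 1 + int m = int n" using cm by simp
      finally show ?thesis by (simp add: power_int_of_nat)
    qed
    ultimately have "to_fract (coxeter_poly n q) * ?x ^ m =
        (?x powi (int c - 1) * (\<Prod>k\<leftarrow>\<pi>. to_fract (monom 1 k - 1))) * ?x ^ m"
      by (simp only: mult_ac)
    then show ?thesis by (simp only: mult_right_cancel[OF power_not_zero[OF x0]])
  qed
qed

end
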